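(* Let $\mathfrak A=\mathfrak A_0\oplus\mathfrak A_1$ (resp. $\mathfrak B=\mathfrak B_0\oplus\mathfrak B_1$) be a Leibniz superalgebra over a field $k$ with a linear basis $A=A_0\cup A_1$ (resp. $B=B_0\cup B_1$), where $A_i$ (resp. $B_i$) is a linear basis of $\mathfrak A_i$ (resp. $\mathfrak B_i$), $i=0,1$, and with multiplication table $(aa')=0$, $a,a'\in A$ (resp. $(bb')=\{b\cdot b'\}$, $b,b'\in B$). Then a Leibniz superalgebra $\mathfrak E$ is an extension of $\mathfrak B$ by $\mathfrak A$ if and only if $$\mathfrak E\cong\mathrm{Lb}_s\left(A\cup B\ \left|\ \begin{array}{ll}(aa'), & a,a'\in A\\ (ab)-\{a\cdot b\},\ (ba)-\{b\cdot a\}, & a\in A,\ b\in B\\ (bb')-\{b\cdot b'\}-\lfloor b,b'\rfloor, & b,b'\in B\end{array}\right.\right)$$ for some $\mathfrak B$-supermodule structure on $\mathfrak A$ (with operation denoted $\cdot$) and some bilinear map $\lfloor\,,\rfloor:\mathfrak B\times\mathfrak B\to\mathfrak A$ with $|\lfloor b,b'\rfloor|=|b|+|b'|$ for $b,b'\in B$ (i.e. $\lfloor b,b'\rfloor\in\mathfrak A_{|b|+|b'|}$), such that for all $b,b',b''\in B$, $$\{\lfloor b'',b\rfloor\cdot b'\}-(-1)^{|b||b'|}\{\lfloor b'',b'\rfloor\cdot b\}-\{b''\cdot\lfloor b,b'\rfloor\}+\lfloor\{b''\cdot b\},b'\rfloor-(-1)^{|b||b'|}\lfloor\{b''\cdot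 b'\},b\rfloor-\lfloor b'',\{b\cdot b'\}\rfloor=0.$$ If this is the case, then $\mathfrak E$ is isomorphic to the superalgebra $$E_{(\mathfrak A,\mathfrak B,\lfloor\ \rfloor,\cdot)}:=\mathrm{Lb}_s\left(A\cup B\ \left|\ \begin{array}{ll}(aa'), & a,a'\in A\\ (ab)-\{a\cdot b\},\ (ba)-\{b\cdot a\}, & a\in A,\ b\in B\\ (bb')-\{b\cdot b'\}-\lfloor b,b'\rfloor, & b,b'\in B\end{array}\right.\right),$$ which equals $\mathfrak A\oplus\mathfrak B$ as a vector space, with multiplication given, for all $a,a'\in A$ and $b,b'\in B$, by $$((a+b)(a'+b'))=\{a\cdot b'\}+\{b\cdot a'\}+\lfloor b,b'\rfloor+\{b\cdot b'\}.$$
   Context: $k$ is a field. A superalgebra is a $k$-vector space $\mathcal A=\mathcal A_0\oplus\mathcal A_1$ with a bilinear product $(xy)$ such that $(\mathcal A_i\mathcal A_j)\subseteq\mathcal A_{i+j}$ (indices in $\mathbb Z_2$); $|x|=i$ for $x\in\mathcal A_i$. It is a Leibniz superalgebra if $(x(yz))=((xy)z)-(-1)^{|z||y|}((xz)y)$ for all homogeneous $x,y,z$. Homomorphisms are parity-preserving linear multiplicative maps. $\mathfrak E$ is an extension of $\mathfrak B$ by $\mathfrak A$ if there is a short exact sequence $0\to\mathfrak A\to\mathfrak E\to\mathfrak B\to0$ of Leibniz superalgebras. $\mathrm{Lb}_s(X\mid S)$ is the quotient of the free Leibniz superalgebra $\mathrm{Lb}_s(X)$ over $k$ on $X=X_0\cup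 X_1$ (elements of $X_i$ of parity $i$) by the two-sided ideal generated by the homogeneous set $S$. Here $A$ and $B$ are taken disjoint. A supermodule over a Leibniz superalgebra $\mathfrak B$ is a vector space $\mathfrak A=\mathfrak A_0\oplus\mathfrak A_1$ with bilinear maps $\mathfrak B\times\mathfrak A\to\mathfrak A$, $(x,f)\mapsto x\cdot f$ and $\mathfrak A\times\mathfrak B\to\mathfrak A$, $(f,x)\mapsto f\cdot x$ with $\mathfrak A_i\cdot\mathfrak B_j,\ \mathfrak B_i\cdot\mathfrak A_j\subseteq\mathfrak A_{i+j}$ and, for homogeneous $f\in\mathfrak A$, $x,y\in\mathfrak B$: $f\cdot(xy)=(f\cdot x)\cdot y-(-1)^{|x||y|}(f\cdot y)\cdot x$; $x\cdot(y\cdot f)=(xy)\cdot f-(-1)^{|f||y|}(x\cdot f)\cdot y$; $x\cdot(f\cdot y)=(x\cdot f)\cdot y-(-1)^{|f||y|}(xy)\cdot f$. Notation: for $x\in\mathfrak A$, $y\in\mathfrak B$, $\{x\cdot y\}$ and $\{y\cdot x\}$ denote $x\cdot y,\ y\cdot x\in\mathfrak A$ written as linear combinations of elements of $A$; for $x,y\in\mathfrak B$, $\{x\cdot y\}$ is the product $(xy)$ in $\mathfrak B$ written as a linear combination of elements of $B$. Such linear combinations (and $\lfloor b,b'\rfloor\in\mathfrak A$) are regarded as elements of $\mathrm{Lb}_s(A\cup B)$. *)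

theory Defs
  imports "HOL-Algebra.QuotRing" "HOL-Algebra.Module" "HOL-Library.Z2"
begin

section \<open>Linear algebra over a field \<open>K\<close>\<close>

definition linear_map ::
  "('k, 'r) ring_scheme \<Rightarrow> ('k, 'v, 'm) module_scheme \<Rightarrow> ('k, 'w, 'n) module_scheme \<Rightarrow> ('v \<Rightarrow> 'w) \<Rightarrow> bool"
  where "linear_map K V W h \<longleftrightarrow>
    h \<in> carrier V \<rightarrow> carrier W \<and>
    (\<forall>x\<in>carrier V. \<forall>y\<in>carrier V. h (x \<oplus>\<^bsub>V\<^esub> y) = h x \<oplus>\<^bsub>W\<^esub> h y) \<and>
    (\<forall>c\<in>carrier K. \<forall>x\<in>carrier V. h (c \<odot>\<^bsub>V\<^esub> x) = c \<odot>\<^bsub>W\<^esub> h x)"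

definition bilinear_map ::
  "('k, 'r) ring_scheme \<Rightarrow> ('k, 'u, 'l) module_scheme \<Rightarrow> ('k, 'v, 'm) module_scheme \<Rightarrow>
    ('k, 'w, 'n) module_scheme \<Rightarrow> ('u \<Rightarrow> 'v \<Rightarrow> 'w) \<Rightarrow> bool"
  where "bilinear_map K U V W f \<longleftrightarrow>
    (\<forall>x\<in>carrier U. linear_map K V W (\<lambda>y. f x y)) \<and>
    (\<forall>y\<in>carrier V. linear_map K U W (\<lambda>x. f x y))"

definition lin_comb :: "('k, 'v, 'm) module_scheme \<Rightarrow> ('v \<Rightarrow> 'k) \<Rightarrow> 'v set \<Rightarrow> 'v"
  where "lin_comb V c F = (\<Oplus>\<^bsub>V\<^esub>v\<in>F. c v \<odot>\<^bsub>V\<^esub> v)"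

definition lin_span :: "('k, 'r) ring_scheme \<Rightarrow> ('k, 'v, 'm) module_scheme \<Rightarrow> 'v set \<Rightarrow> 'v set"
  where "lin_span K V S =
    {lin_comb V c F | c F. finite F \<and> F \<subseteq> S \<and> c \<in> F \<rightarrow> carrier K}"

definition lin_indep :: "('k, 'r) ring_scheme \<Rightarrow> ('k, 'v, 'm) module_scheme \<Rightarrow> 'v set \<Rightarrow> bool"
  where "lin_indep K V S \<longleftrightarrow>
    (\<forall>F c. finite F \<longrightarrow> F \<subseteq> S \<longrightarrow> c \<in> F \<rightarrow> carrier K \<longrightarrow> lin_comb V c F = \<zero>\<^bsub>V\<^esub> \<longrightarrow>
      (\<forall>v\<in>F. c v = \<zero>\<^bsub>K\<^esub>))"

text \<open>\<open>S\<close> is a linear basis of the subspace \<open>U\<close> of \<open>V\<close>.\<close>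
definition linear_basis ::
  "('k, 'r) ring_scheme \<Rightarrow> ('k, 'v, 'm) module_scheme \<Rightarrow> 'v set \<Rightarrow> 'v set \<Rightarrow> bool"
  where "linear_basis K V U S \<longleftrightarrow> S \<subseteq> carrier V \<and> lin_indep K V S \<and> lin_span K V S = U"

text \<open>The coordinates of \<open>v\<close> with respect to a linear basis \<open>S\<close> of \<open>V\<close>, extended by zero
  outside \<open>S\<close>.\<close>
definition coords ::
  "('k, 'r) ring_scheme \<Rightarrow> ('k, 'v, 'm) module_scheme \<Rightarrow> 'v set \<Rightarrow> 'v \<Rightarrow> 'v \<Rightarrow> 'k"
  where "coords K V S v =
    (THE c. range c \<subseteq> carrier K \<and> finite {s. c s \<noteq> \<zero>\<^bsub>K\<^esub>} \<and> {s. c s \<noteq> \<zero>\<^bsub>K\<^esub>} \<subseteq> S \<and>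
      lin_comb V c {s. c s \<noteq> \<zero>\<^bsub>K\<^esub>} = v)"

text \<open>Write \<open>v \<in> V\<close> as a linear combination of elements of the basis \<open>S\<close> and read it in \<open>W\<close>,
  where \<open>s \<in> S\<close> is regarded as the element \<open>g s\<close> of \<open>W\<close>.\<close>
definition read_in ::
  "('k, 'r) ring_scheme \<Rightarrow> ('k, 'v, 'm) module_scheme \<Rightarrow> 'v set \<Rightarrow>
    ('k, 'w, 'n) module_scheme \<Rightarrow> ('v \<Rightarrow> 'w) \<Rightarrow> 'v \<Rightarrow> 'w"
  where "read_in K V S W g v =
    (\<Oplus>\<^bsub>W\<^esub>s\<in>{s. coords K V S v s \<noteq> \<zero>\<^bsub>K\<^esub>}. coords K V S v s \<odot>\<^bsub>W\<^esub> g s)"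

text \<open>Only the vector space structure of the direct sum is meaningful: a \<open>module\<close> record
  inherits the fields \<open>mult\<close> and \<open>one\<close>, which are left unspecified.\<close>
definition direct_sum ::
  "('k, 'v, 'm) module_scheme \<Rightarrow> ('k, 'w, 'n) module_scheme \<Rightarrow> ('k, 'v \<times> 'w) module"
  where "direct_sum V W =
    \<lparr>carrier = carrier V \<times> carrier W, mult = undefined, one = undefined,
     zero = (\<zero>\<^bsub>V\<^esub>, \<zero>\<^bsub>W\<^esub>),
     add = (\<lambda>(x, y) (x', y'). (x \<oplus>\<^bsub>V\<^esub> x', y \<oplus>\<^bsub>W\<^esub> y')),
     smult = (\<lambda>c (x, y). (c \<odot>\<^bsub>V\<^esub> x, c \<odot>\<^bsub>W\<^esub> y))\<rparr>"


section \<open>Superalgebras\<close>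

text \<open>The index set \<open>\<int>\<^sub>2\<close> of the grading is the type \<open>bit\<close>, with its own addition and
  multiplication. The product is the field \<open>mult\<close>; it need be neither associative nor unital, and
  the field \<open>one\<close> inherited from \<open>module\<close> plays no role.\<close>
record ('k, 'v) superalgebra = "('k, 'v) module" +
  part :: "bit \<Rightarrow> 'v set"

locale superalgebra = field K + module K V
  for K :: "('k, 'r) ring_scheme" and V :: "('k, 'v, 'm) superalgebra_scheme" +
  assumes part_subspace: "submodule (part V i) K V"
    and part_sum: "carrier V = part V 0 <+>\<^bsub>V\<^esub> part V 1"
    and part_direct: "part V 0 \<inter> part V 1 = {\<zero>\<^bsub>V\<^esub>}"
    and mult_bilinear: "bilinear_map K V V V (\<lambda>x y. x \<otimes>\<^bsub>V\<^esub> y)"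
    and mult_graded: "x \<in> part V i \<Longrightarrow> y \<in> part V j \<Longrightarrow> x \<otimes>\<^bsub>V\<^esub> y \<in> part V (i + j)"

text \<open>\<open>sgn_pow K i\<close> is \<open>(-1)\<^sup>i\<close> in \<open>K\<close>.\<close>
definition sgn_pow :: "('k, 'r) ring_scheme \<Rightarrow> bit \<Rightarrow> 'k"
  where "sgn_pow K i = (if i = 0 then \<one>\<^bsub>K\<^esub> else \<ominus>\<^bsub>K\<^esub> \<one>\<^bsub>K\<^esub>)"

locale leibniz_superalgebra = superalgebra +
  assumes leibniz:
    "x \<in> part V i \<Longrightarrow> y \<in> part V j \<Longrightarrow> z \<in> part V l \<Longrightarrow>
      x \<otimes>\<^bsub>V\<^esub> (y \<otimes>\<^bsub>V\<^esub> z) =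
        ((x \<otimes>\<^bsub>V\<^esub> y) \<otimes>\<^bsub>V\<^esub> z) \<ominus>\<^bsub>V\<^esub> sgn_pow K (l * j) \<odot>\<^bsub>V\<^esub> ((x \<otimes>\<^bsub>V\<^esub> z) \<otimes>\<^bsub>V\<^esub> y)"

definition superalgebra_hom ::
  "('k, 'r) ring_scheme \<Rightarrow> ('k, 'v, 'm) superalgebra_scheme \<Rightarrow> ('k, 'w, 'n) superalgebra_scheme \<Rightarrow>
    ('v \<Rightarrow> 'w) \<Rightarrow> bool"
  where "superalgebra_hom K V W h \<longleftrightarrow>
    linear_map K V W h \<and>
    (\<forall>x\<in>carrier V. \<forall>y\<in>carrier V. h (x \<otimes>\<^bsub>V\<^esub> y) = h x \<otimes>\<^bsub>W\<^esub> h y) \<and>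
    (\<forall>i. h ` part V i \<subseteq> part W i)"

definition superalgebra_isomorphic ::
  "('k, 'r) ring_scheme \<Rightarrow> ('k, 'v, 'm) superalgebra_scheme \<Rightarrow> ('k, 'w, 'n) superalgebra_scheme \<Rightarrow> bool"
  where "superalgebra_isomorphic K V W \<longleftrightarrow>
    (\<exists>h. superalgebra_hom K V W h \<and> bij_betw h (carrier V) (carrier W))"

text \<open>\<open>E\<close> is an extension of \<open>B\<close> by \<open>A\<close>.\<close>
definition is_extension ::
  "('k, 'r) ring_scheme \<Rightarrow> ('k, 'e, 'l) superalgebra_scheme \<Rightarrow> ('k, 'b, 'm) superalgebra_scheme \<Rightarrow>
    ('k, 'a, 'n) superalgebra_scheme \<Rightarrow> bool"
  where "is_extension K E B A \<longleftrightarrow>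
    leibniz_superalgebra K E \<and> leibniz_superalgebra K B \<and> leibniz_superalgebra K A \<and>
    (\<exists>f g. superalgebra_hom K A E f \<and> superalgebra_hom K E B g \<and>
      inj_on f (carrier A) \<and>
      f ` carrier A = {x \<in> carrier E. g x = \<zero>\<^bsub>B\<^esub>} \<and>
      g ` carrier E = carrier B)"

text \<open>\<open>lft x f\<close> is \<open>x \<cdot> f\<close> and \<open>rgt f x\<close> is \<open>f \<cdot> x\<close>, for \<open>x \<in> B\<close> and \<open>f \<in> A\<close>. Only the graded
  vector space underlying \<open>A\<close> is used.\<close>
definition supermodule ::
  "('k, 'r) ring_scheme \<Rightarrow> ('k, 'b, 'm) superalgebra_scheme \<Rightarrow> ('k, 'a, 'n) superalgebra_scheme \<Rightarrow>
    ('b \<Rightarrow> 'a \<Rightarrow> 'a) \<Rightarrow> ('a \<Rightarrow> 'b \<Rightarrow> 'a) \<Rightarrow> bool"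
  where "supermodule K B A lft rgt \<longleftrightarrow>
    bilinear_map K B A A lft \<and> bilinear_map K A B A rgt \<and>
    (\<forall>i j. \<forall>f\<in>part A i. \<forall>x\<in>part B j. rgt f x \<in> part A (i + j)) \<and>
    (\<forall>i j. \<forall>x\<in>part B i. \<forall>f\<in>part A j. lft x f \<in> part A (i + j)) \<and>
    (\<forall>i j l. \<forall>f\<in>part A i. \<forall>x\<in>part B j. \<forall>y\<in>part B l.
      rgt f (x \<otimes>\<^bsub>B\<^esub> y) = rgt (rgt f x) y \<ominus>\<^bsub>A\<^esub> sgn_pow K (j * l) \<odot>\<^bsub>A\<^esub> rgt (rgt f y) x \<and>
      lft x (lft y f) = lft (x \<otimes>\<^bsub>B\<^esub> y) f \<ominus>\<^bsub>A\<^esub> sgn_pow K (i * l) \<odot>\<^bsub>A\<^esub> rgt (lft x f) y \<and>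
      lft x (rgt f y) = rgt (lft x f) y \<ominus>\<^bsub>A\<^esub> sgn_pow K (i * l) \<odot>\<^bsub>A\<^esub> lft (x \<otimes>\<^bsub>B\<^esub> y) f)"


section \<open>Ideals and quotients\<close>

definition two_sided_ideal ::
  "('k, 'r) ring_scheme \<Rightarrow> ('k, 'v, 'm) superalgebra_scheme \<Rightarrow> 'v set \<Rightarrow> bool"
  where "two_sided_ideal K V I \<longleftrightarrow>
    submodule I K V \<and>
    (\<forall>x\<in>carrier V. \<forall>y\<in>I. x \<otimes>\<^bsub>V\<^esub> y \<in> I \<and> y \<otimes>\<^bsub>V\<^esub> x \<in> I)"

definition ideal_generated ::
  "('k, 'r) ring_scheme \<Rightarrow> ('k, 'v, 'm) superalgebra_scheme \<Rightarrow> 'v set \<Rightarrow> 'v set"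
  where "ideal_generated K V S = \<Inter>{I. two_sided_ideal K V I \<and> S \<subseteq> I}"

text \<open>The grading on the quotient is well defined only when \<open>I\<close> is generated by homogeneous
  elements, as is the case in all uses below.\<close>
definition superalgebra_quot ::
  "('k, 'v, 'm) superalgebra_scheme \<Rightarrow> 'v set \<Rightarrow> ('k, 'v set) superalgebra"
  where "superalgebra_quot V I =
    \<lparr>carrier = a_rcosets\<^bsub>V\<^esub> I, mult = rcoset_mult V I, one = undefined,
     zero = I, add = set_add V,
     smult = (\<lambda>c C. \<Union>x\<in>C. I +>\<^bsub>V\<^esub> (c \<odot>\<^bsub>V\<^esub> x)),
     part = (\<lambda>i. (\<lambda>x. I +>\<^bsub>V\<^esub> x) ` part V i)\<rparr>"


section \<open>Free Leibniz superalgebras and presentations\<close>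

datatype 'x word = Gen 'x | Prod "'x word" "'x word"

text \<open>Below, \<open>words X i\<close> is the set of nonassociative words of parity \<open>i\<close> in the generators
  \<open>X 0 \<union> X 1\<close>, where the elements of \<open>X i\<close> have parity \<open>i\<close>; \<open>X 0\<close> and \<open>X 1\<close> are meant to be disjoint.\<close>
inductive_set words_par :: "(bit \<Rightarrow> 'x set) \<Rightarrow> ('x word \<times> bit) set"
  for X :: "bit \<Rightarrow> 'x set"
  where
    "x \<in> X i \<Longrightarrow> (Gen x, i) \<in> words_par X"
  | "(u, i) \<in> words_par X \<Longrightarrow> (v, j) \<in> words_par X \<Longrightarrow> (Prod u v, i + j) \<in> words_par X"

definition words :: "(bit \<Rightarrow> 'x set) \<Rightarrow> bit \<Rightarrow> 'x word set"
  where "words X i = {w. (w, i) \<in> words_par X}"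

text \<open>The free nonassociative superalgebra on \<open>X\<close>: finitely supported functions on words.\<close>
definition free_superalgebra ::
  "('k, 'r) ring_scheme \<Rightarrow> (bit \<Rightarrow> 'x set) \<Rightarrow> ('k, 'x word \<Rightarrow> 'k) superalgebra"
  where "free_superalgebra K X =
    (let fin_supp = (\<lambda>W. {p. range p \<subseteq> carrier K \<and> finite {w. p w \<noteq> \<zero>\<^bsub>K\<^esub>} \<and> {w. p w \<noteq> \<zero>\<^bsub>K\<^esub>} \<subseteq> W})
     in \<lparr>carrier = fin_supp (words X 0 \<union> words X 1),
         mult = (\<lambda>p q w. case w of Gen x \<Rightarrow> \<zero>\<^bsub>K\<^esub> | Prod u v \<Rightarrow> p u \<otimes>\<^bsub>K\<^esub> q v),
         one = undefined,
         zero = (\<lambda>w. \<zero>\<^bsub>K\<^esub>),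
         add = (\<lambda>p q w. p w \<oplus>\<^bsub>K\<^esub> q w),
         smult = (\<lambda>c p w. c \<otimes>\<^bsub>K\<^esub> p w),
         part = (\<lambda>i. fin_supp (words X i))\<rparr>)"

definition free_gen :: "('k, 'r) ring_scheme \<Rightarrow> 'x \<Rightarrow> 'x word \<Rightarrow> 'k"
  where "free_gen K x = (\<lambda>w. if w = Gen x then \<one>\<^bsub>K\<^esub> else \<zero>\<^bsub>K\<^esub>)"

definition leibniz_relators ::
  "('k, 'r) ring_scheme \<Rightarrow> ('k, 'v, 'm) superalgebra_scheme \<Rightarrow> 'v set"
  where "leibniz_relators K V =
    {(x \<otimes>\<^bsub>V\<^esub> (y \<otimes>\<^bsub>V\<^esub> z)) \<ominus>\<^bsub>V\<^esub>
       (((x \<otimes>\<^bsub>V\<^esub> y) \<otimes>\<^bsub>V\<^esub> z) \<ominus>\<^bsub>V\<^esub> sgn_pow K (l * j) \<odot>\<^bsub>V\<^esub> ((x \<otimes>\<^bsub>V\<^esub> z) \<otimes>\<^bsub>V\<^esub> y))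
     | x y z i j l. x \<in> part V i \<and> y \<in> part V j \<and> z \<in> part V l}"

definition leibniz_ideal ::
  "('k, 'r) ring_scheme \<Rightarrow> (bit \<Rightarrow> 'x set) \<Rightarrow> ('x word \<Rightarrow> 'k) set"
  where "leibniz_ideal K X =
    ideal_generated K (free_superalgebra K X) (leibniz_relators K (free_superalgebra K X))"

text \<open>The free Leibniz superalgebra \<open>Lb\<^sub>s(X)\<close> and its generators.\<close>
definition Lb ::
  "('k, 'r) ring_scheme \<Rightarrow> (bit \<Rightarrow> 'x set) \<Rightarrow> ('k, ('x word \<Rightarrow> 'k) set) superalgebra"
  where "Lb K X = superalgebra_quot (free_superalgebra K X) (leibniz_ideal K X)"

definition Lb_gen ::
  "('k, 'r) ring_scheme \<Rightarrow> (bit \<Rightarrow> 'x set) \<Rightarrow> 'x \<Rightarrow> ('x word \<Rightarrow> 'k) set"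
  where "Lb_gen K X x = leibniz_ideal K X +>\<^bsub>free_superalgebra K X\<^esub> free_gen K x"

text \<open>The presented Leibniz superalgebra \<open>Lb\<^sub>s(X | S)\<close>, for a homogeneous set \<open>S\<close> of elements of
  \<open>Lb\<^sub>s(X)\<close>, and the images of the generators in it.\<close>
definition Lb_pres ::
  "('k, 'r) ring_scheme \<Rightarrow> (bit \<Rightarrow> 'x set) \<Rightarrow> ('x word \<Rightarrow> 'k) set set \<Rightarrow>
    ('k, ('x word \<Rightarrow> 'k) set set) superalgebra"
  where "Lb_pres K X S = superalgebra_quot (Lb K X) (ideal_generated K (Lb K X) S)"

definition Lb_pres_gen ::
  "('k, 'r) ring_scheme \<Rightarrow> (bit \<Rightarrow> 'x set) \<Rightarrow> ('x word \<Rightarrow> 'k) set set \<Rightarrow> 'x \<Rightarrow>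
    ('x word \<Rightarrow> 'k) set set"
  where "Lb_pres_gen K X S x = ideal_generated K (Lb K X) S +>\<^bsub>Lb K X\<^esub> Lb_gen K X x"


section \<open>The superalgebra attached to an action and a bilinear map\<close>

text \<open>From here on \<open>A i\<close> and \<open>B i\<close> are linear bases of \<open>part \<AA> i\<close> and \<open>part \<BB> i\<close>. The
  disjoint union of the generating sets is formed in the sum type.\<close>
definition gens :: "(bit \<Rightarrow> 'a set) \<Rightarrow> (bit \<Rightarrow> 'b set) \<Rightarrow> bit \<Rightarrow> ('a + 'b) set"
  where "gens A B i = Inl ` A i \<union> Inr ` B i"

definition ext_relators ::
  "('k, 'r) ring_scheme \<Rightarrow> ('k, 'a, 'm) superalgebra_scheme \<Rightarrow> ('k, 'b, 'n) superalgebra_scheme \<Rightarrow>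
    (bit \<Rightarrow> 'a set) \<Rightarrow> (bit \<Rightarrow> 'b set) \<Rightarrow>
    ('b \<Rightarrow> 'a \<Rightarrow> 'a) \<Rightarrow> ('a \<Rightarrow> 'b \<Rightarrow> 'a) \<Rightarrow> ('b \<Rightarrow> 'b \<Rightarrow> 'a) \<Rightarrow>
    (('a + 'b) word \<Rightarrow> 'k) set set"
  where "ext_relators K \<AA> \<BB> A B lft rgt \<beta> =
    (let L = Lb K (gens A B);
         gA = (\<lambda>a. Lb_gen K (gens A B) (Inl a));
         gB = (\<lambda>b. Lb_gen K (gens A B) (Inr b));
         inA = read_in K \<AA> (A 0 \<union> A 1) L gA;
         inB = read_in K \<BB> (B 0 \<union> B 1) L gB
     in {gA a \<otimes>\<^bsub>L\<^esub> gA a' | a a'. a \<in> A 0 \<union> A 1 \<and> a' \<in> A 0 \<union> A 1}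
      \<union> {gA a \<otimes>\<^bsub>L\<^esub> gB b \<ominus>\<^bsub>L\<^esub> inA (rgt a b) | a b. a \<in> A 0 \<union> A 1 \<and> b \<in> B 0 \<union> B 1}
      \<union> {gB b \<otimes>\<^bsub>L\<^esub> gA a \<ominus>\<^bsub>L\<^esub> inA (lft b a) | a b. a \<in> A 0 \<union> A 1 \<and> b \<in> B 0 \<union> B 1}
      \<union> {gB b \<otimes>\<^bsub>L\<^esub> gB b' \<ominus>\<^bsub>L\<^esub> inB (b \<otimes>\<^bsub>\<BB>\<^esub> b') \<ominus>\<^bsub>L\<^esub> inA (\<beta> b b')
          | b b'. b \<in> B 0 \<union> B 1 \<and> b' \<in> B 0 \<union> B 1})"

definition ext_alg ::
  "('k, 'r) ring_scheme \<Rightarrow> ('k, 'a, 'm) superalgebra_scheme \<Rightarrow> ('k, 'b, 'n) superalgebra_scheme \<Rightarrow>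
    (bit \<Rightarrow> 'a set) \<Rightarrow> (bit \<Rightarrow> 'b set) \<Rightarrow>
    ('b \<Rightarrow> 'a \<Rightarrow> 'a) \<Rightarrow> ('a \<Rightarrow> 'b \<Rightarrow> 'a) \<Rightarrow> ('b \<Rightarrow> 'b \<Rightarrow> 'a) \<Rightarrow>
    ('k, (('a + 'b) word \<Rightarrow> 'k) set set) superalgebra"
  where "ext_alg K \<AA> \<BB> A B lft rgt \<beta> =
    Lb_pres K (gens A B) (ext_relators K \<AA> \<BB> A B lft rgt \<beta>)"

text \<open>The map \<open>\<AA> \<oplus> \<BB> \<rightarrow> ext_alg\<close> which regards \<open>x + y\<close>, with \<open>x \<in> \<AA>\<close> and \<open>y \<in> \<BB>\<close> written as
  linear combinations of elements of the bases, as an element of the presented superalgebra.\<close>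
definition ext_map ::
  "('k, 'r) ring_scheme \<Rightarrow> ('k, 'a, 'm) superalgebra_scheme \<Rightarrow> ('k, 'b, 'n) superalgebra_scheme \<Rightarrow>
    (bit \<Rightarrow> 'a set) \<Rightarrow> (bit \<Rightarrow> 'b set) \<Rightarrow>
    ('b \<Rightarrow> 'a \<Rightarrow> 'a) \<Rightarrow> ('a \<Rightarrow> 'b \<Rightarrow> 'a) \<Rightarrow> ('b \<Rightarrow> 'b \<Rightarrow> 'a) \<Rightarrow>
    'a \<times> 'b \<Rightarrow> (('a + 'b) word \<Rightarrow> 'k) set set"
  where "ext_map K \<AA> \<BB> A B lft rgt \<beta> =
    (let P = ext_alg K \<AA> \<BB> A B lft rgt \<beta>;
         g = Lb_pres_gen K (gens A B) (ext_relators K \<AA> \<BB> A B lft rgt \<beta>)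
     in (\<lambda>(x, y). read_in K \<AA> (A 0 \<union> A 1) P (\<lambda>a. g (Inl a)) x \<oplus>\<^bsub>P\<^esub>
                  read_in K \<BB> (B 0 \<union> B 1) P (\<lambda>b. g (Inr b)) y))"

text \<open>\<open>\<beta>\<close> is the bilinear map written \<open>\<lfloor>_,_\<rfloor>\<close>.\<close>
definition ext_data ::
  "('k, 'r) ring_scheme \<Rightarrow> ('k, 'a, 'm) superalgebra_scheme \<Rightarrow> ('k, 'b, 'n) superalgebra_scheme \<Rightarrow>
    (bit \<Rightarrow> 'b set) \<Rightarrow>
    ('b \<Rightarrow> 'a \<Rightarrow> 'a) \<Rightarrow> ('a \<Rightarrow> 'b \<Rightarrow> 'a) \<Rightarrow> ('b \<Rightarrow> 'b \<Rightarrow> 'a) \<Rightarrow> bool"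
  where "ext_data K \<AA> \<BB> B lft rgt \<beta> \<longleftrightarrow>
    supermodule K \<BB> \<AA> lft rgt \<and>
    bilinear_map K \<BB> \<BB> \<AA> \<beta> \<and>
    (\<forall>i j. \<forall>b\<in>B i. \<forall>b'\<in>B j. \<beta> b b' \<in> part \<AA> (i + j)) \<and>
    (\<forall>i j l. \<forall>b\<in>B i. \<forall>b'\<in>B j. \<forall>b''\<in>B l.
      rgt (\<beta> b'' b) b'
        \<ominus>\<^bsub>\<AA>\<^esub> sgn_pow K (i * j) \<odot>\<^bsub>\<AA>\<^esub> rgt (\<beta> b'' b') b
        \<ominus>\<^bsub>\<AA>\<^esub> lft b'' (\<beta> b b')
        \<oplus>\<^bsub>\<AA>\<^esub> \<beta> (b'' \<otimes>\<^bsub>\<BB>\<^esub> b) b'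
        \<ominus>\<^bsub>\<AA>\<^esub> sgn_pow K (i * j) \<odot>\<^bsub>\<AA>\<^esub> \<beta> (b'' \<otimes>\<^bsub>\<BB>\<^esub> b') b
        \<ominus>\<^bsub>\<AA>\<^esub> \<beta> b'' (b \<otimes>\<^bsub>\<BB>\<^esub> b') = \<zero>\<^bsub>\<AA>\<^esub>)"

end

theory Submission
  imports Defs
begin

text \<open>
  The vector space \<open>\<AA> \<oplus> \<BB>\<close> with the product
  \<open>(a + b)(a' + b') = a\<cdot>b' + b\<cdot>a' + \<lfloor>b,b'\<rfloor> + bb'\<close> is a Leibniz superalgebra: the components of the
  Leibniz identity are the three supermodule laws, the cocycle identity and the Leibniz identity
  of \<open>\<BB>\<close>. The universal property of the presentation gives a homomorphism from the presented
  superalgebra to this model. Conversely, writing elements of \<open>\<AA> \<oplus> \<BB>\<close> in the bases gives a linear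
  map back. By the defining relations it is multiplicative, so its image is a subalgebra containing
  the generators, and the two maps are mutually inverse.
  Given an extension, a graded linear section \<open>s\<close> of \<open>\<EE> \<rightarrow> \<BB>\<close> yields the actions
  \<open>s(b)a\<close> and \<open>as(b)\<close> and the cocycle \<open>s(b)s(b') - s(bb')\<close>, and \<open>\<EE>\<close> is isomorphic to the model.
\<close>

section \<open>Linear maps and bases\<close>

text \<open>The relations alone show that the basis elements span the presented superalgebra; they
  do not show that these elements stay independent, and some hidden consequence of the relations
  might collapse part of \<open>\<AA> \<oplus> \<BB>\<close>. Independence has to come from a map
  into a concrete superalgebra, and such a map is available once the concrete product satisfies the
  Leibniz identity: there the cocycle identity enters, as the condition for products of three
  elements of \<open>\<BB>\<close>. The second obstacle is parity. It is not known in advance that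
  the presented superalgebra is the direct sum of its parts, so isomorphisms are constructed with
  the presentation as source and a superalgebra of known grading as target; inverting them needs
  directness on the target side only. Finally, the cocycle identity is prescribed on basis elements,
  while the Leibniz identity concerns all homogeneous elements. With the parities fixed the sign is
  a constant, so the identity is multilinear on the homogeneous parts and extends one variable at a
  time.\<close>

lemma linear_mapI:
  assumes "\<And>x. x \<in> carrier V \<Longrightarrow> h x \<in> carrier W"
    and "\<And>x y. x \<in> carrier V \<Longrightarrow> y \<in> carrier V \<Longrightarrow> h (x \<oplus>\<^bsub>V\<^esub> y) = h x \<oplus>\<^bsub>W\<^esub> h y"
    and "\<And>c x. c \<in> carrier K \<Longrightarrow> x \<in> carrier V \<Longrightarrow> h (c \<odot>\<^bsub>V\<^esub> x) = c \<odot>\<^bsub>W\<^esub> h x"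
  shows "linear_map K V W h"
  using assms unfolding linear_map_def by auto

lemma linear_mapD:
  assumes "linear_map K V W h"
  shows "x \<in> carrier V \<Longrightarrow> h x \<in> carrier W"
    and "x \<in> carrier V \<Longrightarrow> y \<in> carrier V \<Longrightarrow> h (x \<oplus>\<^bsub>V\<^esub> y) = h x \<oplus>\<^bsub>W\<^esub> h y"
    and "c \<in> carrier K \<Longrightarrow> x \<in> carrier V \<Longrightarrow> h (c \<odot>\<^bsub>V\<^esub> x) = c \<odot>\<^bsub>W\<^esub> h x"
  using assms unfolding linear_map_def by auto

lemma linear_map_zero:
  assumes "module K V" "module K W" "linear_map K V W h"
  shows "h \<zero>\<^bsub>V\<^esub> = \<zero>\<^bsub>W\<^esub>"
proof -
  interpret V: module K V by fact
  interpret W: module K W by fact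
  have "h (\<zero>\<^bsub>K\<^esub> \<odot>\<^bsub>V\<^esub> \<zero>\<^bsub>V\<^esub>) = \<zero>\<^bsub>K\<^esub> \<odot>\<^bsub>W\<^esub> h \<zero>\<^bsub>V\<^esub>"
    by (rule linear_mapD(3)[OF assms(3)]) auto
  with linear_mapD(1)[OF assms(3), of "\<zero>\<^bsub>V\<^esub>"] show ?thesis by simp
qed

lemma linear_map_neg:
  assumes "module K V" "module K W" "linear_map K V W h" "x \<in> carrier V"
  shows "h (\<ominus>\<^bsub>V\<^esub> x) = \<ominus>\<^bsub>W\<^esub> h x"
proof -
  interpret V: module K V by fact
  interpret W: module K W by fact
  have "h (\<ominus>\<^bsub>V\<^esub> x) \<oplus>\<^bsub>W\<^esub> h x = h (\<ominus>\<^bsub>V\<^esub> x \<oplus>\<^bsub>V\<^esub> x)"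
    using linear_mapD(2)[OF assms(3)] assms(4) by simp
  also have "\<dots> = \<zero>\<^bsub>W\<^esub>"
    using assms(4) linear_map_zero[OF assms(1-3)] by (simp add: V.l_neg)
  finally show ?thesis
    using linear_mapD(1)[OF assms(3)] assms(4) by (simp add: W.minus_equality)
qed

lemma linear_map_minus:
  assumes "module K V" "module K W" "linear_map K V W h" "x \<in> carrier V" "y \<in> carrier V"
  shows "h (x \<ominus>\<^bsub>V\<^esub> y) = h x \<ominus>\<^bsub>W\<^esub> h y"
proof -
  interpret V: module K V by fact
  show ?thesis
    using linear_mapD(2)[OF assms(3), of x "\<ominus>\<^bsub>V\<^esub> y"] linear_map_neg[OF assms(1-3), of y] assms
    by (simp add: a_minus_def)
qed

lemma linear_map_comp:
  "linear_map K U V h \<Longrightarrow> linear_map K V W k \<Longrightarrow> linear_map K U W (\<lambda>x. k (h x))"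
  unfolding linear_map_def by (auto simp: Pi_iff)

lemma linear_map_const_zero:
  assumes "module K W"
  shows "linear_map K V W (\<lambda>x. \<zero>\<^bsub>W\<^esub>)"
proof -
  interpret W: module K W by fact
  show ?thesis by (rule linear_mapI) auto
qed

lemma linear_map_add:
  assumes "module K V" "module K W" "linear_map K V W h" "linear_map K V W k"
  shows "linear_map K V W (\<lambda>x. h x \<oplus>\<^bsub>W\<^esub> k x)"
proof -
  interpret V: module K V by fact
  interpret W: module K W by fact
  note h = linear_mapD[OF assms(3)] and k = linear_mapD[OF assms(4)]
  show ?thesis
    by (rule linear_mapI) (auto simp: h k W.smult_r_distr W.a_ac)
qed

lemma linear_map_diff:
  assumes "module K V" "module K W" "linear_map K V W h" "linear_map K V W k"
  shows "linear_map K V W (\<lambda>x. h x \<ominus>\<^bsub>W\<^esub> k x)"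
proof -
  interpret V: module K V by fact
  interpret W: module K W by fact
  note h = linear_mapD[OF assms(3)] and k = linear_mapD[OF assms(4)]
  show ?thesis
    by (rule linear_mapI)
      (auto simp: h k W.smult_r_distr W.a_ac W.smult_r_minus W.minus_add a_minus_def)
qed

lemma linear_map_smult:
  assumes "module K V" "module K W" "linear_map K V W h" "c \<in> carrier K"
  shows "linear_map K V W (\<lambda>x. c \<odot>\<^bsub>W\<^esub> h x)"
proof -
  interpret V: module K V by fact
  interpret W: module K W by fact
  note h = linear_mapD[OF assms(3)]
  have "c \<odot>\<^bsub>W\<^esub> (d \<odot>\<^bsub>W\<^esub> h x) = d \<odot>\<^bsub>W\<^esub> (c \<odot>\<^bsub>W\<^esub> h x)" if "d \<in> carrier K" "x \<in> carrier V" for d x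
    using that assms(4) h(1) by (metis V.R.m_comm W.smult_assoc1)
  with assms(4) show ?thesis
    by (intro linear_mapI) (auto simp: h W.smult_r_distr)
qed

text \<open>After applying the injective \<open>h\<close>, both sides of each linearity equation
  become values of \<open>k\<close>, so linearity is inherited from \<open>h\<close> and
  \<open>k\<close>. Operations computed inside \<open>\<EE>\<close> are pulled back to
  \<open>\<AA>\<close> in this way; with the identity for \<open>k\<close> it gives the linearity of
  an inverse.\<close>

lemma linear_map_lift:
  assumes "module K V" "linear_map K V W h" "inj_on h (carrier V)"
    and "linear_map K U W k" "k ` carrier U \<subseteq> h ` carrier V"
  shows "linear_map K U V (\<lambda>x. inv_into (carrier V) h (k x))"
proof -
  interpret V: module K V by fact
  note h = linear_mapD[OF assms(2)] and k = linear_mapD[OF assms(4)]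
  let ?i = "inv_into (carrier V) h"
  have cl: "?i (k x) \<in> carrier V" and r: "h (?i (k x)) = k x" if "x \<in> carrier U" for x
    using that assms(5) by (blast intro: inv_into_into f_inv_into_f)+
  have l: "?i (h x) = x" if "x \<in> carrier V" for x
    using assms(3) that by simp
  show ?thesis
  proof (rule linear_mapI)
    fix x y assume x: "x \<in> carrier U" and y: "y \<in> carrier U"
    have "k (x \<oplus>\<^bsub>U\<^esub> y) = h (?i (k x) \<oplus>\<^bsub>V\<^esub> ?i (k y))"
      using x y by (simp add: h k r cl)
    then show "?i (k (x \<oplus>\<^bsub>U\<^esub> y)) = ?i (k x) \<oplus>\<^bsub>V\<^esub> ?i (k y)"
      using x y by (simp add: l cl)
  next
    fix c x assume c: "c \<in> carrier K" and x: "x \<in> carrier U"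
    have "k (c \<odot>\<^bsub>U\<^esub> x) = h (c \<odot>\<^bsub>V\<^esub> ?i (k x))"
      using c x by (simp add: h k r cl)
    then show "?i (k (c \<odot>\<^bsub>U\<^esub> x)) = c \<odot>\<^bsub>V\<^esub> ?i (k x)"
      using c x by (simp add: l cl)
  qed (rule cl)
qed

lemma bilinear_mapD:
  assumes "bilinear_map K U V W f"
  shows "x \<in> carrier U \<Longrightarrow> linear_map K V W (\<lambda>y. f x y)"
    and "y \<in> carrier V \<Longrightarrow> linear_map K U W (\<lambda>x. f x y)"
  using assms unfolding bilinear_map_def by auto

lemma bilinear_map_comp:
  assumes "bilinear_map K U V W f" "linear_map K U' U h" "linear_map K V' V k"
  shows "bilinear_map K U' V' W (\<lambda>x y. f (h x) (k y))"
  unfolding bilinear_map_def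
  by (auto intro!: linear_map_comp[OF assms(2)] linear_map_comp[OF assms(3)]
      bilinear_mapD[OF assms(1)] linear_mapD(1)[OF assms(2)] linear_mapD(1)[OF assms(3)])

lemma bilinear_map_comp_left:
  assumes "bilinear_map K U V W f" "linear_map K W W' h"
  shows "bilinear_map K U V W' (\<lambda>x y. h (f x y))"
  unfolding bilinear_map_def
  by (auto intro!: linear_map_comp[OF _ assms(2)] bilinear_mapD[OF assms(1)])

lemma bilinear_map_lift:
  assumes "module K W" "linear_map K W E f" "inj_on f (carrier W)" "bilinear_map K U V E k"
    and "\<And>x y. x \<in> carrier U \<Longrightarrow> y \<in> carrier V \<Longrightarrow> k x y \<in> f ` carrier W"
  shows "bilinear_map K U V W (\<lambda>x y. inv_into (carrier W) f (k x y))"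
  unfolding bilinear_map_def
proof (intro conjI ballI)
  show "linear_map K V W (\<lambda>y. inv_into (carrier W) f (k x y))" if "x \<in> carrier U" for x
    using assms(5) that by (intro linear_map_lift[OF assms(1-3) bilinear_mapD(1)[OF assms(4)]]) auto
  show "linear_map K U W (\<lambda>x. inv_into (carrier W) f (k x y))" if "y \<in> carrier V" for y
    using assms(5) that by (intro linear_map_lift[OF assms(1-3) bilinear_mapD(2)[OF assms(4)]]) auto
qed

lemma bilinear_map_const_zero:
  "module K W \<Longrightarrow> bilinear_map K U V W (\<lambda>x y. \<zero>\<^bsub>W\<^esub>)"
  unfolding bilinear_map_def by (auto intro: linear_map_const_zero)

lemma bilinear_map_add:
  assumes "module K U" "module K V" "module K W" "bilinear_map K U V W f" "bilinear_map K U V W g"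
  shows "bilinear_map K U V W (\<lambda>x y. f x y \<oplus>\<^bsub>W\<^esub> g x y)"
  using assms unfolding bilinear_map_def by (auto intro: linear_map_add)

lemma bilinear_map_diff:
  assumes "module K U" "module K V" "module K W" "bilinear_map K U V W f" "bilinear_map K U V W g"
  shows "bilinear_map K U V W (\<lambda>x y. f x y \<ominus>\<^bsub>W\<^esub> g x y)"
  using assms unfolding bilinear_map_def by (auto intro: linear_map_diff)

section \<open>Finitely supported coefficient families, spans and coordinates\<close>

definition fin_supp :: "('k, 'r) ring_scheme \<Rightarrow> 's set \<Rightarrow> ('s \<Rightarrow> 'k) set"
  where "fin_supp K S =
    {p. range p \<subseteq> carrier K \<and> finite {s. p s \<noteq> \<zero>\<^bsub>K\<^esub>} \<and> {s. p s \<noteq> \<zero>\<^bsub>K\<^esub>} \<subseteq> S}"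

text \<open>The index type \<open>'s\<close> is kept apart from the vectors: indices may be basis
  elements, evaluated at themselves or at other vectors as in \<open>read_in\<close>, or
  nonassociative words, evaluated in a superalgebra. One calculus of sums then serves all these
  cases.\<close>

definition fin_comb ::
  "('k, 'r) ring_scheme \<Rightarrow> ('k, 'w, 'n) module_scheme \<Rightarrow> ('s \<Rightarrow> 'w) \<Rightarrow> ('s \<Rightarrow> 'k) \<Rightarrow> 'w"
  where "fin_comb K W g p = (\<Oplus>\<^bsub>W\<^esub>s\<in>{s. p s \<noteq> \<zero>\<^bsub>K\<^esub>}. p s \<odot>\<^bsub>W\<^esub> g s)"

definition delta :: "('k, 'r) ring_scheme \<Rightarrow> 's \<Rightarrow> 's \<Rightarrow> 'k"
  where "delta K s = (\<lambda>t. if t = s then \<one>\<^bsub>K\<^esub> else \<zero>\<^bsub>K\<^esub>)"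

lemma fin_supp_range: "p \<in> fin_supp K S \<Longrightarrow> p s \<in> carrier K"
  unfolding fin_supp_def by auto

lemma fin_supp_mono: "S \<subseteq> T \<Longrightarrow> fin_supp K S \<subseteq> fin_supp K T"
  unfolding fin_supp_def by auto

context cring
begin

lemma fin_supp_zero: "(\<lambda>s. \<zero>) \<in> fin_supp R S"
  unfolding fin_supp_def by auto

lemma fin_supp_add:
  assumes "p \<in> fin_supp R S" "q \<in> fin_supp R S"
  shows "(\<lambda>s. p s \<oplus> q s) \<in> fin_supp R S"
proof -
  have "{s. p s \<oplus> q s \<noteq> \<zero>} \<subseteq> {s. p s \<noteq> \<zero>} \<union> {s. q s \<noteq> \<zero>}" by auto
  moreover have "finite ({s. p s \<noteq> \<zero>} \<union> {s. q s \<noteq> \<zero>})" "{s. p s \<noteq> \<zero>} \<union> {s. q s \<noteq> \<zero>} \<subseteq> S"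
    using assms by (auto simp: fin_supp_def)
  ultimately show ?thesis
    using assms unfolding fin_supp_def by (auto intro: finite_subset intro!: a_closed)
qed

lemma fin_supp_smult:
  assumes "p \<in> fin_supp R S" "c \<in> carrier R"
  shows "(\<lambda>s. c \<otimes> p s) \<in> fin_supp R S"
proof -
  have "{s. c \<otimes> p s \<noteq> \<zero>} \<subseteq> {s. p s \<noteq> \<zero>}" using assms by auto
  then show ?thesis
    using assms unfolding fin_supp_def by (auto intro: finite_subset)
qed

lemma fin_supp_delta: "s \<in> S \<Longrightarrow> delta R s \<in> fin_supp R S"
  unfolding fin_supp_def delta_def by auto

text \<open>The support loses one point at a time: \<open>p\<close> is the sum of \<open>p\<close>
  with its value at \<open>s\<close> erased and of \<open>p s\<close> times the indicator of
  \<open>s\<close>. Statements about combinations thus reduce to linearity and a check on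
  indicators.\<close>

lemma fin_supp_induct [consumes 1, case_names zero add smult delta]:
  assumes "p \<in> fin_supp R S"
    and zero: "P (\<lambda>s. \<zero>)"
    and add: "\<And>p q. p \<in> fin_supp R S \<Longrightarrow> q \<in> fin_supp R S \<Longrightarrow> P p \<Longrightarrow> P q \<Longrightarrow> P (\<lambda>s. p s \<oplus> q s)"
    and smult: "\<And>c p. c \<in> carrier R \<Longrightarrow> p \<in> fin_supp R S \<Longrightarrow> P p \<Longrightarrow> P (\<lambda>s. c \<otimes> p s)"
    and delta: "\<And>s. s \<in> S \<Longrightarrow> P (delta R s)"
  shows "P p"
proof -
  have "finite {s. p s \<noteq> \<zero>}" using assms(1) by (auto simp: fin_supp_def)
  then show ?thesis using assms(1)
  proof (induction "{s. p s \<noteq> \<zero>}" arbitrary: p rule: finite_induct)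
    case empty
    then have "p = (\<lambda>s. \<zero>)" by auto
    with zero show ?case by simp
  next
    case (insert s F)
    have s: "s \<in> S" and ps: "p s \<in> carrier R"
      using insert.hyps(4) insert.prems by (auto simp: fin_supp_def)
    define q where "q = p(s := \<zero>)"
    have F: "F = {t. q t \<noteq> \<zero>}"
      using insert.hyps(2,4) unfolding q_def by auto
    have q: "q \<in> fin_supp R S"
      using insert.prems by (auto simp: fin_supp_def q_def intro: rev_finite_subset)
    have "P q" using insert.hyps(3)[OF F q] .
    moreover have "P (\<lambda>t. p s \<otimes> delta R s t)"
      by (rule smult[OF ps fin_supp_delta[OF s] delta[OF s]])
    ultimately have "P (\<lambda>t. q t \<oplus> p s \<otimes> delta R s t)"
      by (rule add[OF q fin_supp_smult[OF fin_supp_delta[OF s] ps]])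
    moreover have "(\<lambda>t. q t \<oplus> p s \<otimes> delta R s t) = p"
      using ps fin_supp_range[OF insert.prems] by (auto simp: q_def delta_def)
    ultimately show ?case by simp
  qed
qed

end

context module
begin

text \<open>The support of a sum depends on cancellation, so sums over exact supports do not add up
  termwise. Over a common finite superset they do, because the additional terms vanish.\<close>

lemma fin_comb_superset:
  assumes "finite F" "{s. p s \<noteq> \<zero>} \<subseteq> F" "p \<in> F \<rightarrow> carrier R" "g \<in> F \<rightarrow> carrier M"
  shows "fin_comb R M g p = (\<Oplus>\<^bsub>M\<^esub>s\<in>F. p s \<odot>\<^bsub>M\<^esub> g s)"
  unfolding fin_comb_def
  by (rule M.add.finprod_mono_neutral_cong_left) (use assms in \<open>auto simp: Pi_iff\<close>)

lemma fin_comb_closed: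
  assumes "p \<in> fin_supp R S" "g \<in> S \<rightarrow> carrier M"
  shows "fin_comb R M g p \<in> carrier M"
  unfolding fin_comb_def using assms by (intro M.finsum_closed Pi_I smult_closed) (auto simp: fin_supp_def)

lemma fin_comb_zero: "fin_comb R M g (\<lambda>s. \<zero>) = \<zero>\<^bsub>M\<^esub>"
  unfolding fin_comb_def by simp

lemma fin_comb_add:
  assumes "p \<in> fin_supp R S" "q \<in> fin_supp R S" "g \<in> S \<rightarrow> carrier M"
  shows "fin_comb R M g (\<lambda>s. p s \<oplus> q s) = fin_comb R M g p \<oplus>\<^bsub>M\<^esub> fin_comb R M g q"
proof -
  let ?F = "{s. p s \<noteq> \<zero>} \<union> {s. q s \<noteq> \<zero>}"
  have F: "finite ?F" "?F \<subseteq> S" using assms by (auto simp: fin_supp_def)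
  have p: "p s \<in> carrier R" and q: "q s \<in> carrier R" for s
    using assms by (auto simp: fin_supp_def)
  have g: "g s \<in> carrier M" if "s \<in> ?F" for s using F that assms(3) by auto
  have "fin_comb R M g (\<lambda>s. p s \<oplus> q s) = (\<Oplus>\<^bsub>M\<^esub>s\<in>?F. (p s \<oplus> q s) \<odot>\<^bsub>M\<^esub> g s)"
    by (rule fin_comb_superset) (use F p q g in auto)
  also have "\<dots> = (\<Oplus>\<^bsub>M\<^esub>s\<in>?F. p s \<odot>\<^bsub>M\<^esub> g s \<oplus>\<^bsub>M\<^esub> q s \<odot>\<^bsub>M\<^esub> g s)"
    using p q g by (intro M.finsum_cong') (auto simp: smult_l_distr)
  also have "\<dots> = (\<Oplus>\<^bsub>M\<^esub>s\<in>?F. p s \<odot>\<^bsub>M\<^esub> g s) \<oplus>\<^bsub>M\<^esub> (\<Oplus>\<^bsub>M\<^esub>s\<in>?F. q s \<odot>\<^bsub>M\<^esub> g s)"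
    using p q g by (intro M.finsum_addf) auto
  also have "(\<Oplus>\<^bsub>M\<^esub>s\<in>?F. p s \<odot>\<^bsub>M\<^esub> g s) = fin_comb R M g p"
    by (rule sym, rule fin_comb_superset) (use F p q g in auto)
  also have "(\<Oplus>\<^bsub>M\<^esub>s\<in>?F. q s \<odot>\<^bsub>M\<^esub> g s) = fin_comb R M g q"
    by (rule sym, rule fin_comb_superset) (use F p q g in auto)
  finally show ?thesis .
qed

lemma fin_comb_smult:
  assumes "p \<in> fin_supp R S" "c \<in> carrier R" "g \<in> S \<rightarrow> carrier M"
  shows "fin_comb R M g (\<lambda>s. c \<otimes> p s) = c \<odot>\<^bsub>M\<^esub> fin_comb R M g p"
proof -
  let ?F = "{s. p s \<noteq> \<zero>}"
  have F: "finite ?F" "?F \<subseteq> S" using assms by (auto simp: fin_supp_def)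
  have p: "p s \<in> carrier R" for s using assms by (auto simp: fin_supp_def)
  have g: "g s \<in> carrier M" if "s \<in> ?F" for s using F that assms(3) by auto
  have "fin_comb R M g (\<lambda>s. c \<otimes> p s) = (\<Oplus>\<^bsub>M\<^esub>s\<in>?F. (c \<otimes> p s) \<odot>\<^bsub>M\<^esub> g s)"
    by (rule fin_comb_superset) (use F p g assms in auto)
  also have "\<dots> = (\<Oplus>\<^bsub>M\<^esub>s\<in>?F. c \<odot>\<^bsub>M\<^esub> (p s \<odot>\<^bsub>M\<^esub> g s))"
    using p g assms(2) by (intro M.finsum_cong') (auto simp: smult_assoc1)
  also have "\<dots> = c \<odot>\<^bsub>M\<^esub> fin_comb R M g p"
    unfolding fin_comb_def using p g assms(2) F
    by (intro finsum_smult_ldistr[symmetric]) auto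
  finally show ?thesis .
qed

lemma fin_comb_delta:
  assumes "g s \<in> carrier M"
  shows "fin_comb R M g (delta R s) = g s"
proof -
  have "fin_comb R M g (delta R s) = (\<Oplus>\<^bsub>M\<^esub>t\<in>{s}. delta R s t \<odot>\<^bsub>M\<^esub> g t)"
    by (rule fin_comb_superset) (use assms in \<open>auto simp: delta_def\<close>)
  then show ?thesis using assms by (simp add: delta_def)
qed

text \<open>A combination in \<open>lin_span\<close> has coefficients controlled only on its finite
  set. Extending them by zero gives a total family, the form in which \<open>coords\<close> stores
  coefficients.\<close>

lemma lin_span_eq:
  assumes "S \<subseteq> carrier M"
  shows "lin_span R M S = fin_comb R M (\<lambda>s. s) ` fin_supp R S"
proof (intro equalityI subsetI)
  fix x assume "x \<in> lin_span R M S"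
  then obtain c F where x: "x = lin_comb M c F" "finite F" "F \<subseteq> S" "c \<in> F \<rightarrow> carrier R"
    unfolding lin_span_def by auto
  define p where "p = (\<lambda>s. if s \<in> F then c s else \<zero>)"
  have p: "p \<in> fin_supp R S" "{s. p s \<noteq> \<zero>} \<subseteq> F" "p \<in> F \<rightarrow> carrier R"
    using x unfolding p_def fin_supp_def by auto
  have "fin_comb R M (\<lambda>s. s) p = (\<Oplus>\<^bsub>M\<^esub>s\<in>F. p s \<odot>\<^bsub>M\<^esub> s)"
    by (rule fin_comb_superset) (use p x assms in auto)
  also have "\<dots> = x"
    unfolding x(1) lin_comb_def using x assms by (intro M.finsum_cong') (auto simp: p_def Pi_iff)
  finally show "x \<in> fin_comb R M (\<lambda>s. s) ` fin_supp R S" using p by auto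
next
  fix x assume "x \<in> fin_comb R M (\<lambda>s. s) ` fin_supp R S"
  then show "x \<in> lin_span R M S"
    unfolding lin_span_def fin_comb_def lin_comb_def fin_supp_def by blast
qed

lemma lin_span_induct [consumes 2, case_names zero add smult base]:
  assumes "x \<in> lin_span R M S" "S \<subseteq> carrier M"
    and zero: "P \<zero>\<^bsub>M\<^esub>"
    and add: "\<And>x y. x \<in> carrier M \<Longrightarrow> y \<in> carrier M \<Longrightarrow> P x \<Longrightarrow> P y \<Longrightarrow> P (x \<oplus>\<^bsub>M\<^esub> y)"
    and smult: "\<And>c x. c \<in> carrier R \<Longrightarrow> x \<in> carrier M \<Longrightarrow> P x \<Longrightarrow> P (c \<odot>\<^bsub>M\<^esub> x)"
    and base: "\<And>s. s \<in> S \<Longrightarrow> P s"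
  shows "P x"
proof -
  have id: "(\<lambda>s. s) \<in> S \<rightarrow> carrier M" using assms(2) by auto
  obtain p where p: "x = fin_comb R M (\<lambda>s. s) p" "p \<in> fin_supp R S"
    using assms(1) lin_span_eq[OF assms(2)] by auto
  from p(2) have "P (fin_comb R M (\<lambda>s. s) p)"
  proof (induction rule: fin_supp_induct)
    case zero
    show ?case using assms(3) by (simp add: fin_comb_zero)
  next
    case (add p q)
    then show ?case using assms(4) by (simp add: fin_comb_add[OF _ _ id] fin_comb_closed[OF _ id])
  next
    case (smult c p)
    then show ?case using assms(5) by (simp add: fin_comb_smult[OF _ _ id] fin_comb_closed[OF _ id])
  next
    case (delta s)
    then show ?case using assms(2) base by (auto simp: fin_comb_delta)
  qed
  with p(1) show ?thesis by simp
qed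

text \<open>The difference of the two families combines to zero, so independence makes it
  vanish.\<close>

lemma fin_comb_inj:
  assumes "lin_indep R M S" "S \<subseteq> carrier M" "p \<in> fin_supp R S" "q \<in> fin_supp R S"
    and "fin_comb R M (\<lambda>s. s) p = fin_comb R M (\<lambda>s. s) q"
  shows "p = q"
proof
  fix t
  have id: "(\<lambda>s. s) \<in> S \<rightarrow> carrier M" using assms(2) by auto
  define d where "d = (\<lambda>s. p s \<oplus> (\<ominus> \<one>) \<otimes> q s)"
  have d: "d \<in> fin_supp R S"
    unfolding d_def by (intro fin_supp_add fin_supp_smult assms) auto
  have "fin_comb R M (\<lambda>s. s) d =
      fin_comb R M (\<lambda>s. s) p \<oplus>\<^bsub>M\<^esub> (\<ominus> \<one>) \<odot>\<^bsub>M\<^esub> fin_comb R M (\<lambda>s. s) q"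
    unfolding d_def
    by (subst fin_comb_add[OF assms(3) fin_supp_smult[OF assms(4)] id])
      (auto simp: fin_comb_smult[OF assms(4) _ id])
  also have "\<dots> = \<zero>\<^bsub>M\<^esub>"
    using fin_comb_closed[OF assms(4) id] by (simp add: assms(5) smult_l_minus M.r_neg)
  finally have "lin_comb M d {s. d s \<noteq> \<zero>} = \<zero>\<^bsub>M\<^esub>"
    unfolding fin_comb_def lin_comb_def .
  \<comment> \<open>Independence is applied to the support of \<open>d\<close> itself: every
    coefficient there is nonzero by choice and zero by independence, so the support is
    empty.\<close>
  then have "\<forall>s\<in>{s. d s \<noteq> \<zero>}. d s = \<zero>"
    using assms(1) d unfolding lin_indep_def fin_supp_def
    by (metis (no_types, lifting) Pi_I mem_Collect_eq range_subsetD)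
  then have "d t = \<zero>" by auto
  then show "p t = q t"
    using fin_supp_range[OF assms(3), of t] fin_supp_range[OF assms(4), of t]
    unfolding d_def by (simp add: R.l_minus R.add.inv_solve_right')
qed

text \<open>\<open>coords\<close> is a definite description and says nothing until a unique
  candidate is known: existence is spanning, uniqueness is independence in the form of
  \<open>fin_comb_inj\<close>.\<close>

lemma coords_props:
  assumes "linear_basis R M (carrier M) S" "v \<in> carrier M"
  shows "coords R M S v \<in> fin_supp R S" "fin_comb R M (\<lambda>s. s) (coords R M S v) = v"
proof -
  have S: "S \<subseteq> carrier M" "lin_indep R M S" "lin_span R M S = carrier M"
    using assms(1) unfolding linear_basis_def by auto
  have eq: "coords R M S v = (THE c. c \<in> fin_supp R S \<and> fin_comb R M (\<lambda>s. s) c = v)"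
    unfolding coords_def fin_supp_def fin_comb_def lin_comb_def by (simp add: conj_assoc)
  obtain p where p: "p \<in> fin_supp R S" "fin_comb R M (\<lambda>s. s) p = v"
    using lin_span_eq[OF S(1)] S(3) assms(2) by auto
  have "coords R M S v \<in> fin_supp R S \<and> fin_comb R M (\<lambda>s. s) (coords R M S v) = v"
    unfolding eq by (rule theI[where a = p]) (use p fin_comb_inj[OF S(2,1)] in auto)
  then show "coords R M S v \<in> fin_supp R S" "fin_comb R M (\<lambda>s. s) (coords R M S v) = v"
    by auto
qed

lemma coords_eqI:
  assumes "linear_basis R M (carrier M) S" "p \<in> fin_supp R S" "fin_comb R M (\<lambda>s. s) p = v"
  shows "coords R M S v = p"
proof -
  have S: "S \<subseteq> carrier M" "lin_indep R M S"
    using assms(1) unfolding linear_basis_def by auto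
  have "v \<in> carrier M" using fin_comb_closed[OF assms(2), of "\<lambda>s. s"] S(1) assms(3) by auto
  from coords_props[OF assms(1) this] fin_comb_inj[OF S(2,1) _ assms(2)] assms(3)
  show ?thesis by simp
qed

end

lemma read_in_eq: "read_in K V S W g v = fin_comb K W g (coords K V S v)"
  unfolding read_in_def fin_comb_def ..

text \<open>Uniqueness of coordinates makes them linear in the vector, hence every assignment on a
  basis extends linearly. The section of an extension and the maps of \<open>\<AA>\<close> and
  \<open>\<BB>\<close> into \<open>Lb\<close> and into the presentation are all obtained from
  it.\<close>

lemma linear_map_read_in:
  assumes "module K V" "module K W" "linear_basis K V (carrier V) S" "g \<in> S \<rightarrow> carrier W"
  shows "linear_map K V W (read_in K V S W g)"
proof -
  interpret V: module K V by fact
  interpret W: module K W by fact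
  have id: "(\<lambda>s. s) \<in> S \<rightarrow> carrier V" using assms(3) unfolding linear_basis_def by auto
  note c = V.coords_props[OF assms(3)]
  show ?thesis
  proof (rule linear_mapI)
    fix x y assume x: "x \<in> carrier V" and y: "y \<in> carrier V"
    have "coords K V S (x \<oplus>\<^bsub>V\<^esub> y) = (\<lambda>s. coords K V S x s \<oplus>\<^bsub>K\<^esub> coords K V S y s)"
      using x y by (intro V.coords_eqI[OF assms(3)])
        (auto simp: c V.fin_comb_add[OF _ _ id] intro: V.fin_supp_add)
    with x y show "read_in K V S W g (x \<oplus>\<^bsub>V\<^esub> y) = read_in K V S W g x \<oplus>\<^bsub>W\<^esub> read_in K V S W g y"
      by (simp add: read_in_eq W.fin_comb_add[OF c(1) c(1) assms(4)])
  next
    fix a x assume a: "a \<in> carrier K" and x: "x \<in> carrier V"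
    have "coords K V S (a \<odot>\<^bsub>V\<^esub> x) = (\<lambda>s. a \<otimes>\<^bsub>K\<^esub> coords K V S x s)"
      using x a by (intro V.coords_eqI[OF assms(3)])
        (auto simp: c V.fin_comb_smult[OF _ _ id] intro: V.fin_supp_smult)
    with a x show "read_in K V S W g (a \<odot>\<^bsub>V\<^esub> x) = a \<odot>\<^bsub>W\<^esub> read_in K V S W g x"
      by (simp add: read_in_eq W.fin_comb_smult[OF c(1) _ assms(4)])
  qed (auto simp: read_in_eq intro: W.fin_comb_closed[OF c(1) assms(4)])
qed

lemma read_in_basis:
  assumes "module K V" "module K W" "linear_basis K V (carrier V) S" "s \<in> S" "g s \<in> carrier W"
  shows "read_in K V S W g s = g s"
proof -
  interpret V: module K V by fact
  interpret W: module K W by fact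
  have "s \<in> carrier V" using assms(3,4) unfolding linear_basis_def by auto
  then have "coords K V S s = delta K s"
    using assms(4) by (intro V.coords_eqI[OF assms(3)]) (auto simp: V.fin_comb_delta V.fin_supp_delta)
  with assms(5) show ?thesis by (simp add: read_in_eq W.fin_comb_delta)
qed

text \<open>Stated for a span rather than the whole space, because an identity with a parity sign
  can be compared only on elements of one parity, that is, on the span of a single
  \<open>B i\<close>.\<close>

lemma linear_map_eq_on_span:
  assumes "module K V" "module K W" "S \<subseteq> carrier V" "linear_map K V W h" "linear_map K V W k"
    and "\<And>s. s \<in> S \<Longrightarrow> h s = k s" "x \<in> lin_span K V S"
  shows "h x = k x"
proof -
  interpret V: module K V by fact
  show ?thesis
    using assms(7,3)
  proof (induction rule: V.lin_span_induct)
    case zero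
    show ?case
      using linear_map_zero[OF assms(1,2,4)] linear_map_zero[OF assms(1,2,5)] by simp
  qed (auto simp: linear_mapD[OF assms(4)] linear_mapD[OF assms(5)] assms(6))
qed

lemma linear_map_eq_on_basis:
  assumes "module K V" "module K W" "linear_basis K V (carrier V) S"
    and "linear_map K V W h" "linear_map K V W k"
    and "\<And>s. s \<in> S \<Longrightarrow> h s = k s" "x \<in> carrier V"
  shows "h x = k x"
  using assms linear_map_eq_on_span[OF assms(1,2) _ assms(4,5,6)] unfolding linear_basis_def by auto

lemma bilinear_map_eq_on_basis:
  assumes "module K U" "module K V" "module K W"
    and "linear_basis K U (carrier U) S" "linear_basis K V (carrier V) T"
    and "bilinear_map K U V W f" "bilinear_map K U V W g"
    and "\<And>s t. s \<in> S \<Longrightarrow> t \<in> T \<Longrightarrow> f s t = g s t" "x \<in> carrier U" "y \<in> carrier V"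
  shows "f x y = g x y"
proof -
  have S: "S \<subseteq> carrier U" and T: "T \<subseteq> carrier V" using assms(4,5) unfolding linear_basis_def by auto
  have "f s y = g s y" if "s \<in> S" for s
    using that S by (intro linear_map_eq_on_basis[OF assms(2,3,5) bilinear_mapD(1)[OF assms(6)]
      bilinear_mapD(1)[OF assms(7)] _ assms(10)]) (auto intro: assms(8))
  then show ?thesis
    using assms(10)
    by (intro linear_map_eq_on_basis[OF assms(1,3,4) bilinear_mapD(2)[OF assms(6)]
      bilinear_mapD(2)[OF assms(7)] _ assms(9)]) auto
qed

section \<open>Homomorphisms, quotients and the free superalgebra\<close>

text \<open>The two parts are only required to span, since the presented superalgebra is not known to
  be a direct sum of its parts until it has been compared with an explicit model.\<close>

locale graded_algebra = field K + module K V
  for K :: "('k, 'r) ring_scheme" and V :: "('k, 'v, 'm) superalgebra_scheme" +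
  assumes part_subset: "part V i \<subseteq> carrier V"
    and part_span: "x \<in> carrier V \<Longrightarrow> \<exists>y\<in>part V 0. \<exists>z\<in>part V 1. x = y \<oplus>\<^bsub>V\<^esub> z"
    and bilinear: "bilinear_map K V V V (\<lambda>x y. x \<otimes>\<^bsub>V\<^esub> y)"
begin

lemma module_V: "module K V" ..

lemma mult_closed: "x \<in> carrier V \<Longrightarrow> y \<in> carrier V \<Longrightarrow> x \<otimes>\<^bsub>V\<^esub> y \<in> carrier V"
  using linear_mapD(1)[OF bilinear_mapD(1)[OF bilinear]] by auto

lemma mult_add_right:
  "x \<in> carrier V \<Longrightarrow> y \<in> carrier V \<Longrightarrow> z \<in> carrier V \<Longrightarrow>
    x \<otimes>\<^bsub>V\<^esub> (y \<oplus>\<^bsub>V\<^esub> z) = x \<otimes>\<^bsub>V\<^esub> y \<oplus>\<^bsub>V\<^esub> x \<otimes>\<^bsub>V\<^esub> z"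
  using linear_mapD(2)[OF bilinear_mapD(1)[OF bilinear]] by auto

lemma mult_add_left:
  "x \<in> carrier V \<Longrightarrow> y \<in> carrier V \<Longrightarrow> z \<in> carrier V \<Longrightarrow>
    (x \<oplus>\<^bsub>V\<^esub> y) \<otimes>\<^bsub>V\<^esub> z = x \<otimes>\<^bsub>V\<^esub> z \<oplus>\<^bsub>V\<^esub> y \<otimes>\<^bsub>V\<^esub> z"
  using linear_mapD(2)[OF bilinear_mapD(2)[OF bilinear]] by auto

lemma mult_smult_right:
  "c \<in> carrier K \<Longrightarrow> x \<in> carrier V \<Longrightarrow> y \<in> carrier V \<Longrightarrow>
    x \<otimes>\<^bsub>V\<^esub> (c \<odot>\<^bsub>V\<^esub> y) = c \<odot>\<^bsub>V\<^esub> (x \<otimes>\<^bsub>V\<^esub> y)"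
  using linear_mapD(3)[OF bilinear_mapD(1)[OF bilinear]] by auto

lemma mult_smult_left:
  "c \<in> carrier K \<Longrightarrow> x \<in> carrier V \<Longrightarrow> y \<in> carrier V \<Longrightarrow>
    (c \<odot>\<^bsub>V\<^esub> x) \<otimes>\<^bsub>V\<^esub> y = c \<odot>\<^bsub>V\<^esub> (x \<otimes>\<^bsub>V\<^esub> y)"
  using linear_mapD(3)[OF bilinear_mapD(2)[OF bilinear]] by auto

lemma mult_zero_right: "x \<in> carrier V \<Longrightarrow> x \<otimes>\<^bsub>V\<^esub> \<zero>\<^bsub>V\<^esub> = \<zero>\<^bsub>V\<^esub>"
  using linear_map_zero[OF module_V module_V bilinear_mapD(1)[OF bilinear]] by auto

lemma mult_zero_left: "x \<in> carrier V \<Longrightarrow> \<zero>\<^bsub>V\<^esub> \<otimes>\<^bsub>V\<^esub> x = \<zero>\<^bsub>V\<^esub>"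
  using linear_map_zero[OF module_V module_V bilinear_mapD(2)[OF bilinear]] by auto

lemma mult_minus_right:
  "x \<in> carrier V \<Longrightarrow> y \<in> carrier V \<Longrightarrow> z \<in> carrier V \<Longrightarrow>
    x \<otimes>\<^bsub>V\<^esub> (y \<ominus>\<^bsub>V\<^esub> z) = x \<otimes>\<^bsub>V\<^esub> y \<ominus>\<^bsub>V\<^esub> x \<otimes>\<^bsub>V\<^esub> z"
  using linear_map_minus[OF module_V module_V bilinear_mapD(1)[OF bilinear]] by auto

lemma mult_minus_left:
  "x \<in> carrier V \<Longrightarrow> y \<in> carrier V \<Longrightarrow> z \<in> carrier V \<Longrightarrow>
    (x \<ominus>\<^bsub>V\<^esub> y) \<otimes>\<^bsub>V\<^esub> z = x \<otimes>\<^bsub>V\<^esub> z \<ominus>\<^bsub>V\<^esub> y \<otimes>\<^bsub>V\<^esub> z"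
  using linear_map_minus[OF module_V module_V bilinear_mapD(2)[OF bilinear]] by auto

lemma part_carrier: "x \<in> part V i \<Longrightarrow> x \<in> carrier V"
  using part_subset by auto

lemma sgn_pow_closed: "sgn_pow K i \<in> carrier K"
  unfolding sgn_pow_def by auto

end

sublocale superalgebra \<subseteq> graded_algebra K V
proof unfold_locales
  show "part V i \<subseteq> carrier V" for i
    using submoduleE(1)[OF part_subspace] .
  show "\<exists>y\<in>part V 0. \<exists>z\<in>part V 1. x = y \<oplus>\<^bsub>V\<^esub> z" if "x \<in> carrier V" for x
    using that part_sum by (auto simp: set_add_def')
qed (rule mult_bilinear)

context superalgebra
begin

lemma part_zero: "\<zero>\<^bsub>V\<^esub> \<in> part V i"
  using part_direct submoduleE(2,3,5)[OF part_subspace[of i]] part_subset[of i]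
  by (metis M.r_neg ex_in_conv part_carrier)

lemmas part_add = submoduleE(5)[OF part_subspace]
lemmas part_neg = submoduleE(3)[OF part_subspace]
lemmas part_smult = submoduleE(4)[OF part_subspace]

lemma part_diff: "x \<in> part V i \<Longrightarrow> y \<in> part V i \<Longrightarrow> x \<ominus>\<^bsub>V\<^esub> y \<in> part V i"
  unfolding a_minus_def by (intro part_add part_neg)

lemma part_disjoint: "x \<in> part V i \<Longrightarrow> x \<in> part V j \<Longrightarrow> i \<noteq> j \<Longrightarrow> x = \<zero>\<^bsub>V\<^esub>"
  using part_direct by (cases i; cases j) auto

text \<open>The component of the other parity is a difference of two elements of parity
  \<open>i\<close>, so it lies in both parts and vanishes. Parities of preimages are recovered from
  this fact, applied to their images.\<close>

lemma part_sum_unique: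
  assumes "x \<in> part V 0" "y \<in> part V 1" "x \<oplus>\<^bsub>V\<^esub> y \<in> part V i"
  shows "x \<oplus>\<^bsub>V\<^esub> y = (if i = 0 then x else y)"
proof -
  note c = part_carrier[OF assms(1)] part_carrier[OF assms(2)]
  show ?thesis
  proof (cases "i = 0")
    case True
    have "\<ominus>\<^bsub>V\<^esub> x \<oplus>\<^bsub>V\<^esub> (x \<oplus>\<^bsub>V\<^esub> y) \<in> part V 0"
      using assms True by (intro part_add[OF part_neg]) auto
    then have "y \<in> part V 0" using c by (simp add: M.a_assoc[symmetric] M.l_neg)
    then have "y = \<zero>\<^bsub>V\<^esub>" using part_disjoint assms(2) by (metis zero_neq_one)
    with True c show ?thesis by simp
  next
    case False
    then have "i = 1" by (cases i) auto
    then have "(x \<oplus>\<^bsub>V\<^esub> y) \<oplus>\<^bsub>V\<^esub> \<ominus>\<^bsub>V\<^esub> y \<in> part V 1"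
      using assms by (intro part_add[OF _ part_neg]) auto
    then have "x \<in> part V 1" using c by (simp add: M.a_assoc M.r_neg)
    then have "x = \<zero>\<^bsub>V\<^esub>" using part_disjoint assms(1) by (metis zero_neq_one)
    with False c show ?thesis by simp
  qed
qed

text \<open>A vanishing combination splits into two homogeneous sums of opposite parity whose total
  is zero. Directness makes both sums zero, and then each basis is independent on its own
  part.\<close>

lemma linear_basis_union:
  assumes "\<And>i. linear_basis K V (part V i) (S i)"
  shows "linear_basis K V (carrier V) (S 0 \<union> S 1)"
proof -
  have S: "S i \<subseteq> carrier V" "lin_indep K V (S i)" "lin_span K V (S i) = part V i" for i
    using assms unfolding linear_basis_def by auto
  have U: "S 0 \<union> S 1 \<subseteq> carrier V" using S by auto
  then have id: "(\<lambda>s. s) \<in> S 0 \<union> S 1 \<rightarrow> carrier V" by auto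
  have "lin_indep K V (S 0 \<union> S 1)"
    unfolding lin_indep_def
  proof (intro allI impI)
    fix F c
    assume F: "finite F" "F \<subseteq> S 0 \<union> S 1" "c \<in> F \<rightarrow> carrier K" "lin_comb V c F = \<zero>\<^bsub>V\<^esub>"
    \<comment> \<open>Taking the complement of \<open>S 0\<close> instead of the intersection with
      \<open>S 1\<close> makes the two pieces disjoint by construction, whether or not the bases
      meet.\<close>
    define F0 F1 where "F0 = F \<inter> S 0" and "F1 = F - S 0"
    have F0: "finite F0" "F0 \<subseteq> S 0" "c \<in> F0 \<rightarrow> carrier K"
      and F1: "finite F1" "F1 \<subseteq> S 1" "c \<in> F1 \<rightarrow> carrier K"
      using F unfolding F0_def F1_def by auto
    have F01: "F = F0 \<union> F1" "F0 \<inter> F1 = {}" unfolding F0_def F1_def by auto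
    have p0: "lin_comb V c F0 \<in> part V 0" and p1: "lin_comb V c F1 \<in> part V 1"
      using F0 F1 unfolding S(3)[symmetric] lin_span_def by blast+
    have sum: "lin_comb V c F0 \<oplus>\<^bsub>V\<^esub> lin_comb V c F1 = \<zero>\<^bsub>V\<^esub>"
      unfolding F(4)[symmetric] F01(1) lin_comb_def
      using F0 F1 F01 U by (intro M.finsum_Un_disjoint[symmetric] Pi_I smult_closed) auto
    \<comment> \<open>Zero has both parities, so \<open>part_sum_unique\<close> can be read once
      with each parity and yields one component each time.\<close>
    then have "lin_comb V c F0 = \<zero>\<^bsub>V\<^esub>" "lin_comb V c F1 = \<zero>\<^bsub>V\<^esub>"
      using part_sum_unique[OF p0 p1, of 0] part_sum_unique[OF p0 p1, of 1] part_zero by auto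
    then have "\<forall>v\<in>F0. c v = \<zero>\<^bsub>K\<^esub>" "\<forall>v\<in>F1. c v = \<zero>\<^bsub>K\<^esub>"
      using S(2) F0 F1 unfolding lin_indep_def by blast+
    then show "\<forall>v\<in>F. c v = \<zero>\<^bsub>K\<^esub>" using F01 by auto
  qed
  moreover have "lin_span K V (S 0 \<union> S 1) = carrier V"
  proof
    show "lin_span K V (S 0 \<union> S 1) \<subseteq> carrier V"
      unfolding lin_span_eq[OF U] using fin_comb_closed[OF _ id] by auto
    show "carrier V \<subseteq> lin_span K V (S 0 \<union> S 1)"
    proof
      fix x assume "x \<in> carrier V"
      then obtain y z where x: "x = y \<oplus>\<^bsub>V\<^esub> z" "y \<in> part V 0" "z \<in> part V 1"
        using part_span by blast
      then obtain p q where
        p: "y = fin_comb K V (\<lambda>s. s) p" "p \<in> fin_supp K (S 0)" and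
        q: "z = fin_comb K V (\<lambda>s. s) q" "q \<in> fin_supp K (S 1)"
        unfolding S(3)[symmetric] lin_span_eq[OF S(1)] by auto
      have pq: "p \<in> fin_supp K (S 0 \<union> S 1)" "q \<in> fin_supp K (S 0 \<union> S 1)"
        using p q fin_supp_mono[of "S 0" "S 0 \<union> S 1" K] fin_supp_mono[of "S 1" "S 0 \<union> S 1" K] by auto
      then have "x = fin_comb K V (\<lambda>s. s) (\<lambda>s. p s \<oplus>\<^bsub>K\<^esub> q s)"
        unfolding x(1) p(1) q(1) by (rule fin_comb_add[OF _ _ id, symmetric])
      then show "x \<in> lin_span K V (S 0 \<union> S 1)"
        unfolding lin_span_eq[OF U] using fin_supp_add[OF pq] by auto
    qed
  qed
  ultimately show ?thesis using U unfolding linear_basis_def by auto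
qed

end

lemma linear_map_span_part:
  assumes "module K V" "superalgebra K W" "linear_map K V W h" "S \<subseteq> carrier V"
    and "\<And>s. s \<in> S \<Longrightarrow> h s \<in> part W i" "x \<in> lin_span K V S"
  shows "h x \<in> part W i"
proof -
  interpret V: module K V by fact
  interpret W: superalgebra K W by fact
  from assms(6,4) show ?thesis
  proof (induction rule: V.lin_span_induct)
    case zero
    show ?case
      unfolding linear_map_zero[OF assms(1) W.module_V assms(3)] by (rule W.part_zero)
  next
    case (add u v)
    then show ?case unfolding linear_mapD(2)[OF assms(3) add(1,2)] by (intro W.part_add)
  next
    case (smult c u)
    then show ?case unfolding linear_mapD(3)[OF assms(3) smult(1,2)] by (intro W.part_smult)
  qed (rule assms(5))
qed

section \<open>Homomorphisms, their inverses and their kernels\<close>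

lemma superalgebra_homD:
  assumes "superalgebra_hom K V W h"
  shows "linear_map K V W h"
    and "x \<in> carrier V \<Longrightarrow> y \<in> carrier V \<Longrightarrow> h (x \<otimes>\<^bsub>V\<^esub> y) = h x \<otimes>\<^bsub>W\<^esub> h y"
    and "x \<in> part V i \<Longrightarrow> h x \<in> part W i"
  using assms unfolding superalgebra_hom_def by blast+

lemma superalgebra_homI:
  assumes "linear_map K V W h"
    and "\<And>x y. x \<in> carrier V \<Longrightarrow> y \<in> carrier V \<Longrightarrow> h (x \<otimes>\<^bsub>V\<^esub> y) = h x \<otimes>\<^bsub>W\<^esub> h y"
    and "\<And>i x. x \<in> part V i \<Longrightarrow> h x \<in> part W i"
  shows "superalgebra_hom K V W h"
  using assms unfolding superalgebra_hom_def by auto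

lemma superalgebra_hom_comp:
  assumes "superalgebra_hom K U V h" "superalgebra_hom K V W k"
  shows "superalgebra_hom K U W (\<lambda>x. k (h x))"
proof (rule superalgebra_homI)
  show "linear_map K U W (\<lambda>x. k (h x))"
    using assms by (auto intro: linear_map_comp superalgebra_homD(1))
qed (use superalgebra_homD[OF assms(1)] superalgebra_homD[OF assms(2)]
    linear_mapD(1)[OF superalgebra_homD(1)[OF assms(1)]] in auto)

text \<open>Parity is the delicate point, since \<open>V\<close> is not assumed to be the direct sum
  of its parts. A preimage is split in \<open>V\<close> and the images of its components are
  compared in \<open>W\<close>, where the splitting is unique; by injectivity the preimage equals
  its own component of the required parity.\<close>

lemma superalgebra_hom_inverse:
  assumes "graded_algebra K V" "superalgebra K W" "superalgebra_hom K V W h"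
    and bij: "bij_betw h (carrier V) (carrier W)"
  shows "superalgebra_hom K W V (inv_into (carrier V) h)"
proof -
  interpret V: graded_algebra K V by fact
  interpret W: superalgebra K W by fact
  note h = superalgebra_homD[OF assms(3)]
  note hl = linear_mapD[OF h(1)]
  let ?i = "inv_into (carrier V) h"
  have inj: "inj_on h (carrier V)" and im: "h ` carrier V = carrier W"
    using bij by (auto simp: bij_betw_def)
  have l: "?i (h x) = x" if "x \<in> carrier V" for x using inj that by simp
  have r: "h (?i y) = y" "?i y \<in> carrier V" if "y \<in> carrier W" for y
    using im that by (auto intro: f_inv_into_f inv_into_into)
  show ?thesis
  proof (rule superalgebra_homI)
    have "linear_map K W W (\<lambda>x. x)" by (rule linear_mapI) auto
    then show "linear_map K W V ?i"
      using linear_map_lift[OF V.module_V h(1) inj, of W "\<lambda>x. x"] im by simp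
  next
    fix x y assume "x \<in> carrier W" "y \<in> carrier W"
    then have "?i (h (?i x \<otimes>\<^bsub>V\<^esub> ?i y)) = ?i (x \<otimes>\<^bsub>W\<^esub> y)" by (simp add: h r)
    then show "?i (x \<otimes>\<^bsub>W\<^esub> y) = ?i x \<otimes>\<^bsub>V\<^esub> ?i y"
      using \<open>x \<in> carrier W\<close> \<open>y \<in> carrier W\<close> by (simp add: l r V.mult_closed)
  next
    fix i y assume y: "y \<in> part W i"
    then have yc: "y \<in> carrier W" by (rule W.part_carrier)
    obtain u v where uv: "?i y = u \<oplus>\<^bsub>V\<^esub> v" "u \<in> part V 0" "v \<in> part V 1"
      using V.part_span[OF r(2)[OF yc]] by auto
    note uvc = V.part_carrier[OF uv(2)] V.part_carrier[OF uv(3)]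
    have y_eq: "y = h u \<oplus>\<^bsub>W\<^esub> h v"
      using r(1)[OF yc] uv(1) uvc hl by simp
    then have "y = (if i = 0 then h u else h v)"
      using W.part_sum_unique[OF h(3)[OF uv(2)] h(3)[OF uv(3)]] y by auto
    then have "?i y = (if i = 0 then u else v)" using l uvc by auto
    with uv show "?i y \<in> part V i" by (cases i) auto
  qed
qed

text \<open>Together with \<open>ideal_generated_least\<close> this shows that a homomorphism
  killing a set of relators kills the whole ideal generated by them.\<close>

lemma superalgebra_hom_kernel:
  assumes "graded_algebra K V" "graded_algebra K W" "superalgebra_hom K V W h"
  shows "two_sided_ideal K V {x \<in> carrier V. h x = \<zero>\<^bsub>W\<^esub>}"
proof -
  interpret V: graded_algebra K V by fact
  interpret W: graded_algebra K W by fact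
  note h = superalgebra_homD[OF assms(3)]
  note hl = linear_mapD[OF h(1)]
  have "submodule {x \<in> carrier V. h x = \<zero>\<^bsub>W\<^esub>} K V"
    by (rule V.submoduleI)
      (auto simp: hl linear_map_zero[OF V.module_V W.module_V h(1)]
        linear_map_neg[OF V.module_V W.module_V h(1)])
  then show ?thesis
    unfolding two_sided_ideal_def
    by (auto simp: V.mult_closed h hl W.mult_zero_right W.mult_zero_left)
qed

section \<open>Generated ideals and quotients\<close>

lemma ideal_generated_least:
  "two_sided_ideal K V I \<Longrightarrow> S \<subseteq> I \<Longrightarrow> ideal_generated K V S \<subseteq> I"
  unfolding ideal_generated_def by auto

lemma ideal_generated_superset: "S \<subseteq> ideal_generated K V S"
  unfolding ideal_generated_def by auto

text \<open>\<open>ideal_generated\<close> is an intersection of ideals, and closure passes to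
  intersections. Since \<open>S\<close> lies in the carrier, the carrier is one of the ideals
  intersected; over an empty family the intersection would be the whole type.\<close>

lemma (in graded_algebra) ideal_generated_ideal:
  assumes "S \<subseteq> carrier V"
  shows "two_sided_ideal K V (ideal_generated K V S)"
proof -
  let ?J = "ideal_generated K V S"
  have whole: "two_sided_ideal K V (carrier V)"
    unfolding two_sided_ideal_def using carrier_is_submodule mult_closed by auto
  then have sub: "?J \<subseteq> carrier V" using assms by (rule ideal_generated_least)
  have sm: "submodule I K V" if "two_sided_ideal K V I" for I
    using that unfolding two_sided_ideal_def by auto
  have z: "\<zero>\<^bsub>V\<^esub> \<in> I" if "two_sided_ideal K V I" for I
    using submoduleE(1,2,3,5)[OF sm[OF that]] by (metis M.r_neg ex_in_conv subsetD)
  have "submodule ?J K V"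
  proof (rule submoduleI)
    show "\<zero>\<^bsub>V\<^esub> \<in> ?J" using z unfolding ideal_generated_def by auto
    show "?J \<subseteq> carrier V" by (rule sub)
  qed (use submoduleE(3,4,5)[OF sm] in \<open>auto simp: ideal_generated_def\<close>)
  then show ?thesis
    unfolding two_sided_ideal_def
    by (auto simp: ideal_generated_def two_sided_ideal_def)
qed

text \<open>The axioms of \<open>graded_algebra\<close> are equations and existence statements,
  which survive a surjection compatible with the operations; directness of the grading would not.
  The compatibility equations are oriented so that simplification moves every computation back into
  \<open>V\<close>.\<close>

lemma graded_algebra_image:
  assumes "graded_algebra K V"
    and surj: "h ` carrier V = carrier W"
    and zero: "h \<zero>\<^bsub>V\<^esub> = \<zero>\<^bsub>W\<^esub>"
    and add: "\<And>x y. x \<in> carrier V \<Longrightarrow> y \<in> carrier V \<Longrightarrow> h x \<oplus>\<^bsub>W\<^esub> h y = h (x \<oplus>\<^bsub>V\<^esub> y)"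
    and smult: "\<And>c x. c \<in> carrier K \<Longrightarrow> x \<in> carrier V \<Longrightarrow> c \<odot>\<^bsub>W\<^esub> h x = h (c \<odot>\<^bsub>V\<^esub> x)"
    and mult: "\<And>x y. x \<in> carrier V \<Longrightarrow> y \<in> carrier V \<Longrightarrow> h x \<otimes>\<^bsub>W\<^esub> h y = h (x \<otimes>\<^bsub>V\<^esub> y)"
    and part: "\<And>i. part W i = h ` part V i"
  shows "graded_algebra K W" "superalgebra_hom K V W h"
proof -
  interpret V: graded_algebra K V by fact
  have cl: "h x \<in> carrier W" if "x \<in> carrier V" for x using surj that by auto
  have "abelian_group W"
  proof (rule abelian_groupI)
    show "\<zero>\<^bsub>W\<^esub> \<in> carrier W" using cl[OF V.M.zero_closed] zero by simp
  next
    fix x y assume "x \<in> carrier W" "y \<in> carrier W"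
    then obtain u v where "x = h u" "y = h v" "u \<in> carrier V" "v \<in> carrier V"
      unfolding surj[symmetric] by auto
    then show "x \<oplus>\<^bsub>W\<^esub> y \<in> carrier W" "x \<oplus>\<^bsub>W\<^esub> y = y \<oplus>\<^bsub>W\<^esub> x"
      by (auto simp: add V.M.a_ac intro: cl)
  next
    fix x y z assume "x \<in> carrier W" "y \<in> carrier W" "z \<in> carrier W"
    then obtain u v w where "x = h u" "y = h v" "z = h w" "u \<in> carrier V" "v \<in> carrier V"
      "w \<in> carrier V"
      unfolding surj[symmetric] by auto
    then show "x \<oplus>\<^bsub>W\<^esub> y \<oplus>\<^bsub>W\<^esub> z = x \<oplus>\<^bsub>W\<^esub> (y \<oplus>\<^bsub>W\<^esub> z)"
      by (auto simp: add V.M.a_ac)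
  next
    fix x assume "x \<in> carrier W"
    then obtain u where u: "x = h u" "u \<in> carrier V" unfolding surj[symmetric] by auto
    then show "\<zero>\<^bsub>W\<^esub> \<oplus>\<^bsub>W\<^esub> x = x" by (simp add: add flip: zero)
    have "h (\<ominus>\<^bsub>V\<^esub> u) \<oplus>\<^bsub>W\<^esub> x = \<zero>\<^bsub>W\<^esub>"
      using u by (simp add: add V.M.l_neg zero)
    then show "\<exists>y\<in>carrier W. y \<oplus>\<^bsub>W\<^esub> x = \<zero>\<^bsub>W\<^esub>" using u cl by blast
  qed
  then interpret W: abelian_group W .
  have modW: "module K W"
  proof (rule moduleI)
    show "cring K" ..
    show "abelian_group W" by fact
    fix a b x y assume "a \<in> carrier K" "b \<in> carrier K" "x \<in> carrier W" "y \<in> carrier W"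
    then obtain u v where "x = h u" "y = h v" "u \<in> carrier V" "v \<in> carrier V"
      unfolding surj[symmetric] by auto
    then show "a \<odot>\<^bsub>W\<^esub> (x \<oplus>\<^bsub>W\<^esub> y) = a \<odot>\<^bsub>W\<^esub> x \<oplus>\<^bsub>W\<^esub> a \<odot>\<^bsub>W\<^esub> y"
      using \<open>a \<in> carrier K\<close> by (simp add: add smult V.smult_r_distr)
  next
    fix a b x assume "a \<in> carrier K" "b \<in> carrier K" "x \<in> carrier W"
    moreover from this obtain u where "x = h u" "u \<in> carrier V"
      unfolding surj[symmetric] by auto
    ultimately show "(a \<oplus>\<^bsub>K\<^esub> b) \<odot>\<^bsub>W\<^esub> x = a \<odot>\<^bsub>W\<^esub> x \<oplus>\<^bsub>W\<^esub> b \<odot>\<^bsub>W\<^esub> x"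
      "(a \<otimes>\<^bsub>K\<^esub> b) \<odot>\<^bsub>W\<^esub> x = a \<odot>\<^bsub>W\<^esub> (b \<odot>\<^bsub>W\<^esub> x)"
      by (simp_all add: add smult V.smult_l_distr V.smult_assoc1)
  next
    fix a x assume "a \<in> carrier K" "x \<in> carrier W"
    moreover from this obtain u where "x = h u" "u \<in> carrier V"
      unfolding surj[symmetric] by auto
    ultimately show "a \<odot>\<^bsub>W\<^esub> x \<in> carrier W"
      by (simp add: smult cl)
  next
    fix x assume "x \<in> carrier W"
    then obtain u where "x = h u" "u \<in> carrier V"
      unfolding surj[symmetric] by auto
    then show "\<one>\<^bsub>K\<^esub> \<odot>\<^bsub>W\<^esub> x = x"
      by (simp add: smult)
  qed
  have bil: "bilinear_map K W W W (\<lambda>x y. x \<otimes>\<^bsub>W\<^esub> y)"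
    unfolding bilinear_map_def
  proof (intro conjI ballI linear_mapI)
    fix x y assume "x \<in> carrier W" "y \<in> carrier W"
    then obtain u v where "x = h u" "y = h v" "u \<in> carrier V" "v \<in> carrier V"
      unfolding surj[symmetric] by auto
    then show "x \<otimes>\<^bsub>W\<^esub> y \<in> carrier W" "x \<otimes>\<^bsub>W\<^esub> y \<in> carrier W"
      by (auto simp: mult V.mult_closed cl)
  next
    fix x y z assume "x \<in> carrier W" "y \<in> carrier W" "z \<in> carrier W"
    then obtain u v w where "x = h u" "y = h v" "z = h w" "u \<in> carrier V" "v \<in> carrier V"
      "w \<in> carrier V"
      unfolding surj[symmetric] by auto
    then show "x \<otimes>\<^bsub>W\<^esub> (y \<oplus>\<^bsub>W\<^esub> z) = x \<otimes>\<^bsub>W\<^esub> y \<oplus>\<^bsub>W\<^esub> x \<otimes>\<^bsub>W\<^esub> z"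
      "(y \<oplus>\<^bsub>W\<^esub> z) \<otimes>\<^bsub>W\<^esub> x = y \<otimes>\<^bsub>W\<^esub> x \<oplus>\<^bsub>W\<^esub> z \<otimes>\<^bsub>W\<^esub> x"
      by (auto simp: add mult V.mult_closed V.mult_add_left V.mult_add_right)
  next
    fix c x y assume "x \<in> carrier W" "y \<in> carrier W" "c \<in> carrier K"
    moreover from this obtain u v where "x = h u" "y = h v" "u \<in> carrier V" "v \<in> carrier V"
      unfolding surj[symmetric] by auto
    ultimately show "x \<otimes>\<^bsub>W\<^esub> (c \<odot>\<^bsub>W\<^esub> y) = c \<odot>\<^bsub>W\<^esub> (x \<otimes>\<^bsub>W\<^esub> y)"
      "(c \<odot>\<^bsub>W\<^esub> y) \<otimes>\<^bsub>W\<^esub> x = c \<odot>\<^bsub>W\<^esub> (y \<otimes>\<^bsub>W\<^esub> x)"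
      by (auto simp: smult mult V.mult_closed V.mult_smult_left V.mult_smult_right)
  qed
  interpret W: module K W by (rule modW)
  show "graded_algebra K W"
  proof unfold_locales
    show "part W i \<subseteq> carrier W" for i
      unfolding part surj[symmetric] using V.part_subset by auto
    show "\<exists>y\<in>part W 0. \<exists>z\<in>part W 1. x = y \<oplus>\<^bsub>W\<^esub> z" if "x \<in> carrier W" for x
    proof -
      from that obtain u where u: "x = h u" "u \<in> carrier V" unfolding surj[symmetric] by auto
      then obtain y z where yz: "u = y \<oplus>\<^bsub>V\<^esub> z" "y \<in> part V 0" "z \<in> part V 1"
        using V.part_span by blast
      then have "x = h y \<oplus>\<^bsub>W\<^esub> h z" using u by (simp add: add V.part_carrier)
      then show ?thesis using yz unfolding part by blast
    qed
  qed (rule bil)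
  show "superalgebra_hom K V W h"
    by (intro superalgebra_homI linear_mapI) (auto simp: cl add smult mult part)
qed

text \<open>In \<open>superalgebra_quot\<close>, product and scalar action are unions over
  representatives. Once these unions are seen to be single cosets, the coset map is compatible with
  all operations and \<open>graded_algebra_image\<close> supplies the structure.\<close>

lemma quotient_hom:
  assumes "graded_algebra K V" "two_sided_ideal K V I"
  shows "graded_algebra K (superalgebra_quot V I)"
    and "superalgebra_hom K V (superalgebra_quot V I) (\<lambda>x. I +>\<^bsub>V\<^esub> x)"
    and "carrier (superalgebra_quot V I) = (\<lambda>x. I +>\<^bsub>V\<^esub> x) ` carrier V"
    and "\<And>x y. x \<in> carrier V \<Longrightarrow> y \<in> carrier V \<Longrightarrow>
      I +>\<^bsub>V\<^esub> x = I +>\<^bsub>V\<^esub> y \<longleftrightarrow> x \<ominus>\<^bsub>V\<^esub> y \<in> I"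
proof -
  interpret V: graded_algebra K V by fact
  have sm: "submodule I K V"
    and id: "\<And>x y. x \<in> carrier V \<Longrightarrow> y \<in> I \<Longrightarrow> x \<otimes>\<^bsub>V\<^esub> y \<in> I"
      "\<And>x y. x \<in> carrier V \<Longrightarrow> y \<in> I \<Longrightarrow> y \<otimes>\<^bsub>V\<^esub> x \<in> I"
    using assms(2) unfolding two_sided_ideal_def by auto
  note sme = V.submoduleE[OF sm]
  interpret I: abelian_subgroup I V
    by (rule abelian_subgroupI3)
      (auto intro: additive_subgroup.intro submodule.axioms(1)[OF sm] V.M.abelian_group_axioms)
  show eq: "I +>\<^bsub>V\<^esub> x = I +>\<^bsub>V\<^esub> y \<longleftrightarrow> x \<ominus>\<^bsub>V\<^esub> y \<in> I"
    if "x \<in> carrier V" "y \<in> carrier V" for x y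
  proof -
    have "I +>\<^bsub>V\<^esub> x = I +>\<^bsub>V\<^esub> y \<longleftrightarrow> x \<in> I +>\<^bsub>V\<^esub> y"
      using I.a_repr_independence'[of x y] I.a_rcos_self[of x] that by blast
    then show ?thesis using I.a_rcos_module[of y x] that by (simp add: a_minus_def)
  qed
  have mem: "y \<in> carrier V" "y \<ominus>\<^bsub>V\<^esub> x \<in> I" if "x \<in> carrier V" "y \<in> I +>\<^bsub>V\<^esub> x" for x y
    using that I.a_elemrcos_carrier[of x y] I.a_rcos_module[of x y] by (simp_all add: a_minus_def)
  have sur: "carrier (superalgebra_quot V I) = (\<lambda>x. I +>\<^bsub>V\<^esub> x) ` carrier V"
    by (auto simp: superalgebra_quot_def A_RCOSETS_def')
  then show "carrier (superalgebra_quot V I) = (\<lambda>x. I +>\<^bsub>V\<^esub> x) ` carrier V" .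
  have smult: "(\<Union>y\<in>I +>\<^bsub>V\<^esub> x. I +>\<^bsub>V\<^esub> (c \<odot>\<^bsub>V\<^esub> y)) = I +>\<^bsub>V\<^esub> (c \<odot>\<^bsub>V\<^esub> x)"
    if "c \<in> carrier K" "x \<in> carrier V" for c x
  proof -
    have "I +>\<^bsub>V\<^esub> (c \<odot>\<^bsub>V\<^esub> y) = I +>\<^bsub>V\<^esub> (c \<odot>\<^bsub>V\<^esub> x)" if "y \<in> I +>\<^bsub>V\<^esub> x" for y
    proof -
      note y = mem[OF \<open>x \<in> carrier V\<close> that]
      have "c \<odot>\<^bsub>V\<^esub> y \<ominus>\<^bsub>V\<^esub> c \<odot>\<^bsub>V\<^esub> x = c \<odot>\<^bsub>V\<^esub> (y \<ominus>\<^bsub>V\<^esub> x)"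
        using \<open>c \<in> carrier K\<close> \<open>x \<in> carrier V\<close> y(1)
        by (simp add: a_minus_def V.smult_r_distr V.smult_r_minus)
      also have "\<dots> \<in> I" using sme(4) y(2) \<open>c \<in> carrier K\<close> by auto
      finally show ?thesis using eq \<open>c \<in> carrier K\<close> \<open>x \<in> carrier V\<close> y(1) by simp
    qed
    then show ?thesis using I.a_rcos_self[OF that(2)] by blast
  qed
  have mult: "rcoset_mult V I (I +>\<^bsub>V\<^esub> x) (I +>\<^bsub>V\<^esub> y) = I +>\<^bsub>V\<^esub> (x \<otimes>\<^bsub>V\<^esub> y)"
    if "x \<in> carrier V" "y \<in> carrier V" for x y
  proof -
    have "I +>\<^bsub>V\<^esub> (u \<otimes>\<^bsub>V\<^esub> v) = I +>\<^bsub>V\<^esub> (x \<otimes>\<^bsub>V\<^esub> y)"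
      if "u \<in> I +>\<^bsub>V\<^esub> x" "v \<in> I +>\<^bsub>V\<^esub> y" for u v
    proof -
      note u = mem[OF \<open>x \<in> carrier V\<close> that(1)] and v = mem[OF \<open>y \<in> carrier V\<close> that(2)]
      note c = u(1) v(1) \<open>x \<in> carrier V\<close> \<open>y \<in> carrier V\<close>
      \<comment> \<open>The representatives are exchanged one factor at a time, the left one here
        and the right one below; each exchange consumes one side of the two-sided ideal
        property.\<close>
      have "u \<otimes>\<^bsub>V\<^esub> v \<ominus>\<^bsub>V\<^esub> x \<otimes>\<^bsub>V\<^esub> v = (u \<ominus>\<^bsub>V\<^esub> x) \<otimes>\<^bsub>V\<^esub> v"
        using c by (simp add: V.mult_minus_left)
      then have 1: "I +>\<^bsub>V\<^esub> (u \<otimes>\<^bsub>V\<^esub> v) = I +>\<^bsub>V\<^esub> (x \<otimes>\<^bsub>V\<^esub> v)"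
        using eq id(2)[OF v(1) u(2)] c by (simp add: V.mult_closed)
      have "x \<otimes>\<^bsub>V\<^esub> v \<ominus>\<^bsub>V\<^esub> x \<otimes>\<^bsub>V\<^esub> y = x \<otimes>\<^bsub>V\<^esub> (v \<ominus>\<^bsub>V\<^esub> y)"
        using c by (simp add: V.mult_minus_right)
      then have "I +>\<^bsub>V\<^esub> (x \<otimes>\<^bsub>V\<^esub> v) = I +>\<^bsub>V\<^esub> (x \<otimes>\<^bsub>V\<^esub> y)"
        using eq id(1)[OF c(3) v(2)] c by (simp add: V.mult_closed)
      with 1 show ?thesis by simp
    qed
    then show ?thesis
      unfolding rcoset_mult_def using I.a_rcos_self[OF that(1)] I.a_rcos_self[OF that(2)] by blast
  qed
  note im = graded_algebra_image[where V = V and W = "superalgebra_quot V I"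
      and h = "\<lambda>x. I +>\<^bsub>V\<^esub> x", OF assms(1) sur[symmetric]]
  have z: "I +>\<^bsub>V\<^esub> \<zero>\<^bsub>V\<^esub> = I" using I.a_subset by simp
  show "graded_algebra K (superalgebra_quot V I)"
    by (rule im) (auto simp: superalgebra_quot_def z I.a_rcos_sum smult mult)
  show "superalgebra_hom K V (superalgebra_quot V I) (\<lambda>x. I +>\<^bsub>V\<^esub> x)"
    by (rule im) (auto simp: superalgebra_quot_def z I.a_rcos_sum smult mult)
qed

text \<open>The value on a coset is taken at a chosen representative. The choice does not matter,
  because two representatives differ by an element of \<open>I\<close>, which \<open>h\<close>
  kills.\<close>

lemma quotient_lift:
  assumes "graded_algebra K V" "graded_algebra K W" "two_sided_ideal K V I"
    and "superalgebra_hom K V W h" "\<And>x. x \<in> I \<Longrightarrow> h x = \<zero>\<^bsub>W\<^esub>"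
  obtains k where "superalgebra_hom K (superalgebra_quot V I) W k"
    and "\<And>x. x \<in> carrier V \<Longrightarrow> k (I +>\<^bsub>V\<^esub> x) = h x"
proof -
  interpret V: graded_algebra K V by fact
  interpret W: graded_algebra K W by fact
  note q = quotient_hom[OF assms(1,3)]
  note \<pi> = superalgebra_homD[OF q(2)]
  note \<pi>l = linear_mapD[OF \<pi>(1)]
  note h = superalgebra_homD[OF assms(4)]
  note hl = linear_mapD[OF h(1)]
  define k where "k = (\<lambda>C. h (inv_into (carrier V) (\<lambda>x. I +>\<^bsub>V\<^esub> x) C))"
  have k: "k (I +>\<^bsub>V\<^esub> x) = h x" if x: "x \<in> carrier V" for x
  proof -
    define y where "y = inv_into (carrier V) (\<lambda>x. I +>\<^bsub>V\<^esub> x) (I +>\<^bsub>V\<^esub> x)"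
    have y: "y \<in> carrier V" "I +>\<^bsub>V\<^esub> y = I +>\<^bsub>V\<^esub> x"
      unfolding y_def using x by (auto intro: inv_into_into intro!: f_inv_into_f simp del: set_eq_iff)
    then have "h (y \<ominus>\<^bsub>V\<^esub> x) = \<zero>\<^bsub>W\<^esub>" using q(4) x assms(5) by auto
    then have "h y \<ominus>\<^bsub>W\<^esub> h x = \<zero>\<^bsub>W\<^esub>"
      using linear_map_minus[OF V.module_V W.module_V h(1)] x y by simp
    then show ?thesis
      unfolding k_def y_def[symmetric] using hl x y by (simp add: a_minus_def W.M.add.inv_solve_right')
  qed
  have "superalgebra_hom K (superalgebra_quot V I) W k"
  proof (intro superalgebra_homI linear_mapI)
    fix x assume "x \<in> carrier (superalgebra_quot V I)"
    then obtain u where u: "x = I +>\<^bsub>V\<^esub> u" "u \<in> carrier V" unfolding q(3) by auto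
    then show "k x \<in> carrier W" using k hl by simp
    show "k (c \<odot>\<^bsub>superalgebra_quot V I\<^esub> x) = c \<odot>\<^bsub>W\<^esub> k x" if "c \<in> carrier K" for c
      using u that by (simp add: k hl \<pi>l(2,3)[symmetric])
    fix y assume "y \<in> carrier (superalgebra_quot V I)"
    then obtain v where v: "y = I +>\<^bsub>V\<^esub> v" "v \<in> carrier V" unfolding q(3) by auto
    show "k (x \<oplus>\<^bsub>superalgebra_quot V I\<^esub> y) = k x \<oplus>\<^bsub>W\<^esub> k y"
      using u v by (simp add: k hl \<pi>l(2,3)[symmetric])
    show "k (x \<otimes>\<^bsub>superalgebra_quot V I\<^esub> y) = k x \<otimes>\<^bsub>W\<^esub> k y"
      using u v by (simp add: k h V.mult_closed \<pi>(2)[symmetric])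
  next
    fix i x assume "x \<in> part (superalgebra_quot V I) i"
    then obtain u where "x = I +>\<^bsub>V\<^esub> u" "u \<in> part V i" by (auto simp: superalgebra_quot_def)
    then show "k x \<in> part W i" using k h V.part_carrier by auto
  qed
  with k that show thesis by blast
qed

section \<open>The free nonassociative superalgebra and evaluation of words\<close>

lemma free_superalgebra_simps:
  "carrier (free_superalgebra K X) = fin_supp K (words X 0 \<union> words X 1)"
  "part (free_superalgebra K X) i = fin_supp K (words X i)"
  "p \<otimes>\<^bsub>free_superalgebra K X\<^esub> q =
    (\<lambda>w. case w of Gen x \<Rightarrow> \<zero>\<^bsub>K\<^esub> | Prod u v \<Rightarrow> p u \<otimes>\<^bsub>K\<^esub> q v)"
  "\<zero>\<^bsub>free_superalgebra K X\<^esub> = (\<lambda>w. \<zero>\<^bsub>K\<^esub>)"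
  "p \<oplus>\<^bsub>free_superalgebra K X\<^esub> q = (\<lambda>w. p w \<oplus>\<^bsub>K\<^esub> q w)"
  "c \<odot>\<^bsub>free_superalgebra K X\<^esub> p = (\<lambda>w. c \<otimes>\<^bsub>K\<^esub> p w)"
  unfolding free_superalgebra_def Let_def fin_supp_def by simp_all

lemma words_Gen: "x \<in> X i \<Longrightarrow> Gen x \<in> words X i"
  unfolding words_def by (auto intro: words_par.intros)

lemma words_Prod: "u \<in> words X i \<Longrightarrow> v \<in> words X j \<Longrightarrow> Prod u v \<in> words X (i + j)"
  unfolding words_def mem_Collect_eq by (rule words_par.intros(2))

lemma words_Prod_Un:
  assumes "u \<in> words X 0 \<union> words X 1" "v \<in> words X 0 \<union> words X 1"
  shows "Prod u v \<in> words X 0 \<union> words X 1"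
proof -
  obtain i j where "u \<in> words X i" "v \<in> words X j" using assms by auto
  then have "Prod u v \<in> words X (i + j)" by (rule words_Prod)
  then show ?thesis by (metis UnCI bit_not_zero_iff)
qed

lemma words_induct [consumes 1, case_names Gen Prod]:
  assumes "w \<in> words X i"
    and "\<And>x i. x \<in> X i \<Longrightarrow> P (Gen x) i"
    and "\<And>u v i j. u \<in> words X i \<Longrightarrow> v \<in> words X j \<Longrightarrow> P u i \<Longrightarrow> P v j \<Longrightarrow> P (Prod u v) (i + j)"
  shows "P w i"
proof -
  have "(w, i) \<in> words_par X" using assms(1) unfolding words_def by simp
  then show ?thesis
  proof induction
    case (1 x i)
    then show ?case by (rule assms(2))
  next
    case (2 u i v j)
    then show ?case by (intro assms(3)) (simp_all add: words_def)
  qed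
qed

text \<open>A word is a product in at most one way, so a coefficient of the product is a single term
  and no convolution sum occurs. The support is covered by the products of pairs from the two finite
  supports.\<close>

lemma (in cring) fin_supp_mult:
  assumes "p \<in> fin_supp R (words X 0 \<union> words X 1)" "q \<in> fin_supp R (words X 0 \<union> words X 1)"
  shows "(\<lambda>w. case w of Gen x \<Rightarrow> \<zero> | Prod u v \<Rightarrow> p u \<otimes> q v)
    \<in> fin_supp R (words X 0 \<union> words X 1)"
proof -
  define m where "m = (\<lambda>w. case w of Gen x \<Rightarrow> \<zero> | Prod u v \<Rightarrow> p u \<otimes> q v)"
  note r = fin_supp_range[OF assms(1)] fin_supp_range[OF assms(2)]
  have supp: "\<exists>u v. w = Prod u v \<and> p u \<noteq> \<zero> \<and> q v \<noteq> \<zero>" if "m w \<noteq> \<zero>" for w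
    using that r by (cases w) (auto simp: m_def)
  have p: "u \<in> words X 0 \<union> words X 1" if "p u \<noteq> \<zero>" for u
    using assms(1) that unfolding fin_supp_def by blast
  have q: "u \<in> words X 0 \<union> words X 1" if "q u \<noteq> \<zero>" for u
    using assms(2) that unfolding fin_supp_def by blast
  have "range m \<subseteq> carrier R" using r by (auto simp: m_def split: word.split)
  moreover have "{w. m w \<noteq> \<zero>} \<subseteq> words X 0 \<union> words X 1"
  proof
    fix w assume "w \<in> {w. m w \<noteq> \<zero>}"
    then obtain u v where w: "w = Prod u v" "p u \<noteq> \<zero>" "q v \<noteq> \<zero>" using supp[of w] by auto
    show "w \<in> words X 0 \<union> words X 1"
      unfolding w(1) by (rule words_Prod_Un[OF p[OF w(2)] q[OF w(3)]])
  qed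
  moreover have "finite {w. m w \<noteq> \<zero>}"
  proof (rule finite_subset)
    show "{w. m w \<noteq> \<zero>} \<subseteq> (\<lambda>(u, v). Prod u v) ` ({u. p u \<noteq> \<zero>} \<times> {v. q v \<noteq> \<zero>})"
    proof
      fix w assume "w \<in> {w. m w \<noteq> \<zero>}"
      then obtain u v where "w = Prod u v" "p u \<noteq> \<zero>" "q v \<noteq> \<zero>" using supp[of w] by auto
      then show "w \<in> (\<lambda>(u, v). Prod u v) ` ({u. p u \<noteq> \<zero>} \<times> {v. q v \<noteq> \<zero>})" by auto
    qed
    show "finite ((\<lambda>(u, v). Prod u v) ` ({u. p u \<noteq> \<zero>} \<times> {v. q v \<noteq> \<zero>}))"
      using assms by (auto simp: fin_supp_def)
  qed
  ultimately have "m \<in> fin_supp R (words X 0 \<union> words X 1)"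
    unfolding fin_supp_def by simp
  then show ?thesis unfolding m_def .
qed

lemma free_superalgebra_graded:
  assumes "field K"
  shows "graded_algebra K (free_superalgebra K X)"
proof -
  interpret K: field K by fact
  let ?F = "free_superalgebra K X" and ?W = "words X 0 \<union> words X 1"
  note s = free_superalgebra_simps
  note r = fin_supp_range[of _ K ?W]
  have "abelian_group ?F"
  proof (rule abelian_groupI)
    fix p assume p: "p \<in> carrier ?F"
    show "\<exists>q\<in>carrier ?F. q \<oplus>\<^bsub>?F\<^esub> p = \<zero>\<^bsub>?F\<^esub>"
    proof
      show "(\<lambda>w. (\<ominus>\<^bsub>K\<^esub> \<one>\<^bsub>K\<^esub>) \<otimes>\<^bsub>K\<^esub> p w) \<in> carrier ?F"
        using p by (auto simp: s intro: K.fin_supp_smult)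
      show "(\<lambda>w. (\<ominus>\<^bsub>K\<^esub> \<one>\<^bsub>K\<^esub>) \<otimes>\<^bsub>K\<^esub> p w) \<oplus>\<^bsub>?F\<^esub> p = \<zero>\<^bsub>?F\<^esub>"
        using p r by (auto simp: s K.l_minus K.l_neg)
    qed
  qed (auto simp: s r K.a_ac K.fin_supp_zero intro: K.fin_supp_add)
  then have "module K ?F"
    by (intro moduleI) (auto simp: s r K.l_distr K.r_distr K.m_ac K.is_cring intro: K.fin_supp_smult)
  then interpret F: module K ?F .
  show ?thesis
  proof unfold_locales
    show "part ?F i \<subseteq> carrier ?F" for i
      unfolding s by (rule fin_supp_mono) (cases i; auto)
    show "bilinear_map K ?F ?F ?F (\<lambda>x y. x \<otimes>\<^bsub>?F\<^esub> y)"
      unfolding bilinear_map_def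
      by (intro conjI ballI linear_mapI)
        (auto simp: s r K.r_distr K.l_distr K.m_ac fun_eq_iff K.fin_supp_mult split: word.split)
    fix p assume p: "p \<in> carrier ?F"
    \<comment> \<open>If \<open>X 0\<close> and \<open>X 1\<close> overlap, a word can carry both
      parities. Every word of parity zero is given to \<open>p0\<close> and the rest to
      \<open>p1\<close>, so nothing is counted twice.\<close>
    define p0 p1 where "p0 = (\<lambda>w. if w \<in> words X 0 then p w else \<zero>\<^bsub>K\<^esub>)"
      and "p1 = (\<lambda>w. if w \<in> words X 0 then \<zero>\<^bsub>K\<^esub> else p w)"
    have ps: "finite {w. p w \<noteq> \<zero>\<^bsub>K\<^esub>}" "{w. p w \<noteq> \<zero>\<^bsub>K\<^esub>} \<subseteq> ?W"
      using p by (auto simp: s fin_supp_def)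
    have "{w. p0 w \<noteq> \<zero>\<^bsub>K\<^esub>} \<subseteq> {w. p w \<noteq> \<zero>\<^bsub>K\<^esub>}" "{w. p1 w \<noteq> \<zero>\<^bsub>K\<^esub>} \<subseteq> {w. p w \<noteq> \<zero>\<^bsub>K\<^esub>}"
      by (auto simp: p0_def p1_def)
    then have "finite {w. p0 w \<noteq> \<zero>\<^bsub>K\<^esub>}" "finite {w. p1 w \<noteq> \<zero>\<^bsub>K\<^esub>}"
      using ps(1) by (auto intro: finite_subset)
    moreover have "range p0 \<subseteq> carrier K" "range p1 \<subseteq> carrier K"
      using p r by (auto simp: s p0_def p1_def)
    moreover have "{w. p0 w \<noteq> \<zero>\<^bsub>K\<^esub>} \<subseteq> words X 0" "{w. p1 w \<noteq> \<zero>\<^bsub>K\<^esub>} \<subseteq> words X 1"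
      using ps(2) by (auto simp: p0_def p1_def)
    ultimately have "p0 \<in> part ?F 0" "p1 \<in> part ?F 1"
      unfolding s fin_supp_def by auto
    moreover have "p = p0 \<oplus>\<^bsub>?F\<^esub> p1"
      using p r unfolding s p0_def p1_def by (auto simp: fun_eq_iff)
    ultimately show "\<exists>y\<in>part ?F 0. \<exists>z\<in>part ?F 1. p = y \<oplus>\<^bsub>?F\<^esub> z" by blast
  qed
qed

lemma free_gen_delta: "free_gen K x = delta K (Gen x)"
  unfolding free_gen_def delta_def ..

lemma (in cring) delta_Prod:
  "delta R (Prod u v) = (\<lambda>w. case w of Gen x \<Rightarrow> \<zero> | Prod u' v' \<Rightarrow> delta R u u' \<otimes> delta R v v')"
  by (auto simp: delta_def fun_eq_iff split: word.split)

primrec word_eval :: "('k, 'v, 'm) superalgebra_scheme \<Rightarrow> ('x \<Rightarrow> 'v) \<Rightarrow> 'x word \<Rightarrow> 'v"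
  where
    "word_eval V g (Gen x) = g x"
  | "word_eval V g (Prod u v) = word_eval V g u \<otimes>\<^bsub>V\<^esub> word_eval V g v"

text \<open>Evaluation on words is extended linearly. Multiplicativity compares two bilinear maps,
  so it need only hold for indicators of words, where it is the recursion of
  \<open>word_eval\<close>.\<close>

lemma free_superalgebra_lift:
  assumes "superalgebra K V" "\<And>i x. x \<in> X i \<Longrightarrow> g x \<in> part V i"
  shows "superalgebra_hom K (free_superalgebra K X) V (fin_comb K V (word_eval V g))"
proof -
  interpret V: superalgebra K V by fact
  let ?F = "free_superalgebra K X" and ?W = "words X 0 \<union> words X 1"
  let ?h = "fin_comb K V (word_eval V g)"
  note s = free_superalgebra_simps
  interpret F: graded_algebra K ?F by (rule free_superalgebra_graded) (rule V.field_axioms)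
  have evp: "word_eval V g w \<in> part V i" if "w \<in> words X i" for w i
    using that
  proof (induction rule: words_induct)
    case (Gen x i)
    then show ?case by (simp add: assms(2))
  next
    case (Prod u v i j)
    from Prod.IH show ?case unfolding word_eval.simps by (rule V.mult_graded)
  qed
  then have ev: "word_eval V g \<in> ?W \<rightarrow> carrier V" using V.part_carrier by blast
  have lin: "linear_map K ?F V ?h"
    by (rule linear_mapI)
      (auto simp: s V.fin_comb_add[OF _ _ ev] V.fin_comb_smult[OF _ _ ev] V.fin_comb_closed[OF _ ev]
        simp del: Un_iff)
  have hd: "?h (delta K w) = word_eval V g w" if "w \<in> ?W" for w
    using ev that by (intro V.fin_comb_delta) auto
  \<comment> \<open>The analogue of \<open>linear_map_eq_on_basis\<close>, with the indicators of
    words in the role of the basis.\<close>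
  have eq: "h p = k p" if "linear_map K ?F V h" "linear_map K ?F V k" "p \<in> carrier ?F"
    and "\<And>w. w \<in> ?W \<Longrightarrow> h (delta K w) = k (delta K w)" for h k p
    using that(3) unfolding s(1)
  proof (induction rule: V.fin_supp_induct)
    case zero
    show ?case
      using linear_map_zero[OF F.module_V V.module_V that(1)]
        linear_map_zero[OF F.module_V V.module_V that(2)] by (simp add: s)
  next
    case (add p q)
    then show ?case
      using linear_mapD(2)[OF that(1), of p q] linear_mapD(2)[OF that(2), of p q] by (simp add: s)
  next
    case (smult c p)
    then show ?case
      using linear_mapD(3)[OF that(1), of c p] linear_mapD(3)[OF that(2), of c p] by (simp add: s)
  qed (rule that(4))
  show ?thesis
  proof (rule superalgebra_homI)
    show "linear_map K ?F V ?h" by (rule lin)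
    have dl: "delta K w \<in> carrier ?F" if "w \<in> ?W" for w
      unfolding s using that by (rule V.fin_supp_delta)
    have hm: "bilinear_map K ?F ?F V (\<lambda>p q. ?h (p \<otimes>\<^bsub>?F\<^esub> q))"
      by (rule bilinear_map_comp_left[OF F.bilinear lin])
    have mh: "bilinear_map K ?F ?F V (\<lambda>p q. ?h p \<otimes>\<^bsub>V\<^esub> ?h q)"
      by (rule bilinear_map_comp[OF V.bilinear lin lin])
    fix p q assume p: "p \<in> carrier ?F" and q: "q \<in> carrier ?F"
    have dd: "?h (delta K u \<otimes>\<^bsub>?F\<^esub> delta K v) = ?h (delta K u) \<otimes>\<^bsub>V\<^esub> ?h (delta K v)"
      if "u \<in> ?W" "v \<in> ?W" for u v
      using hd[OF words_Prod_Un[OF that]] hd[OF that(1)] hd[OF that(2)]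
      by (simp add: s V.delta_Prod)
    have "?h (delta K u \<otimes>\<^bsub>?F\<^esub> q) = ?h (delta K u) \<otimes>\<^bsub>V\<^esub> ?h q" if "u \<in> ?W" for u
      by (rule eq[OF bilinear_mapD(1)[OF hm dl[OF that]] bilinear_mapD(1)[OF mh dl[OF that]] q])
        (rule dd[OF that])
    then show "?h (p \<otimes>\<^bsub>?F\<^esub> q) = ?h p \<otimes>\<^bsub>V\<^esub> ?h q"
      by (intro eq[OF bilinear_mapD(2)[OF hm q] bilinear_mapD(2)[OF mh q] p])
  next
    fix i p assume "p \<in> part ?F i"
    then have "p \<in> fin_supp K (words X i)" by (simp add: s)
    moreover have ev': "word_eval V g \<in> words X i \<rightarrow> carrier V"
      using evp V.part_carrier by blast
    ultimately show "?h p \<in> part V i"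
    proof (induction rule: V.fin_supp_induct)
      case (delta w)
      then show ?case using evp[OF delta(1)] V.part_carrier by (simp add: V.fin_comb_delta)
    qed (auto simp: V.fin_comb_zero V.fin_comb_add[OF _ _ ev'] V.fin_comb_smult[OF _ _ ev']
        intro: V.part_zero V.part_add V.part_smult)
  qed
qed

section \<open>The free Leibniz superalgebra and its universal property\<close>

lemma leibniz_relators_subset:
  assumes "graded_algebra K V"
  shows "leibniz_relators K V \<subseteq> carrier V"
proof -
  interpret V: graded_algebra K V by fact
  show ?thesis
    unfolding leibniz_relators_def
    by (auto simp: V.part_carrier V.mult_closed V.sgn_pow_closed)
qed

text \<open>A relator is the difference of the two sides of the Leibniz identity. Parity-preserving
  maps keep the sign, so its image is the same difference formed in \<open>W\<close>, which is
  zero.\<close>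

lemma leibniz_relators_hom_zero:
  assumes "graded_algebra K V" "leibniz_superalgebra K W" "superalgebra_hom K V W h"
    and "r \<in> leibniz_relators K V"
  shows "h r = \<zero>\<^bsub>W\<^esub>"
proof -
  interpret V: graded_algebra K V by fact
  interpret W: leibniz_superalgebra K W by fact
  note h = superalgebra_homD[OF assms(3)]
  note hl = linear_mapD[OF h(1)] and hm = linear_map_minus[OF V.module_V W.module_V h(1)]
  obtain x y z i j l where r: "r = (x \<otimes>\<^bsub>V\<^esub> (y \<otimes>\<^bsub>V\<^esub> z)) \<ominus>\<^bsub>V\<^esub>
       (((x \<otimes>\<^bsub>V\<^esub> y) \<otimes>\<^bsub>V\<^esub> z) \<ominus>\<^bsub>V\<^esub> sgn_pow K (l * j) \<odot>\<^bsub>V\<^esub> ((x \<otimes>\<^bsub>V\<^esub> z) \<otimes>\<^bsub>V\<^esub> y))"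
    and p: "x \<in> part V i" "y \<in> part V j" "z \<in> part V l"
    using assms(4) unfolding leibniz_relators_def by blast
  note c = V.part_carrier[OF p(1)] V.part_carrier[OF p(2)] V.part_carrier[OF p(3)]
  have "h r = (h x \<otimes>\<^bsub>W\<^esub> (h y \<otimes>\<^bsub>W\<^esub> h z)) \<ominus>\<^bsub>W\<^esub>
       (((h x \<otimes>\<^bsub>W\<^esub> h y) \<otimes>\<^bsub>W\<^esub> h z) \<ominus>\<^bsub>W\<^esub> sgn_pow K (l * j) \<odot>\<^bsub>W\<^esub> ((h x \<otimes>\<^bsub>W\<^esub> h z) \<otimes>\<^bsub>W\<^esub> h y))"
    unfolding r using c by (simp add: h hl hm V.mult_closed V.sgn_pow_closed)
  also have "\<dots> = \<zero>\<^bsub>W\<^esub>"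
    unfolding W.leibniz[OF h(3)[OF p(1)] h(3)[OF p(2)] h(3)[OF p(3)], symmetric]
    using c by (simp add: a_minus_def hl W.mult_closed W.M.r_neg)
  finally show ?thesis .
qed

lemma leibniz_ideal_ideal:
  assumes "field K"
  shows "two_sided_ideal K (free_superalgebra K X) (leibniz_ideal K X)"
  unfolding leibniz_ideal_def
  using graded_algebra.ideal_generated_ideal[OF free_superalgebra_graded[OF assms]
      leibniz_relators_subset[OF free_superalgebra_graded[OF assms]]] .

lemma Lb_graded:
  assumes "field K"
  shows "graded_algebra K (Lb K X)"
  unfolding Lb_def
  by (rule quotient_hom[OF free_superalgebra_graded[OF assms] leibniz_ideal_ideal[OF assms]])

lemma free_gen_closed:
  assumes "field K" "x \<in> X 0 \<union> X 1"
  shows "free_gen K x \<in> carrier (free_superalgebra K X)"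
proof -
  interpret K: field K by fact
  show ?thesis
    unfolding free_superalgebra_simps free_gen_delta
    using assms(2) by (intro K.fin_supp_delta) (auto intro: words_Gen)
qed

lemma Lb_gen_closed:
  assumes "field K" "x \<in> X 0 \<union> X 1"
  shows "Lb_gen K X x \<in> carrier (Lb K X)"
  unfolding Lb_def Lb_gen_def
    quotient_hom(3)[OF free_superalgebra_graded[OF assms(1)] leibniz_ideal_ideal[OF assms(1)]]
  using free_gen_closed[where X = X, OF assms] by auto

text \<open>The universal property of \<open>Lb\<close>: evaluation of words in a Leibniz
  superalgebra kills the Leibniz relators and hence descends to the quotient by the ideal they
  generate.\<close>

lemma Lb_lift:
  assumes "leibniz_superalgebra K V" "\<And>i x. x \<in> X i \<Longrightarrow> g x \<in> part V i"
  obtains h where "superalgebra_hom K (Lb K X) V h"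
    and "\<And>x. x \<in> X 0 \<union> X 1 \<Longrightarrow> h (Lb_gen K X x) = g x"
proof -
  interpret V: leibniz_superalgebra K V by fact
  let ?F = "free_superalgebra K X"
  have F: "graded_algebra K ?F" by (rule free_superalgebra_graded) (rule V.field_axioms)
  let ?h = "fin_comb K V (word_eval V g)"
  have h: "superalgebra_hom K ?F V ?h"
    by (rule free_superalgebra_lift) (auto intro: assms(2) V.superalgebra_axioms)
  have "leibniz_ideal K X \<subseteq> {p \<in> carrier ?F. ?h p = \<zero>\<^bsub>V\<^esub>}"
    unfolding leibniz_ideal_def
    using leibniz_relators_subset[OF F] leibniz_relators_hom_zero[OF F assms(1) h]
    by (intro ideal_generated_least superalgebra_hom_kernel[OF F V.graded_algebra_axioms h]) auto
  then obtain k where k: "superalgebra_hom K (Lb K X) V k"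
      "\<And>p. p \<in> carrier ?F \<Longrightarrow> k (leibniz_ideal K X +>\<^bsub>?F\<^esub> p) = ?h p"
    using quotient_lift[OF F V.graded_algebra_axioms leibniz_ideal_ideal[OF V.field_axioms] h]
    unfolding Lb_def by blast
  have "k (Lb_gen K X x) = g x" if "x \<in> X 0 \<union> X 1" for x
  proof -
    have "k (Lb_gen K X x) = ?h (free_gen K x)"
      unfolding Lb_gen_def using free_gen_closed[OF V.field_axioms that] by (rule k(2))
    moreover have "g x \<in> carrier V" using that assms(2) V.part_carrier by blast
    ultimately show ?thesis unfolding free_gen_delta by (simp add: V.fin_comb_delta)
  qed
  with k(1) that show thesis by blast
qed

section \<open>Presented superalgebras: relations, maps out of them, generation\<close>

lemma Lb_pres_graded:
  assumes "field K" "S \<subseteq> carrier (Lb K X)"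
  shows "graded_algebra K (Lb_pres K X S)"
    and "superalgebra_hom K (Lb K X) (Lb_pres K X S) (\<lambda>x. ideal_generated K (Lb K X) S +>\<^bsub>Lb K X\<^esub> x)"
    and "r \<in> S \<Longrightarrow> ideal_generated K (Lb K X) S +>\<^bsub>Lb K X\<^esub> r = \<zero>\<^bsub>Lb_pres K X S\<^esub>"
proof -
  interpret L: graded_algebra K "Lb K X" by (rule Lb_graded[OF assms(1)])
  let ?J = "ideal_generated K (Lb K X) S"
  have J: "two_sided_ideal K (Lb K X) ?J"
    by (rule L.ideal_generated_ideal[OF assms(2)])
  note q = quotient_hom[OF L.graded_algebra_axioms J]
  show "graded_algebra K (Lb_pres K X S)"
    and h: "superalgebra_hom K (Lb K X) (Lb_pres K X S) (\<lambda>x. ?J +>\<^bsub>Lb K X\<^esub> x)"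
    using q(1,2) unfolding Lb_pres_def .
  then interpret P: graded_algebra K "Lb_pres K X S" by simp
  show "?J +>\<^bsub>Lb K X\<^esub> r = \<zero>\<^bsub>Lb_pres K X S\<^esub>" if "r \<in> S"
  proof -
    have r: "r \<in> carrier (Lb K X)" "r \<in> ?J"
      using that assms(2) ideal_generated_superset[of S K "Lb K X"] by auto
    have "\<ominus>\<^bsub>Lb K X\<^esub> \<zero>\<^bsub>Lb K X\<^esub> = \<zero>\<^bsub>Lb K X\<^esub>"
      by (rule L.M.minus_equality) auto
    then have "r \<ominus>\<^bsub>Lb K X\<^esub> \<zero>\<^bsub>Lb K X\<^esub> = r"
      unfolding a_minus_def using r(1) by (simp only: L.M.r_zero)
    with r have "?J +>\<^bsub>Lb K X\<^esub> r = ?J +>\<^bsub>Lb K X\<^esub> \<zero>\<^bsub>Lb K X\<^esub>"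
      using q(4)[OF r(1) L.M.zero_closed] by (simp only:)
    also have "\<dots> = \<zero>\<^bsub>Lb_pres K X S\<^esub>"
      by (rule linear_map_zero[OF L.module_V P.module_V superalgebra_homD(1)[OF h]])
    finally show ?thesis .
  qed
qed

text \<open>The kernel of \<open>h\<close> is an ideal containing the relators, so \<open>h\<close>
  factors through the presentation. The Leibniz identity of the target has already been spent in
  producing \<open>h\<close> by \<open>Lb_lift\<close>.\<close>

lemma Lb_pres_lift:
  assumes "S \<subseteq> carrier (Lb K X)" "graded_algebra K V" "superalgebra_hom K (Lb K X) V h"
    and "\<And>r. r \<in> S \<Longrightarrow> h r = \<zero>\<^bsub>V\<^esub>"
  obtains k where "superalgebra_hom K (Lb_pres K X S) V k"
    and "\<And>x. x \<in> carrier (Lb K X) \<Longrightarrow> k (ideal_generated K (Lb K X) S +>\<^bsub>Lb K X\<^esub> x) = h x"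
proof -
  interpret V: graded_algebra K V by fact
  interpret L: graded_algebra K "Lb K X" by (rule Lb_graded[OF V.field_axioms])
  let ?J = "ideal_generated K (Lb K X) S"
  have J: "two_sided_ideal K (Lb K X) ?J"
    by (rule L.ideal_generated_ideal[OF assms(1)])
  have "?J \<subseteq> {x \<in> carrier (Lb K X). h x = \<zero>\<^bsub>V\<^esub>}"
    using assms(1,4)
    by (intro ideal_generated_least
        superalgebra_hom_kernel[OF L.graded_algebra_axioms V.graded_algebra_axioms assms(3)]) auto
  then show thesis
    using quotient_lift[OF L.graded_algebra_axioms V.graded_algebra_axioms J assms(3)] that
    unfolding Lb_pres_def by blast
qed

text \<open>An induction principle: the presentation is the image of the free superalgebra under two
  successive quotient maps. Images of single words are in \<open>T\<close> by closure under
  products, all others by closure under linear combinations.\<close>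

lemma Lb_pres_generated:
  assumes "field K" "S \<subseteq> carrier (Lb K X)"
    and gen: "\<And>x. x \<in> X 0 \<union> X 1 \<Longrightarrow> Lb_pres_gen K X S x \<in> T"
    and zero: "\<zero>\<^bsub>Lb_pres K X S\<^esub> \<in> T"
    and add: "\<And>x y. x \<in> T \<Longrightarrow> y \<in> T \<Longrightarrow> x \<oplus>\<^bsub>Lb_pres K X S\<^esub> y \<in> T"
    and smult: "\<And>c x. c \<in> carrier K \<Longrightarrow> x \<in> T \<Longrightarrow> c \<odot>\<^bsub>Lb_pres K X S\<^esub> x \<in> T"
    and mult: "\<And>x y. x \<in> T \<Longrightarrow> y \<in> T \<Longrightarrow> x \<otimes>\<^bsub>Lb_pres K X S\<^esub> y \<in> T"
  shows "carrier (Lb_pres K X S) \<subseteq> T"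
proof -
  interpret K: field K by fact
  let ?F = "free_superalgebra K X" and ?W = "words X 0 \<union> words X 1"
  let ?I = "leibniz_ideal K X" and ?J = "ideal_generated K (Lb K X) S"
  let ?\<pi> = "\<lambda>p. ?J +>\<^bsub>Lb K X\<^esub> (?I +>\<^bsub>?F\<^esub> p)"
  note s = free_superalgebra_simps
  interpret F: graded_algebra K ?F by (rule free_superalgebra_graded[OF assms(1)])
  interpret L: graded_algebra K "Lb K X" by (rule Lb_graded[OF assms(1)])
  interpret P: graded_algebra K "Lb_pres K X S" by (rule Lb_pres_graded[OF assms(1,2)])
  note q1 = quotient_hom[OF F.graded_algebra_axioms leibniz_ideal_ideal[OF assms(1)],
      folded Lb_def]
  note q2 = quotient_hom[OF L.graded_algebra_axioms L.ideal_generated_ideal[OF assms(2)],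
      folded Lb_pres_def]
  have hom: "superalgebra_hom K ?F (Lb_pres K X S) ?\<pi>"
    by (rule superalgebra_hom_comp[OF q1(2) q2(2)])
  note \<pi> = superalgebra_homD[OF hom]
  note \<pi>l = linear_mapD[OF \<pi>(1)]
  have "?\<pi> (delta K w) \<in> T" if "w \<in> words X i" for w i
    using that
  proof (induction rule: words_induct)
    case (Gen x i)
    have "x \<in> X 0 \<union> X 1" using Gen by (metis UnCI bit_not_zero_iff)
    from gen[OF this] show ?case
      unfolding Lb_pres_gen_def Lb_gen_def free_gen_delta .
  next
    case (Prod u v i j)
    have "u \<in> ?W" "v \<in> ?W" using Prod.hyps by (metis UnCI bit_not_zero_iff)+
    then have c: "delta K u \<in> carrier ?F" "delta K v \<in> carrier ?F"
      unfolding s by (auto intro: K.fin_supp_delta)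
    have "delta K (Prod u v) = delta K u \<otimes>\<^bsub>?F\<^esub> delta K v"
      by (simp add: s K.delta_Prod)
    then show ?case using \<pi>(2)[OF c] mult[OF Prod.IH] by simp
  qed
  then have d: "?\<pi> (delta K w) \<in> T" if "w \<in> ?W" for w using that by blast
  have "?\<pi> p \<in> T" if "p \<in> carrier ?F" for p
    using that unfolding s
  proof (induction rule: K.fin_supp_induct)
    case zero
    show ?case
      using linear_map_zero[OF F.module_V P.module_V \<pi>(1)] assms(4) by (simp add: s)
  next
    case (add p q)
    then show ?case using \<pi>l(2)[of p q] assms(5) by (simp add: s)
  next
    case (smult c p)
    then show ?case using \<pi>l(3)[of c p] assms(6) by (simp add: s)
  qed (rule d)
  moreover have "carrier (Lb_pres K X S) = ?\<pi> ` carrier ?F"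
    unfolding q2(3) q1(3) image_image ..
  ultimately show ?thesis by auto
qed

section \<open>The explicit model of an extension\<close>

text \<open>The counterpart of describing a group extension with abelian kernel by a factor set,
  here \<open>\<beta>\<close>. The product of \<open>a\<close> and \<open>a'\<close> contributes no
  term because the product of \<open>\<AA>\<close> is zero.\<close>

definition ext_model ::
  "('k, 'a, 'm) superalgebra_scheme \<Rightarrow> ('k, 'b, 'n) superalgebra_scheme \<Rightarrow>
    ('b \<Rightarrow> 'a \<Rightarrow> 'a) \<Rightarrow> ('a \<Rightarrow> 'b \<Rightarrow> 'a) \<Rightarrow> ('b \<Rightarrow> 'b \<Rightarrow> 'a) \<Rightarrow> ('k, 'a \<times> 'b) superalgebra"
  where "ext_model \<AA> \<BB> lft rgt \<beta> =
    \<lparr>carrier = carrier \<AA> \<times> carrier \<BB>,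
     mult = (\<lambda>(a, b) (a', b'). (rgt a b' \<oplus>\<^bsub>\<AA>\<^esub> lft b a' \<oplus>\<^bsub>\<AA>\<^esub> \<beta> b b', b \<otimes>\<^bsub>\<BB>\<^esub> b')),
     one = undefined,
     zero = (\<zero>\<^bsub>\<AA>\<^esub>, \<zero>\<^bsub>\<BB>\<^esub>),
     add = (\<lambda>(x, y) (x', y'). (x \<oplus>\<^bsub>\<AA>\<^esub> x', y \<oplus>\<^bsub>\<BB>\<^esub> y')),
     smult = (\<lambda>c (x, y). (c \<odot>\<^bsub>\<AA>\<^esub> x, c \<odot>\<^bsub>\<BB>\<^esub> y)),
     part = (\<lambda>i. part \<AA> i \<times> part \<BB> i)\<rparr>"

lemma ext_model_simps:
  "carrier (ext_model \<AA> \<BB> lft rgt \<beta>) = carrier \<AA> \<times> carrier \<BB>"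
  "(a, b) \<otimes>\<^bsub>ext_model \<AA> \<BB> lft rgt \<beta>\<^esub> (a', b') =
    (rgt a b' \<oplus>\<^bsub>\<AA>\<^esub> lft b a' \<oplus>\<^bsub>\<AA>\<^esub> \<beta> b b', b \<otimes>\<^bsub>\<BB>\<^esub> b')"
  "\<zero>\<^bsub>ext_model \<AA> \<BB> lft rgt \<beta>\<^esub> = (\<zero>\<^bsub>\<AA>\<^esub>, \<zero>\<^bsub>\<BB>\<^esub>)"
  "(a, b) \<oplus>\<^bsub>ext_model \<AA> \<BB> lft rgt \<beta>\<^esub> (a', b') = (a \<oplus>\<^bsub>\<AA>\<^esub> a', b \<oplus>\<^bsub>\<BB>\<^esub> b')"
  "c \<odot>\<^bsub>ext_model \<AA> \<BB> lft rgt \<beta>\<^esub> (a, b) = (c \<odot>\<^bsub>\<AA>\<^esub> a, c \<odot>\<^bsub>\<BB>\<^esub> b)"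
  "part (ext_model \<AA> \<BB> lft rgt \<beta>) i = part \<AA> i \<times> part \<BB> i"
  unfolding ext_model_def by simp_all

text \<open>Bridge to the final statement, which speaks of \<open>direct_sum\<close>: the two
  records have the same carrier, addition and scalar action, and linearity sees nothing
  else.\<close>

lemma linear_map_direct_sum_iff:
  "linear_map K (direct_sum \<AA> \<BB>) W h \<longleftrightarrow> linear_map K (ext_model \<AA> \<BB> lft rgt \<beta>) W h"
  unfolding linear_map_def direct_sum_def ext_model_def by simp

lemma (in abelian_group) minus_eq_zero_iff:
  "x \<in> carrier G \<Longrightarrow> y \<in> carrier G \<Longrightarrow> x \<ominus> y = \<zero> \<longleftrightarrow> x = y"
  using r_neg add.inv_solve_right'[of \<zero> x y] unfolding a_minus_def by auto

text \<open>Translates between the cocycle identity as a vanishing six-term sum and the arrangement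
  in which its terms occur in the Leibniz identity of the model.\<close>

lemma (in abelian_group) six_term_iff:
  assumes "p \<in> carrier G" "q \<in> carrier G" "l \<in> carrier G" "m \<in> carrier G" "n \<in> carrier G"
    "k \<in> carrier G"
  shows "p \<ominus> q \<ominus> l \<oplus> m \<ominus> n \<ominus> k = \<zero> \<longleftrightarrow> l \<oplus> k = (p \<oplus> m) \<ominus> (q \<oplus> n)"
proof -
  have "p \<ominus> q \<ominus> l \<oplus> m \<ominus> n \<ominus> k = ((p \<oplus> m) \<ominus> (q \<oplus> n)) \<ominus> (l \<oplus> k)"
    using assms by (simp add: a_minus_def minus_add a_ac)
  moreover have "\<dots> = \<zero> \<longleftrightarrow> (p \<oplus> m) \<ominus> (q \<oplus> n) = l \<oplus> k"
    using assms by (intro minus_eq_zero_iff) auto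
  ultimately show ?thesis by auto
qed

section \<open>Bases with trivial product on the kernel, and the data of an extension\<close>

locale extension_bases = A: leibniz_superalgebra K \<AA> + B: leibniz_superalgebra K \<BB>
  for K :: "('k, 'r) ring_scheme"
    and \<AA> :: "('k, 'a) superalgebra" and \<BB> :: "('k, 'b) superalgebra" +
  fixes A :: "bit \<Rightarrow> 'a set" and B :: "bit \<Rightarrow> 'b set"
  assumes basis_A: "\<And>i. linear_basis K \<AA> (part \<AA> i) (A i)"
    and basis_B: "\<And>i. linear_basis K \<BB> (part \<BB> i) (B i)"
    and trivial: "\<And>a a'. a \<in> A 0 \<union> A 1 \<Longrightarrow> a' \<in> A 0 \<union> A 1 \<Longrightarrow> a \<otimes>\<^bsub>\<AA>\<^esub> a' = \<zero>\<^bsub>\<AA>\<^esub>"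
begin

abbreviation "bA \<equiv> A 0 \<union> A 1"
abbreviation "bB \<equiv> B 0 \<union> B 1"

lemma full_basis_A: "linear_basis K \<AA> (carrier \<AA>) bA"
  by (rule A.linear_basis_union) (rule basis_A)

lemma full_basis_B: "linear_basis K \<BB> (carrier \<BB>) bB"
  by (rule B.linear_basis_union) (rule basis_B)

lemma bA_part: "a \<in> A i \<Longrightarrow> a \<in> part \<AA> i"
  using basis_A[of i] A.fin_comb_delta[of "\<lambda>s. s" a] A.fin_supp_delta[of a "A i"]
    A.lin_span_eq[of "A i"]
  unfolding linear_basis_def by (metis image_eqI subsetD)

lemma bB_part: "b \<in> B i \<Longrightarrow> b \<in> part \<BB> i"
  using basis_B[of i] B.fin_comb_delta[of "\<lambda>s. s" b] A.fin_supp_delta[of b "B i"]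
    B.lin_span_eq[of "B i"]
  unfolding linear_basis_def by (metis image_eqI subsetD)

lemma bA_carrier: "a \<in> bA \<Longrightarrow> a \<in> carrier \<AA>"
  using bA_part A.part_carrier by blast

lemma bB_carrier: "b \<in> bB \<Longrightarrow> b \<in> carrier \<BB>"
  using bB_part B.part_carrier by blast

lemma trivial_mult:
  assumes "a \<in> carrier \<AA>" "a' \<in> carrier \<AA>"
  shows "a \<otimes>\<^bsub>\<AA>\<^esub> a' = \<zero>\<^bsub>\<AA>\<^esub>"
  by (rule bilinear_map_eq_on_basis[OF A.module_V A.module_V A.module_V full_basis_A full_basis_A
      A.bilinear bilinear_map_const_zero[OF A.module_V] _ assms]) (rule trivial)

end

locale extension_datum = extension_bases K \<AA> \<BB> A B
  for K :: "('k, 'r) ring_scheme"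
    and \<AA> :: "('k, 'a) superalgebra" and \<BB> :: "('k, 'b) superalgebra" and A B +
  fixes lft :: "'b \<Rightarrow> 'a \<Rightarrow> 'a" and rgt :: "'a \<Rightarrow> 'b \<Rightarrow> 'a" and \<beta> :: "'b \<Rightarrow> 'b \<Rightarrow> 'a"
  assumes data: "ext_data K \<AA> \<BB> B lft rgt \<beta>"
begin

lemma supermodule: "supermodule K \<BB> \<AA> lft rgt"
  and \<beta>_bilinear: "bilinear_map K \<BB> \<BB> \<AA> \<beta>"
  using data unfolding ext_data_def by simp_all

lemmas supermodule_unfolded = supermodule[unfolded supermodule_def]
lemmas lft_bilinear = supermodule_unfolded[THEN conjunct1]
lemmas rgt_bilinear = supermodule_unfolded[THEN conjunct2, THEN conjunct1]
lemmas rgt_graded = supermodule_unfolded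
  [THEN conjunct2, THEN conjunct2, THEN conjunct1, rule_format]
lemmas lft_graded = supermodule_unfolded
  [THEN conjunct2, THEN conjunct2, THEN conjunct2, THEN conjunct1, rule_format]
lemmas supermodule_laws = supermodule_unfolded
  [THEN conjunct2, THEN conjunct2, THEN conjunct2, THEN conjunct2, rule_format]
lemmas \<beta>_basis = data[unfolded ext_data_def, THEN conjunct2, THEN conjunct2, THEN conjunct1, rule_format]
lemmas cocycle_basis = data
  [unfolded ext_data_def, THEN conjunct2, THEN conjunct2, THEN conjunct2, rule_format]

lemmas lft_lin1 = bilinear_mapD(2)[OF lft_bilinear]
lemmas lft_lin2 = bilinear_mapD(1)[OF lft_bilinear]
lemmas rgt_lin1 = bilinear_mapD(2)[OF rgt_bilinear]
lemmas rgt_lin2 = bilinear_mapD(1)[OF rgt_bilinear]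
lemmas \<beta>_lin1 = bilinear_mapD(2)[OF \<beta>_bilinear]
lemmas \<beta>_lin2 = bilinear_mapD(1)[OF \<beta>_bilinear]
lemmas mB_lin1 = bilinear_mapD(2)[OF B.bilinear]
lemmas mB_lin2 = bilinear_mapD(1)[OF B.bilinear]

lemma lft_closed: "x \<in> carrier \<BB> \<Longrightarrow> f \<in> carrier \<AA> \<Longrightarrow> lft x f \<in> carrier \<AA>"
  using linear_mapD(1)[OF lft_lin2] by auto

lemma rgt_closed: "f \<in> carrier \<AA> \<Longrightarrow> x \<in> carrier \<BB> \<Longrightarrow> rgt f x \<in> carrier \<AA>"
  using linear_mapD(1)[OF rgt_lin2] by auto

lemma \<beta>_closed: "x \<in> carrier \<BB> \<Longrightarrow> y \<in> carrier \<BB> \<Longrightarrow> \<beta> x y \<in> carrier \<AA>"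
  using linear_mapD(1)[OF \<beta>_lin2] by auto

lemma part_B_span:
  "x \<in> part \<BB> i \<Longrightarrow> x \<in> lin_span K \<BB> (B i)" "B i \<subseteq> carrier \<BB>"
  using basis_B[of i] unfolding linear_basis_def by auto

text \<open>The parity of \<open>\<beta>\<close> is prescribed on basis elements only. Each
  homogeneous part is the span of one \<open>B i\<close>, so the statement extends through the
  second argument and then through the first.\<close>

lemma \<beta>_graded:
  assumes x: "x \<in> part \<BB> i" and y: "y \<in> part \<BB> j"
  shows "\<beta> x y \<in> part \<AA> (i + j)"
proof -
  note ext = linear_map_span_part[OF B.module_V A.superalgebra_axioms _ part_B_span(2)]
  have "\<beta> b y \<in> part \<AA> (i + j)" if b: "b \<in> B i" for b
  proof -
    have "b \<in> carrier \<BB>" using b part_B_span(2) by auto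
    from ext[OF \<beta>_lin2[OF this] \<beta>_basis[OF b] part_B_span(1)[OF y]] show ?thesis .
  qed
  from ext[OF \<beta>_lin1[OF B.part_carrier[OF y]] this part_B_span(1)[OF x]] show ?thesis .
qed

text \<open>Both sides are linear in each argument, and the sign is constant because the parities
  are fixed. Starting from triples of basis elements, the arguments \<open>z\<close>,
  \<open>y\<close>, \<open>x\<close> are freed in this order. The basis elements \<open>b''\<close>,
  \<open>b\<close>, \<open>b'\<close> of the hypothesis correspond to \<open>x\<close>,
  \<open>y\<close>, \<open>z\<close>.\<close>

lemma cocycle:
  assumes x: "x \<in> part \<BB> l" and y: "y \<in> part \<BB> i" and z: "z \<in> part \<BB> j"
  shows "lft x (\<beta> y z) \<oplus>\<^bsub>\<AA>\<^esub> \<beta> x (y \<otimes>\<^bsub>\<BB>\<^esub> z) =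
    (rgt (\<beta> x y) z \<oplus>\<^bsub>\<AA>\<^esub> \<beta> (x \<otimes>\<^bsub>\<BB>\<^esub> y) z) \<ominus>\<^bsub>\<AA>\<^esub>
      sgn_pow K (i * j) \<odot>\<^bsub>\<AA>\<^esub> (rgt (\<beta> x z) y \<oplus>\<^bsub>\<AA>\<^esub> \<beta> (x \<otimes>\<^bsub>\<BB>\<^esub> z) y)"
    (is "?L x y z = ?R x y z")
proof -
  let ?s = "sgn_pow K (i * j)"
  note mods = B.module_V A.module_V
  note cl = lft_closed rgt_closed \<beta>_closed B.mult_closed
  have base: "?L b'' b b' = ?R b'' b b'" if b: "b \<in> B i" "b' \<in> B j" "b'' \<in> B l" for b b' b''
  proof -
    have c: "b \<in> carrier \<BB>" "b' \<in> carrier \<BB>" "b'' \<in> carrier \<BB>"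
      using b part_B_span(2) by auto
    show ?thesis
      using cocycle_basis[OF b] by (subst (asm) A.M.six_term_iff) (use c in \<open>auto simp: cl A.smult_r_distr A.sgn_pow_closed\<close>)
  qed
  have lin1: "linear_map K \<BB> \<AA> (\<lambda>u. ?L u v w)" "linear_map K \<BB> \<AA> (\<lambda>u. ?R u v w)"
    if "v \<in> carrier \<BB>" "w \<in> carrier \<BB>" for v w
    using that
    by (auto intro!: linear_map_add[OF mods] linear_map_diff[OF mods] linear_map_smult[OF mods] A.sgn_pow_closed
        lft_lin1 \<beta>_lin1 linear_map_comp[OF \<beta>_lin1 rgt_lin1] linear_map_comp[OF mB_lin1 \<beta>_lin1] cl)
  have lin2: "linear_map K \<BB> \<AA> (\<lambda>v. ?L u v w)" "linear_map K \<BB> \<AA> (\<lambda>v. ?R u v w)"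
    if "u \<in> carrier \<BB>" "w \<in> carrier \<BB>" for u w
    using that
    by (auto intro!: linear_map_add[OF mods] linear_map_diff[OF mods] linear_map_smult[OF mods] A.sgn_pow_closed
        linear_map_comp[OF \<beta>_lin1 lft_lin2] linear_map_comp[OF mB_lin1 \<beta>_lin2]
        linear_map_comp[OF \<beta>_lin2 rgt_lin1] linear_map_comp[OF mB_lin2 \<beta>_lin1] rgt_lin2 \<beta>_lin2 cl)
  have lin3: "linear_map K \<BB> \<AA> (\<lambda>w. ?L u v w)" "linear_map K \<BB> \<AA> (\<lambda>w. ?R u v w)"
    if "u \<in> carrier \<BB>" "v \<in> carrier \<BB>" for u v
    using that
    by (auto intro!: linear_map_add[OF mods] linear_map_diff[OF mods] linear_map_smult[OF mods] A.sgn_pow_closed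
        linear_map_comp[OF \<beta>_lin2 lft_lin2] linear_map_comp[OF mB_lin2 \<beta>_lin2]
        linear_map_comp[OF \<beta>_lin2 rgt_lin1] linear_map_comp[OF mB_lin2 \<beta>_lin1] rgt_lin2 \<beta>_lin2 cl)
  note ext = linear_map_eq_on_span[OF mods part_B_span(2)]
  note c = B.part_carrier[OF x] B.part_carrier[OF y] B.part_carrier[OF z]
  have "?L b'' b z = ?R b'' b z" if b: "b \<in> B i" "b'' \<in> B l" for b b''
  proof -
    have bc: "b'' \<in> carrier \<BB>" "b \<in> carrier \<BB>" using b part_B_span(2) by auto
    show ?thesis
      by (rule ext[OF lin3[OF bc] _ part_B_span(1)[OF z]]) (rule base[OF b(1) _ b(2)])
  qed
  then have "?L b'' y z = ?R b'' y z" if b: "b'' \<in> B l" for b''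
  proof -
    have bc: "b'' \<in> carrier \<BB>" using b part_B_span(2) by auto
    show ?thesis
      by (rule ext[OF lin2[OF bc c(3)] _ part_B_span(1)[OF y]])
        (rule \<open>\<And>b'' b. b \<in> B i \<Longrightarrow> b'' \<in> B l \<Longrightarrow> ?L b'' b z = ?R b'' b z\<close>[OF _ b])
  qed
  then show ?thesis
    by (rule ext[OF lin1[OF c(2,3)] _ part_B_span(1)[OF x]])
qed

section \<open>The model satisfies the axioms of a Leibniz superalgebra\<close>

abbreviation "D \<equiv> ext_model \<AA> \<BB> lft rgt \<beta>"

lemma D_module: "module K D"
proof -
  note s = ext_model_simps
  have "abelian_group D"
  proof (rule abelian_groupI)
    fix x assume "x \<in> carrier D"
    then obtain a b where x: "x = (a, b)" "a \<in> carrier \<AA>" "b \<in> carrier \<BB>" by (auto simp: s)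
    then have "(\<ominus>\<^bsub>\<AA>\<^esub> a, \<ominus>\<^bsub>\<BB>\<^esub> b) \<in> carrier D" "(\<ominus>\<^bsub>\<AA>\<^esub> a, \<ominus>\<^bsub>\<BB>\<^esub> b) \<oplus>\<^bsub>D\<^esub> x = \<zero>\<^bsub>D\<^esub>"
      by (auto simp: s A.M.l_neg B.M.l_neg)
    then show "\<exists>y\<in>carrier D. y \<oplus>\<^bsub>D\<^esub> x = \<zero>\<^bsub>D\<^esub>" by blast
  qed (auto simp: s A.M.a_ac B.M.a_ac)
  then show ?thesis
    by (intro moduleI)
      (auto simp: s A.is_cring A.smult_l_distr A.smult_r_distr A.smult_assoc1
        B.smult_l_distr B.smult_r_distr B.smult_assoc1)
qed

lemma fst_linear: "linear_map K D \<AA> fst" and snd_linear: "linear_map K D \<BB> snd"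
  by (auto intro!: linear_mapI simp: ext_model_simps)

lemma inl_linear: "linear_map K \<AA> D (\<lambda>a. (a, \<zero>\<^bsub>\<BB>\<^esub>))"
  and inr_linear: "linear_map K \<BB> D (\<lambda>b. (\<zero>\<^bsub>\<AA>\<^esub>, b))"
  by (auto intro!: linear_mapI simp: ext_model_simps)

lemma D_graded:
  assumes "x \<in> part D i" "y \<in> part D j"
  shows "x \<otimes>\<^bsub>D\<^esub> y \<in> part D (i + j)"
proof -
  obtain a b a' b' where x: "x = (a, b)" "a \<in> part \<AA> i" "b \<in> part \<BB> i"
    and y: "y = (a', b')" "a' \<in> part \<AA> j" "b' \<in> part \<BB> j"
    using assms by (auto simp: ext_model_simps)
  show ?thesis
    unfolding x(1) y(1) ext_model_simps
    by (intro SigmaI A.part_add rgt_graded lft_graded \<beta>_graded B.mult_graded x y)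
qed

lemma D_bilinear: "bilinear_map K D D D (\<lambda>x y. x \<otimes>\<^bsub>D\<^esub> y)"
proof -
  note s = ext_model_simps
  note cl = lft_closed rgt_closed \<beta>_closed B.mult_closed
  note lin = linear_mapD(2,3)[OF lft_lin1] linear_mapD(2,3)[OF lft_lin2]
    linear_mapD(2,3)[OF rgt_lin1] linear_mapD(2,3)[OF rgt_lin2]
    linear_mapD(2,3)[OF \<beta>_lin1] linear_mapD(2,3)[OF \<beta>_lin2]
    B.mult_add_left B.mult_add_right B.mult_smult_left B.mult_smult_right
  show ?thesis
    unfolding bilinear_map_def
  proof (intro conjI ballI linear_mapI)
    fix x y assume "x \<in> carrier D" "y \<in> carrier D"
    then show "x \<otimes>\<^bsub>D\<^esub> y \<in> carrier D" "x \<otimes>\<^bsub>D\<^esub> y \<in> carrier D"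
      by (auto simp: s cl)
  next
    fix x y z assume "x \<in> carrier D" "y \<in> carrier D" "z \<in> carrier D"
    then show "x \<otimes>\<^bsub>D\<^esub> (y \<oplus>\<^bsub>D\<^esub> z) = x \<otimes>\<^bsub>D\<^esub> y \<oplus>\<^bsub>D\<^esub> x \<otimes>\<^bsub>D\<^esub> z"
      "(y \<oplus>\<^bsub>D\<^esub> z) \<otimes>\<^bsub>D\<^esub> x = y \<otimes>\<^bsub>D\<^esub> x \<oplus>\<^bsub>D\<^esub> z \<otimes>\<^bsub>D\<^esub> x"
      by (auto simp: s cl lin A.M.a_ac)
  next
    fix c x y assume "x \<in> carrier D" "y \<in> carrier D" "c \<in> carrier K"
    then show "x \<otimes>\<^bsub>D\<^esub> (c \<odot>\<^bsub>D\<^esub> y) = c \<odot>\<^bsub>D\<^esub> (x \<otimes>\<^bsub>D\<^esub> y)"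
      "(c \<odot>\<^bsub>D\<^esub> y) \<otimes>\<^bsub>D\<^esub> x = c \<odot>\<^bsub>D\<^esub> (y \<otimes>\<^bsub>D\<^esub> x)"
      by (auto simp: s cl lin A.smult_r_distr)
  qed
qed

lemma D_superalgebra: "superalgebra K D"
proof -
  note s = ext_model_simps
  interpret D: module K D by (rule D_module)
  show ?thesis
  proof (rule superalgebra.intro[OF A.field_axioms D_module], rule superalgebra_axioms.intro)
    show "submodule (part D i) K D" for i
    proof (rule D.submoduleI)
      fix x assume "x \<in> part D i"
      then obtain a b where x: "x = (a, b)" "a \<in> part \<AA> i" "b \<in> part \<BB> i" by (auto simp: s)
      \<comment> \<open>Negation is not a field of the record but the inverse for
        \<open>add\<close>, so its componentwise form rests on uniqueness of inverses.\<close>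
      have "\<ominus>\<^bsub>D\<^esub> x = (\<ominus>\<^bsub>\<AA>\<^esub> a, \<ominus>\<^bsub>\<BB>\<^esub> b)"
        by (rule D.M.minus_equality)
          (use x A.part_carrier[OF x(2)] B.part_carrier[OF x(3)] in \<open>auto simp: s A.M.l_neg B.M.l_neg\<close>)
      then show "\<ominus>\<^bsub>D\<^esub> x \<in> part D i" using x by (auto simp: s A.part_neg B.part_neg)
    qed (use A.part_carrier B.part_carrier in \<open>auto simp: s A.part_zero B.part_zero A.part_add B.part_add
        A.part_smult B.part_smult\<close>)
    show "carrier D = part D 0 <+>\<^bsub>D\<^esub> part D 1"
    proof
      show "part D 0 <+>\<^bsub>D\<^esub> part D 1 \<subseteq> carrier D"
        using A.part_carrier B.part_carrier by (auto simp: s set_add_def')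
      show "carrier D \<subseteq> part D 0 <+>\<^bsub>D\<^esub> part D 1"
      proof
        fix x assume "x \<in> carrier D"
        then obtain a b where x: "x = (a, b)" "a \<in> carrier \<AA>" "b \<in> carrier \<BB>" by (auto simp: s)
        obtain a0 a1 where a: "a = a0 \<oplus>\<^bsub>\<AA>\<^esub> a1" "a0 \<in> part \<AA> 0" "a1 \<in> part \<AA> 1"
          using A.part_span[OF x(2)] by blast
        obtain b0 b1 where b: "b = b0 \<oplus>\<^bsub>\<BB>\<^esub> b1" "b0 \<in> part \<BB> 0" "b1 \<in> part \<BB> 1"
          using B.part_span[OF x(3)] by blast
        have "x = (a0, b0) \<oplus>\<^bsub>D\<^esub> (a1, b1)" "(a0, b0) \<in> part D 0" "(a1, b1) \<in> part D 1"
          using x a b by (auto simp: s)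
        then show "x \<in> part D 0 <+>\<^bsub>D\<^esub> part D 1" unfolding set_add_def' by blast
      qed
    qed
    show "part D 0 \<inter> part D 1 = {\<zero>\<^bsub>D\<^esub>}"
      using A.part_direct B.part_direct by (auto simp: s)
  qed (rule D_bilinear, rule D_graded)
qed

text \<open>In the first component every term involves at most one of \<open>a\<close>,
  \<open>a'\<close>, \<open>a''\<close>, since a product of two elements of \<open>\<AA>\<close>
  contributes nothing. Sorting by the one that occurs separates the identity into independent
  pieces; the terms free of all three form the cocycle identity.\<close>

lemma D_leibniz: "leibniz_superalgebra K D"
proof -
  note s = ext_model_simps
  note cl = lft_closed rgt_closed \<beta>_closed B.mult_closed
  interpret D: superalgebra K D by (rule D_superalgebra)
  show ?thesis
  proof (rule leibniz_superalgebra.intro[OF D_superalgebra], rule leibniz_superalgebra_axioms.intro)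
    fix x i y j z l assume "x \<in> part D i" "y \<in> part D j" "z \<in> part D l"
    then obtain a b a' b' a'' b'' where x: "x = (a, b)" "a \<in> part \<AA> i" "b \<in> part \<BB> i"
      and y: "y = (a', b')" "a' \<in> part \<AA> j" "b' \<in> part \<BB> j"
      and z: "z = (a'', b'')" "a'' \<in> part \<AA> l" "b'' \<in> part \<BB> l"
      by (auto simp: s)
    define \<sigma> where "\<sigma> = sgn_pow K (l * j)"
    have \<sigma>: "\<sigma> \<in> carrier K" unfolding \<sigma>_def by (rule A.sgn_pow_closed)
    have \<sigma>': "sgn_pow K (j * l) = \<sigma>" unfolding \<sigma>_def by (simp only: mult.commute)
    note ac = A.part_carrier[OF x(2)] A.part_carrier[OF y(2)] A.part_carrier[OF z(2)]
    note bc = B.part_carrier[OF x(3)] B.part_carrier[OF y(3)] B.part_carrier[OF z(3)]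
    have D: "x \<in> carrier D" "y \<in> carrier D" "z \<in> carrier D" using x y z ac bc by (auto simp: s)
    \<comment> \<open>The supermodule laws are used in the order in which the element of
      \<open>\<AA>\<close> stands in the first, the third and the second place of the triple
      product.\<close>
    have 1: "rgt a (b' \<otimes>\<^bsub>\<BB>\<^esub> b'') = rgt (rgt a b') b'' \<ominus>\<^bsub>\<AA>\<^esub> \<sigma> \<odot>\<^bsub>\<AA>\<^esub> rgt (rgt a b'') b'"
      using supermodule_laws[OF x(2) y(3) z(3)] unfolding \<sigma>' by (rule conjunct1)
    have 2: "lft b (lft b' a'') = lft (b \<otimes>\<^bsub>\<BB>\<^esub> b') a'' \<ominus>\<^bsub>\<AA>\<^esub> \<sigma> \<odot>\<^bsub>\<AA>\<^esub> rgt (lft b a'') b'"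
      using supermodule_laws[OF z(2) x(3) y(3)] unfolding \<sigma>_def by blast
    have 3: "lft b (rgt a' b'') = rgt (lft b a') b'' \<ominus>\<^bsub>\<AA>\<^esub> \<sigma> \<odot>\<^bsub>\<AA>\<^esub> lft (b \<otimes>\<^bsub>\<BB>\<^esub> b'') a'"
      using supermodule_laws[OF y(2) x(3) z(3)] unfolding \<sigma>' by blast
    have 4: "lft b (\<beta> b' b'') \<oplus>\<^bsub>\<AA>\<^esub> \<beta> b (b' \<otimes>\<^bsub>\<BB>\<^esub> b'') =
      (rgt (\<beta> b b') b'' \<oplus>\<^bsub>\<AA>\<^esub> \<beta> (b \<otimes>\<^bsub>\<BB>\<^esub> b') b'') \<ominus>\<^bsub>\<AA>\<^esub>
      \<sigma> \<odot>\<^bsub>\<AA>\<^esub> (rgt (\<beta> b b'') b' \<oplus>\<^bsub>\<AA>\<^esub> \<beta> (b \<otimes>\<^bsub>\<BB>\<^esub> b'') b')"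
      using cocycle[OF x(3) y(3) z(3)] unfolding \<sigma>' .
    have lft_add: "lft b (u \<oplus>\<^bsub>\<AA>\<^esub> v) = lft b u \<oplus>\<^bsub>\<AA>\<^esub> lft b v" if "u \<in> carrier \<AA>" "v \<in> carrier \<AA>" for u v
      using linear_mapD(2)[OF lft_lin2] bc that by blast
    have rgt_add: "rgt (u \<oplus>\<^bsub>\<AA>\<^esub> v) c = rgt u c \<oplus>\<^bsub>\<AA>\<^esub> rgt v c"
      if "u \<in> carrier \<AA>" "v \<in> carrier \<AA>" "c \<in> carrier \<BB>" for u v c
      using linear_mapD(2)[OF rgt_lin1] that by blast
    have "fst (x \<otimes>\<^bsub>D\<^esub> (y \<otimes>\<^bsub>D\<^esub> z)) =
        rgt a (b' \<otimes>\<^bsub>\<BB>\<^esub> b'') \<oplus>\<^bsub>\<AA>\<^esub> (lft b (rgt a' b'') \<oplus>\<^bsub>\<AA>\<^esub> lft b (lft b' a'')) \<oplus>\<^bsub>\<AA>\<^esub>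
        (lft b (\<beta> b' b'') \<oplus>\<^bsub>\<AA>\<^esub> \<beta> b (b' \<otimes>\<^bsub>\<BB>\<^esub> b''))"
      using x y z ac bc by (simp add: s cl lft_add A.M.a_ac)
    also have "\<dots> = (rgt (rgt a b') b'' \<oplus>\<^bsub>\<AA>\<^esub> rgt (lft b a') b'' \<oplus>\<^bsub>\<AA>\<^esub> rgt (\<beta> b b') b''
          \<oplus>\<^bsub>\<AA>\<^esub> lft (b \<otimes>\<^bsub>\<BB>\<^esub> b') a'' \<oplus>\<^bsub>\<AA>\<^esub> \<beta> (b \<otimes>\<^bsub>\<BB>\<^esub> b') b'') \<ominus>\<^bsub>\<AA>\<^esub>
        \<sigma> \<odot>\<^bsub>\<AA>\<^esub> (rgt (rgt a b'') b' \<oplus>\<^bsub>\<AA>\<^esub> rgt (lft b a'') b' \<oplus>\<^bsub>\<AA>\<^esub> rgt (\<beta> b b'') b'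
          \<oplus>\<^bsub>\<AA>\<^esub> lft (b \<otimes>\<^bsub>\<BB>\<^esub> b'') a' \<oplus>\<^bsub>\<AA>\<^esub> \<beta> (b \<otimes>\<^bsub>\<BB>\<^esub> b'') b')"
      unfolding 1 2 3 4
      using \<sigma> ac bc by (simp add: cl a_minus_def A.smult_r_distr A.M.minus_add A.M.a_ac)
    also have "\<dots> = fst (x \<otimes>\<^bsub>D\<^esub> y \<otimes>\<^bsub>D\<^esub> z \<ominus>\<^bsub>D\<^esub> \<sigma> \<odot>\<^bsub>D\<^esub> (x \<otimes>\<^bsub>D\<^esub> z \<otimes>\<^bsub>D\<^esub> y))"
    proof -
      \<comment> \<open>Subtraction in the model is also a derived operation; linearity of the
        projection carries it to the component.\<close>
      have "fst (x \<otimes>\<^bsub>D\<^esub> y \<otimes>\<^bsub>D\<^esub> z \<ominus>\<^bsub>D\<^esub> \<sigma> \<odot>\<^bsub>D\<^esub> (x \<otimes>\<^bsub>D\<^esub> z \<otimes>\<^bsub>D\<^esub> y)) =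
          fst (x \<otimes>\<^bsub>D\<^esub> y \<otimes>\<^bsub>D\<^esub> z) \<ominus>\<^bsub>\<AA>\<^esub> fst (\<sigma> \<odot>\<^bsub>D\<^esub> (x \<otimes>\<^bsub>D\<^esub> z \<otimes>\<^bsub>D\<^esub> y))"
        using \<sigma> D by (intro linear_map_minus[OF D_module A.module_V fst_linear])
          (auto intro!: D.mult_closed D.smult_closed)
      then show ?thesis
        using x y z ac bc \<sigma> by (simp add: s cl rgt_add)
    qed
    finally have fst_eq: "fst (x \<otimes>\<^bsub>D\<^esub> (y \<otimes>\<^bsub>D\<^esub> z)) =
      fst (x \<otimes>\<^bsub>D\<^esub> y \<otimes>\<^bsub>D\<^esub> z \<ominus>\<^bsub>D\<^esub> \<sigma> \<odot>\<^bsub>D\<^esub> (x \<otimes>\<^bsub>D\<^esub> z \<otimes>\<^bsub>D\<^esub> y))" .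
    have "snd (x \<otimes>\<^bsub>D\<^esub> y \<otimes>\<^bsub>D\<^esub> z \<ominus>\<^bsub>D\<^esub> \<sigma> \<odot>\<^bsub>D\<^esub> (x \<otimes>\<^bsub>D\<^esub> z \<otimes>\<^bsub>D\<^esub> y)) =
        snd (x \<otimes>\<^bsub>D\<^esub> y \<otimes>\<^bsub>D\<^esub> z) \<ominus>\<^bsub>\<BB>\<^esub> snd (\<sigma> \<odot>\<^bsub>D\<^esub> (x \<otimes>\<^bsub>D\<^esub> z \<otimes>\<^bsub>D\<^esub> y))"
      using \<sigma> D by (intro linear_map_minus[OF D_module B.module_V snd_linear])
        (auto intro!: D.mult_closed D.smult_closed)
    also have "\<dots> = snd (x \<otimes>\<^bsub>D\<^esub> (y \<otimes>\<^bsub>D\<^esub> z))"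
      using B.leibniz[OF x(3) y(3) z(3), folded \<sigma>_def] x y z by (simp add: s)
    finally have "snd (x \<otimes>\<^bsub>D\<^esub> (y \<otimes>\<^bsub>D\<^esub> z)) =
      snd (x \<otimes>\<^bsub>D\<^esub> y \<otimes>\<^bsub>D\<^esub> z \<ominus>\<^bsub>D\<^esub> \<sigma> \<odot>\<^bsub>D\<^esub> (x \<otimes>\<^bsub>D\<^esub> z \<otimes>\<^bsub>D\<^esub> y))" by simp
    with fst_eq show "x \<otimes>\<^bsub>D\<^esub> (y \<otimes>\<^bsub>D\<^esub> z) =
      x \<otimes>\<^bsub>D\<^esub> y \<otimes>\<^bsub>D\<^esub> z \<ominus>\<^bsub>D\<^esub> sgn_pow K (l * j) \<odot>\<^bsub>D\<^esub> (x \<otimes>\<^bsub>D\<^esub> z \<otimes>\<^bsub>D\<^esub> y)"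
      unfolding \<sigma>_def by (rule prod_eqI)
  qed
qed

end

section \<open>The presented superalgebra is the explicit model\<close>

context extension_datum
begin

abbreviation "X \<equiv> gens A B"
abbreviation "L \<equiv> Lb K X"
abbreviation "S \<equiv> ext_relators K \<AA> \<BB> A B lft rgt \<beta>"
abbreviation "P \<equiv> ext_alg K \<AA> \<BB> A B lft rgt \<beta>"
abbreviation "\<phi> \<equiv> ext_map K \<AA> \<BB> A B lft rgt \<beta>"
abbreviation "\<pi> \<equiv> \<lambda>x. ideal_generated K L S +>\<^bsub>L\<^esub> x"
abbreviation "gA a \<equiv> Lb_gen K X (Inl a)"
abbreviation "gB b \<equiv> Lb_gen K X (Inr b)"
abbreviation "inA \<equiv> read_in K \<AA> bA L (\<lambda>a. gA a)"
abbreviation "inB \<equiv> read_in K \<BB> bB L (\<lambda>b. gB b)"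
abbreviation "iA \<equiv> read_in K \<AA> bA P (\<lambda>a. Lb_pres_gen K X S (Inl a))"
abbreviation "iB \<equiv> read_in K \<BB> bB P (\<lambda>b. Lb_pres_gen K X S (Inr b))"

lemma gens_Un: "X 0 \<union> X 1 = Inl ` bA \<union> Inr ` bB"
  unfolding gens_def by auto

lemma L_graded: "graded_algebra K L"
  by (rule Lb_graded) (rule A.field_axioms)

lemma gA_closed: "a \<in> bA \<Longrightarrow> gA a \<in> carrier L"
  by (rule Lb_gen_closed[OF A.field_axioms]) (auto simp: gens_def)

lemma gB_closed: "b \<in> bB \<Longrightarrow> gB b \<in> carrier L"
  by (rule Lb_gen_closed[OF A.field_axioms]) (auto simp: gens_def)

lemma L_module: "module K L"
  using graded_algebra.module_V[OF L_graded] .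

lemma inA_linear: "linear_map K \<AA> L inA"
  by (rule linear_map_read_in[OF A.module_V L_module full_basis_A]) (auto intro: gA_closed)

lemma inB_linear: "linear_map K \<BB> L inB"
  by (rule linear_map_read_in[OF B.module_V L_module full_basis_B]) (auto intro: gB_closed)

lemma inA_basis: "a \<in> bA \<Longrightarrow> inA a = gA a"
  by (rule read_in_basis[OF A.module_V L_module full_basis_A]) (auto intro: gA_closed)

lemma inB_basis: "b \<in> bB \<Longrightarrow> inB b = gB b"
  by (rule read_in_basis[OF B.module_V L_module full_basis_B]) (auto intro: gB_closed)

lemma relators:
  "S = {gA a \<otimes>\<^bsub>L\<^esub> gA a' | a a'. a \<in> bA \<and> a' \<in> bA}
      \<union> {gA a \<otimes>\<^bsub>L\<^esub> gB b \<ominus>\<^bsub>L\<^esub> inA (rgt a b) | a b. a \<in> bA \<and> b \<in> bB}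
      \<union> {gB b \<otimes>\<^bsub>L\<^esub> gA a \<ominus>\<^bsub>L\<^esub> inA (lft b a) | a b. a \<in> bA \<and> b \<in> bB}
      \<union> {gB b \<otimes>\<^bsub>L\<^esub> gB b' \<ominus>\<^bsub>L\<^esub> inB (b \<otimes>\<^bsub>\<BB>\<^esub> b') \<ominus>\<^bsub>L\<^esub> inA (\<beta> b b')
          | b b'. b \<in> bB \<and> b' \<in> bB}"
  unfolding ext_relators_def Let_def ..

lemma relators_cases [consumes 1, case_names AA AB BA BB]:
  assumes "r \<in> S"
    and "\<And>a a'. a \<in> bA \<Longrightarrow> a' \<in> bA \<Longrightarrow> Q (gA a \<otimes>\<^bsub>L\<^esub> gA a')"
    and "\<And>a b. a \<in> bA \<Longrightarrow> b \<in> bB \<Longrightarrow> Q (gA a \<otimes>\<^bsub>L\<^esub> gB b \<ominus>\<^bsub>L\<^esub> inA (rgt a b))"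
    and "\<And>a b. a \<in> bA \<Longrightarrow> b \<in> bB \<Longrightarrow> Q (gB b \<otimes>\<^bsub>L\<^esub> gA a \<ominus>\<^bsub>L\<^esub> inA (lft b a))"
    and "\<And>b b'. b \<in> bB \<Longrightarrow> b' \<in> bB \<Longrightarrow>
      Q (gB b \<otimes>\<^bsub>L\<^esub> gB b' \<ominus>\<^bsub>L\<^esub> inB (b \<otimes>\<^bsub>\<BB>\<^esub> b') \<ominus>\<^bsub>L\<^esub> inA (\<beta> b b'))"
  shows "Q r"
  using assms(1) unfolding relators
  by (elim UnE CollectE exE conjE) (simp_all only: assms(2-5) Un_iff simp_thms)

lemma in_closed:
  "a \<in> bA \<Longrightarrow> b \<in> bB \<Longrightarrow> inA (rgt a b) \<in> carrier L"
  "a \<in> bA \<Longrightarrow> b \<in> bB \<Longrightarrow> inA (lft b a) \<in> carrier L"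
  "b \<in> bB \<Longrightarrow> b' \<in> bB \<Longrightarrow> inA (\<beta> b b') \<in> carrier L"
  "b \<in> bB \<Longrightarrow> b' \<in> bB \<Longrightarrow> inB (b \<otimes>\<^bsub>\<BB>\<^esub> b') \<in> carrier L"
  by (intro linear_mapD(1)[OF inA_linear] linear_mapD(1)[OF inB_linear] rgt_closed lft_closed
      \<beta>_closed B.mult_closed bA_carrier bB_carrier; assumption)+

lemma relators_closed: "S \<subseteq> carrier L"
proof
  interpret L: graded_algebra K L by (rule L_graded)
  fix r assume "r \<in> S"
  then show "r \<in> carrier L"
    by (induction rule: relators_cases)
      (intro L.M.minus_closed L.mult_closed gA_closed gB_closed in_closed; assumption)+
qed

lemma P_eq: "P = Lb_pres K X S"
  unfolding ext_alg_def ..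

lemma P_graded: "graded_algebra K P"
  and \<pi>_hom: "superalgebra_hom K L P \<pi>"
  and \<pi>_relator: "r \<in> S \<Longrightarrow> \<pi> r = \<zero>\<^bsub>P\<^esub>"
  using Lb_pres_graded[OF A.field_axioms relators_closed] unfolding P_eq .

lemma P_module: "module K P"
  using graded_algebra.module_V[OF P_graded] .

lemma \<pi>_linear: "linear_map K L P \<pi>"
  by (rule superalgebra_homD(1)[OF \<pi>_hom])

lemma pres_gen: "Lb_pres_gen K X S x = \<pi> (Lb_gen K X x)"
  unfolding Lb_pres_gen_def ..

lemma pres_gen_closed:
  "a \<in> bA \<Longrightarrow> Lb_pres_gen K X S (Inl a) \<in> carrier P"
  "b \<in> bB \<Longrightarrow> Lb_pres_gen K X S (Inr b) \<in> carrier P"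
  unfolding pres_gen
  by (rule linear_mapD(1)[OF \<pi>_linear gA_closed], assumption)
    (rule linear_mapD(1)[OF \<pi>_linear gB_closed], assumption)

lemma iA_linear: "linear_map K \<AA> P iA"
  by (rule linear_map_read_in[OF A.module_V P_module full_basis_A]) (rule Pi_I, rule pres_gen_closed)

lemma iB_linear: "linear_map K \<BB> P iB"
  by (rule linear_map_read_in[OF B.module_V P_module full_basis_B]) (rule Pi_I, rule pres_gen_closed)

lemma iA_basis: "a \<in> bA \<Longrightarrow> iA a = \<pi> (gA a)"
  unfolding pres_gen[symmetric]
  by (rule read_in_basis[OF A.module_V P_module full_basis_A _ pres_gen_closed(1)])

lemma iB_basis: "b \<in> bB \<Longrightarrow> iB b = \<pi> (gB b)"
  unfolding pres_gen[symmetric]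
  by (rule read_in_basis[OF B.module_V P_module full_basis_B _ pres_gen_closed(2)])

text \<open>The relators are written in \<open>Lb\<close>, while \<open>\<phi>\<close> is read in
  the presentation. The two readings agree after \<open>\<pi>\<close> because both are linear and
  agree on basis elements.\<close>

lemma \<pi>_inA: "x \<in> carrier \<AA> \<Longrightarrow> \<pi> (inA x) = iA x"
  by (rule linear_map_eq_on_basis[OF A.module_V P_module full_basis_A
      linear_map_comp[OF inA_linear \<pi>_linear] iA_linear])
    (simp only: inA_basis iA_basis)

lemma \<pi>_inB: "x \<in> carrier \<BB> \<Longrightarrow> \<pi> (inB x) = iB x"
  by (rule linear_map_eq_on_basis[OF B.module_V P_module full_basis_B
      linear_map_comp[OF inB_linear \<pi>_linear] iB_linear])
    (simp only: inB_basis iB_basis)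

text \<open>Each relator is killed by \<open>\<pi>\<close>, and a difference that vanishes is an
  equation. The four clauses are the multiplication table imposed by the four families of
  relators.\<close>

lemma i_mult_basis:
  "a \<in> bA \<Longrightarrow> a' \<in> bA \<Longrightarrow> iA a \<otimes>\<^bsub>P\<^esub> iA a' = \<zero>\<^bsub>P\<^esub>"
  "a \<in> bA \<Longrightarrow> b \<in> bB \<Longrightarrow> iA a \<otimes>\<^bsub>P\<^esub> iB b = iA (rgt a b)"
  "a \<in> bA \<Longrightarrow> b \<in> bB \<Longrightarrow> iB b \<otimes>\<^bsub>P\<^esub> iA a = iA (lft b a)"
  "b \<in> bB \<Longrightarrow> b' \<in> bB \<Longrightarrow> iB b \<otimes>\<^bsub>P\<^esub> iB b' = iA (\<beta> b b') \<oplus>\<^bsub>P\<^esub> iB (b \<otimes>\<^bsub>\<BB>\<^esub> b')"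
proof -
  interpret L: graded_algebra K L by (rule L_graded)
  interpret P: graded_algebra K P by (rule P_graded)
  note \<pi>m = superalgebra_homD(2)[OF \<pi>_hom]
  note \<pi>d = linear_map_minus[OF L_module P_module \<pi>_linear]
  note iAc = linear_mapD(1)[OF iA_linear] and iBc = linear_mapD(1)[OF iB_linear]
  show "iA a \<otimes>\<^bsub>P\<^esub> iA a' = \<zero>\<^bsub>P\<^esub>" if a: "a \<in> bA" "a' \<in> bA" for a a'
  proof -
    have "gA a \<otimes>\<^bsub>L\<^esub> gA a' \<in> S" unfolding relators using a by blast
    from \<pi>_relator[OF this] show ?thesis
      unfolding \<pi>m[OF gA_closed[OF a(1)] gA_closed[OF a(2)]] iA_basis[OF a(1)] iA_basis[OF a(2)] .
  qed
  show "iA a \<otimes>\<^bsub>P\<^esub> iB b = iA (rgt a b)" if a: "a \<in> bA" and b: "b \<in> bB" for a b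
  proof -
    have c: "rgt a b \<in> carrier \<AA>" by (rule rgt_closed[OF bA_carrier[OF a] bB_carrier[OF b]])
    have "gA a \<otimes>\<^bsub>L\<^esub> gB b \<ominus>\<^bsub>L\<^esub> inA (rgt a b) \<in> S" unfolding relators using a b by blast
    from \<pi>_relator[OF this] have "iA a \<otimes>\<^bsub>P\<^esub> iB b \<ominus>\<^bsub>P\<^esub> iA (rgt a b) = \<zero>\<^bsub>P\<^esub>"
      unfolding \<pi>d[OF L.mult_closed[OF gA_closed[OF a] gB_closed[OF b]] in_closed(1)[OF a b]]
        \<pi>m[OF gA_closed[OF a] gB_closed[OF b]] iA_basis[OF a] iB_basis[OF b] \<pi>_inA[OF c] .
    then show ?thesis
      using P.M.minus_eq_zero_iff[OF P.mult_closed[OF iAc iBc] iAc] bA_carrier[OF a] bB_carrier[OF b] c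
      by blast
  qed
  show "iB b \<otimes>\<^bsub>P\<^esub> iA a = iA (lft b a)" if a: "a \<in> bA" and b: "b \<in> bB" for a b
  proof -
    have c: "lft b a \<in> carrier \<AA>" by (rule lft_closed[OF bB_carrier[OF b] bA_carrier[OF a]])
    have "gB b \<otimes>\<^bsub>L\<^esub> gA a \<ominus>\<^bsub>L\<^esub> inA (lft b a) \<in> S" unfolding relators using a b by blast
    from \<pi>_relator[OF this] have "iB b \<otimes>\<^bsub>P\<^esub> iA a \<ominus>\<^bsub>P\<^esub> iA (lft b a) = \<zero>\<^bsub>P\<^esub>"
      unfolding \<pi>d[OF L.mult_closed[OF gB_closed[OF b] gA_closed[OF a]] in_closed(2)[OF a b]]
        \<pi>m[OF gB_closed[OF b] gA_closed[OF a]] iA_basis[OF a] iB_basis[OF b] \<pi>_inA[OF c] .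
    then show ?thesis
      using P.M.minus_eq_zero_iff[OF P.mult_closed[OF iBc iAc] iAc] bA_carrier[OF a] bB_carrier[OF b] c
      by blast
  qed
  show "iB b \<otimes>\<^bsub>P\<^esub> iB b' = iA (\<beta> b b') \<oplus>\<^bsub>P\<^esub> iB (b \<otimes>\<^bsub>\<BB>\<^esub> b')" if b: "b \<in> bB" "b' \<in> bB" for b b'
  proof -
    note bc = bB_carrier[OF b(1)] bB_carrier[OF b(2)]
    have c: "\<beta> b b' \<in> carrier \<AA>" "b \<otimes>\<^bsub>\<BB>\<^esub> b' \<in> carrier \<BB>"
      by (rule \<beta>_closed[OF bc], rule B.mult_closed[OF bc])
    note m = L.mult_closed[OF gB_closed[OF b(1)] gB_closed[OF b(2)]]
    have "gB b \<otimes>\<^bsub>L\<^esub> gB b' \<ominus>\<^bsub>L\<^esub> inB (b \<otimes>\<^bsub>\<BB>\<^esub> b') \<ominus>\<^bsub>L\<^esub> inA (\<beta> b b') \<in> S"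
      unfolding relators using b by blast
    from \<pi>_relator[OF this]
    have "iB b \<otimes>\<^bsub>P\<^esub> iB b' \<ominus>\<^bsub>P\<^esub> iB (b \<otimes>\<^bsub>\<BB>\<^esub> b') \<ominus>\<^bsub>P\<^esub> iA (\<beta> b b') = \<zero>\<^bsub>P\<^esub>"
      unfolding \<pi>d[OF L.M.minus_closed[OF m in_closed(4)[OF b]] in_closed(3)[OF b]]
        \<pi>d[OF m in_closed(4)[OF b]]
        \<pi>m[OF gB_closed[OF b(1)] gB_closed[OF b(2)]] iB_basis[OF b(1)] iB_basis[OF b(2)]
        \<pi>_inA[OF c(1)] \<pi>_inB[OF c(2)] .
    \<comment> \<open>The relator subtracts the two terms in succession; they are collected into one
      sum so that a single vanishing difference remains.\<close>
    then have "iB b \<otimes>\<^bsub>P\<^esub> iB b' \<ominus>\<^bsub>P\<^esub> (iA (\<beta> b b') \<oplus>\<^bsub>P\<^esub> iB (b \<otimes>\<^bsub>\<BB>\<^esub> b')) = \<zero>\<^bsub>P\<^esub>"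
      using P.mult_closed[OF iBc[OF bc(1)] iBc[OF bc(2)]] iAc[OF c(1)] iBc[OF c(2)]
      by (simp add: a_minus_def P.M.minus_add P.M.a_ac)
    then show ?thesis
      using P.M.minus_eq_zero_iff[OF P.mult_closed[OF iBc[OF bc(1)] iBc[OF bc(2)]]
          P.M.a_closed[OF iAc[OF c(1)] iBc[OF c(2)]]] by blast
  qed
qed

lemma i_mult:
  "a \<in> carrier \<AA> \<Longrightarrow> a' \<in> carrier \<AA> \<Longrightarrow> iA a \<otimes>\<^bsub>P\<^esub> iA a' = \<zero>\<^bsub>P\<^esub>"
  "a \<in> carrier \<AA> \<Longrightarrow> b \<in> carrier \<BB> \<Longrightarrow> iA a \<otimes>\<^bsub>P\<^esub> iB b = iA (rgt a b)"
  "b \<in> carrier \<BB> \<Longrightarrow> a \<in> carrier \<AA> \<Longrightarrow> iB b \<otimes>\<^bsub>P\<^esub> iA a = iA (lft b a)"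
  "b \<in> carrier \<BB> \<Longrightarrow> b' \<in> carrier \<BB> \<Longrightarrow>
    iB b \<otimes>\<^bsub>P\<^esub> iB b' = iA (\<beta> b b') \<oplus>\<^bsub>P\<^esub> iB (b \<otimes>\<^bsub>\<BB>\<^esub> b')"
proof -
  interpret P: graded_algebra K P by (rule P_graded)
  note eq = bilinear_map_eq_on_basis[OF _ _ P_module]
  note mA = A.module_V and mB = B.module_V
  show "iA a \<otimes>\<^bsub>P\<^esub> iA a' = \<zero>\<^bsub>P\<^esub>" if "a \<in> carrier \<AA>" "a' \<in> carrier \<AA>" for a a'
    by (rule eq[OF mA mA full_basis_A full_basis_A
          bilinear_map_comp[OF P.bilinear iA_linear iA_linear] bilinear_map_const_zero[OF P_module]
          i_mult_basis(1) that])
  show "iA a \<otimes>\<^bsub>P\<^esub> iB b = iA (rgt a b)" if "a \<in> carrier \<AA>" "b \<in> carrier \<BB>" for a b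
    by (rule eq[OF mA mB full_basis_A full_basis_B
          bilinear_map_comp[OF P.bilinear iA_linear iB_linear]
          bilinear_map_comp_left[OF rgt_bilinear iA_linear] i_mult_basis(2) that])
  show "iB b \<otimes>\<^bsub>P\<^esub> iA a = iA (lft b a)" if "b \<in> carrier \<BB>" "a \<in> carrier \<AA>" for a b
    by (rule eq[OF mB mA full_basis_B full_basis_A
          bilinear_map_comp[OF P.bilinear iB_linear iA_linear]
          bilinear_map_comp_left[OF lft_bilinear iA_linear] i_mult_basis(3) that])
  show "iB b \<otimes>\<^bsub>P\<^esub> iB b' = iA (\<beta> b b') \<oplus>\<^bsub>P\<^esub> iB (b \<otimes>\<^bsub>\<BB>\<^esub> b')"
    if "b \<in> carrier \<BB>" "b' \<in> carrier \<BB>" for b b'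
    by (rule eq[OF mB mB full_basis_B full_basis_B
          bilinear_map_comp[OF P.bilinear iB_linear iB_linear]
          bilinear_map_add[OF mB mB P_module bilinear_map_comp_left[OF \<beta>_bilinear iA_linear]
            bilinear_map_comp_left[OF B.bilinear iB_linear]] i_mult_basis(4) that])
qed

lemma \<phi>_eq: "\<phi> (x, y) = iA x \<oplus>\<^bsub>P\<^esub> iB y"
  unfolding ext_map_def Let_def by simp

lemma \<phi>_linear: "linear_map K D P \<phi>"
proof -
  have "linear_map K D P (\<lambda>p. iA (fst p) \<oplus>\<^bsub>P\<^esub> iB (snd p))"
    by (rule linear_map_add[OF D_module P_module linear_map_comp[OF fst_linear iA_linear]
          linear_map_comp[OF snd_linear iB_linear]])
  moreover have "(\<lambda>p. iA (fst p) \<oplus>\<^bsub>P\<^esub> iB (snd p)) = \<phi>"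
    by (auto simp: \<phi>_eq fun_eq_iff)
  ultimately show ?thesis by simp
qed

lemma \<phi>_mult:
  assumes "x \<in> carrier D" "y \<in> carrier D"
  shows "\<phi> x \<otimes>\<^bsub>P\<^esub> \<phi> y = \<phi> (x \<otimes>\<^bsub>D\<^esub> y)"
proof -
  interpret P: graded_algebra K P by (rule P_graded)
  obtain a b a' b' where x: "x = (a, b)" "a \<in> carrier \<AA>" "b \<in> carrier \<BB>"
    and y: "y = (a', b')" "a' \<in> carrier \<AA>" "b' \<in> carrier \<BB>"
    using assms by (auto simp: ext_model_simps)
  note iAc = linear_mapD(1)[OF iA_linear] and iBc = linear_mapD(1)[OF iB_linear]
  note cl = iAc iBc rgt_closed lft_closed \<beta>_closed B.mult_closed P.mult_closed
  have "\<phi> x \<otimes>\<^bsub>P\<^esub> \<phi> y = (iA a \<otimes>\<^bsub>P\<^esub> iA a' \<oplus>\<^bsub>P\<^esub> iA a \<otimes>\<^bsub>P\<^esub> iB b') \<oplus>\<^bsub>P\<^esub>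
      (iB b \<otimes>\<^bsub>P\<^esub> iA a' \<oplus>\<^bsub>P\<^esub> iB b \<otimes>\<^bsub>P\<^esub> iB b')"
    using x y by (simp add: \<phi>_eq P.mult_add_left P.mult_add_right cl P.M.a_ac)
  \<comment> \<open>The product of the two \<open>iA\<close> terms vanishes, and the product of the
    two \<open>iB\<close> terms supplies both the \<open>\<beta>\<close> summand and the component
    in \<open>\<BB>\<close>.\<close>
  also have "\<dots> = (iA (rgt a b') \<oplus>\<^bsub>P\<^esub> iA (lft b a') \<oplus>\<^bsub>P\<^esub> iA (\<beta> b b')) \<oplus>\<^bsub>P\<^esub> iB (b \<otimes>\<^bsub>\<BB>\<^esub> b')"
    using x y by (simp add: i_mult cl P.M.a_ac)
  also have "\<dots> = \<phi> (x \<otimes>\<^bsub>D\<^esub> y)"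
    using x y by (simp add: ext_model_simps \<phi>_eq linear_mapD(2)[OF iA_linear] cl)
  finally show ?thesis .
qed

lemma \<phi>_surj: "carrier P \<subseteq> \<phi> ` carrier D"
proof -
  interpret D: leibniz_superalgebra K D by (rule D_leibniz)
  interpret P: graded_algebra K P by (rule P_graded)
  show ?thesis
  proof (rule Lb_pres_generated[OF A.field_axioms relators_closed, folded P_eq])
    fix x assume "x \<in> X 0 \<union> X 1"
    then consider a where "x = Inl a" "a \<in> bA" | b where "x = Inr b" "b \<in> bB"
      unfolding gens_Un by blast
    then show "Lb_pres_gen K X S x \<in> \<phi> ` carrier D"
    proof cases
      case (1 a)
      have "\<phi> (a, \<zero>\<^bsub>\<BB>\<^esub>) = \<pi> (gA a)"
        unfolding \<phi>_eq linear_map_zero[OF B.module_V P_module iB_linear] iA_basis[OF 1(2)]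
        by (rule P.M.r_zero[OF linear_mapD(1)[OF \<pi>_linear gA_closed[OF 1(2)]]])
      moreover have "(a, \<zero>\<^bsub>\<BB>\<^esub>) \<in> carrier D"
        using bA_carrier[OF 1(2)] by (simp add: ext_model_simps)
      ultimately show ?thesis unfolding pres_gen 1(1) by (metis imageI)
    next
      case (2 b)
      have "\<phi> (\<zero>\<^bsub>\<AA>\<^esub>, b) = \<pi> (gB b)"
        unfolding \<phi>_eq linear_map_zero[OF A.module_V P_module iA_linear] iB_basis[OF 2(2)]
        by (rule P.M.l_zero[OF linear_mapD(1)[OF \<pi>_linear gB_closed[OF 2(2)]]])
      moreover have "(\<zero>\<^bsub>\<AA>\<^esub>, b) \<in> carrier D"
        using bB_carrier[OF 2(2)] by (simp add: ext_model_simps)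
      ultimately show ?thesis unfolding pres_gen 2(1) by (metis imageI)
    qed
  next
    show "\<zero>\<^bsub>P\<^esub> \<in> \<phi> ` carrier D"
      using linear_map_zero[OF D_module P_module \<phi>_linear] D.M.zero_closed by (metis imageI)
  next
    fix x y assume "x \<in> \<phi> ` carrier D" "y \<in> \<phi> ` carrier D"
    then obtain u v where uv: "x = \<phi> u" "y = \<phi> v" "u \<in> carrier D" "v \<in> carrier D" by blast
    show "x \<oplus>\<^bsub>P\<^esub> y \<in> \<phi> ` carrier D"
      unfolding uv(1,2) linear_mapD(2)[OF \<phi>_linear uv(3,4), symmetric]
      by (rule imageI[OF D.M.a_closed[OF uv(3,4)]])
    show "x \<otimes>\<^bsub>P\<^esub> y \<in> \<phi> ` carrier D"
      unfolding uv(1,2) \<phi>_mult[OF uv(3,4)]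
      by (rule imageI[OF D.mult_closed[OF uv(3,4)]])
  next
    fix c x assume c: "c \<in> carrier K" and "x \<in> \<phi> ` carrier D"
    then obtain u where u: "x = \<phi> u" "u \<in> carrier D" by blast
    show "c \<odot>\<^bsub>P\<^esub> x \<in> \<phi> ` carrier D"
      unfolding u(1) linear_mapD(3)[OF \<phi>_linear c u(2), symmetric]
      by (rule imageI[OF D.smult_closed[OF c u(2)]])
  qed
qed

text \<open>This left inverse of \<open>\<phi>\<close> supplies injectivity, which the relations
  cannot give. The generators go to the two coordinate copies inside the model, and each family of
  relators vanishes there because the product of the model was designed to obey it.\<close>

lemma presentation_model:
  obtains \<psi> where "superalgebra_hom K P D \<psi>" "\<And>x. x \<in> carrier D \<Longrightarrow> \<psi> (\<phi> x) = x"
proof -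
  interpret D: leibniz_superalgebra K D by (rule D_leibniz)
  interpret L: graded_algebra K L by (rule L_graded)
  note s = ext_model_simps
  \<comment> \<open>The pairs with one zero entry have the parity of the remaining entry, since zero
    belongs to both parts; this is what \<open>Lb_lift\<close> asks of the images of
    generators.\<close>
  define g where "g = case_sum (\<lambda>a. (a, \<zero>\<^bsub>\<BB>\<^esub>)) (\<lambda>b. (\<zero>\<^bsub>\<AA>\<^esub>, b))"
  have "g x \<in> part D i" if "x \<in> X i" for i x
    using that unfolding gens_def g_def
    by (auto simp: s A.part_zero B.part_zero bA_part bB_part)
  then obtain h where h: "superalgebra_hom K L D h"
    "\<And>x. x \<in> X 0 \<union> X 1 \<Longrightarrow> h (Lb_gen K X x) = g x"
    using Lb_lift[OF D_leibniz] by blast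
  note hl = superalgebra_homD(1)[OF h(1)]
  note hm = superalgebra_homD(2)[OF h(1)] and hd = linear_map_minus[OF L_module D_module hl]
  have hA: "h (gA a) = (a, \<zero>\<^bsub>\<BB>\<^esub>)" if "a \<in> bA" for a
    using h(2)[of "Inl a"] that unfolding gens_Un g_def by auto
  have hB: "h (gB b) = (\<zero>\<^bsub>\<AA>\<^esub>, b)" if "b \<in> bB" for b
    using h(2)[of "Inr b"] that unfolding gens_Un g_def by auto
  have hinA: "h (inA x) = (x, \<zero>\<^bsub>\<BB>\<^esub>)" if "x \<in> carrier \<AA>" for x
    by (rule linear_map_eq_on_basis[OF A.module_V D_module full_basis_A
          linear_map_comp[OF inA_linear hl] inl_linear _ that])
      (simp only: inA_basis hA)
  have hinB: "h (inB x) = (\<zero>\<^bsub>\<AA>\<^esub>, x)" if "x \<in> carrier \<BB>" for x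
    by (rule linear_map_eq_on_basis[OF B.module_V D_module full_basis_B
          linear_map_comp[OF inB_linear hl] inr_linear _ that])
      (simp only: inB_basis hB)
  \<comment> \<open>All operations are linear in each slot and so vanish at zero. The general
    product of the model then collapses to the one or two terms needed for each family of
    relators.\<close>
  have z: "a \<in> carrier \<AA> \<Longrightarrow> rgt a \<zero>\<^bsub>\<BB>\<^esub> = \<zero>\<^bsub>\<AA>\<^esub>" "a \<in> carrier \<AA> \<Longrightarrow> lft \<zero>\<^bsub>\<BB>\<^esub> a = \<zero>\<^bsub>\<AA>\<^esub>"
    "b \<in> carrier \<BB> \<Longrightarrow> rgt \<zero>\<^bsub>\<AA>\<^esub> b = \<zero>\<^bsub>\<AA>\<^esub>" "b \<in> carrier \<BB> \<Longrightarrow> lft b \<zero>\<^bsub>\<AA>\<^esub> = \<zero>\<^bsub>\<AA>\<^esub>"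
    "b \<in> carrier \<BB> \<Longrightarrow> \<beta> \<zero>\<^bsub>\<BB>\<^esub> b = \<zero>\<^bsub>\<AA>\<^esub>" "b \<in> carrier \<BB> \<Longrightarrow> \<beta> b \<zero>\<^bsub>\<BB>\<^esub> = \<zero>\<^bsub>\<AA>\<^esub>" for a b
    using linear_map_zero[OF B.module_V A.module_V rgt_lin2]
      linear_map_zero[OF B.module_V A.module_V lft_lin1] linear_map_zero[OF A.module_V A.module_V rgt_lin1]
      linear_map_zero[OF A.module_V A.module_V lft_lin2] linear_map_zero[OF B.module_V A.module_V \<beta>_lin1]
      linear_map_zero[OF B.module_V A.module_V \<beta>_lin2] by blast+
  have D_diff_self: "u \<ominus>\<^bsub>D\<^esub> u = \<zero>\<^bsub>D\<^esub>" if "u \<in> carrier D" for u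
    using that by (simp only: D.M.minus_eq_zero_iff)
  have "h r = \<zero>\<^bsub>D\<^esub>" if "r \<in> S" for r
    using that
  proof (induction rule: relators_cases)
    case (AA a a')
    note c = bA_carrier[OF AA(1)] bA_carrier[OF AA(2)]
    show ?case
      unfolding hm[OF gA_closed[OF AA(1)] gA_closed[OF AA(2)]] hA[OF AA(1)] hA[OF AA(2)]
      using c by (simp add: s z B.mult_zero_left)
  next
    case (AB a b)
    note c = bA_carrier[OF AB(1)] bB_carrier[OF AB(2)]
    have eq: "(a, \<zero>\<^bsub>\<BB>\<^esub>) \<otimes>\<^bsub>D\<^esub> (\<zero>\<^bsub>\<AA>\<^esub>, b) = (rgt a b, \<zero>\<^bsub>\<BB>\<^esub>)"
      using c by (simp add: s z rgt_closed B.mult_zero_left)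
    show ?case
      unfolding hd[OF L.mult_closed[OF gA_closed[OF AB(1)] gB_closed[OF AB(2)]] in_closed(1)[OF AB]]
        hm[OF gA_closed[OF AB(1)] gB_closed[OF AB(2)]] hA[OF AB(1)] hB[OF AB(2)]
        hinA[OF rgt_closed[OF c]] eq
      using rgt_closed[OF c] by (intro D_diff_self) (simp add: s)
  next
    case (BA a b)
    note c = bB_carrier[OF BA(2)] bA_carrier[OF BA(1)]
    have eq: "(\<zero>\<^bsub>\<AA>\<^esub>, b) \<otimes>\<^bsub>D\<^esub> (a, \<zero>\<^bsub>\<BB>\<^esub>) = (lft b a, \<zero>\<^bsub>\<BB>\<^esub>)"
      using c by (simp add: s z lft_closed B.mult_zero_right)
    show ?case
      unfolding hd[OF L.mult_closed[OF gB_closed[OF BA(2)] gA_closed[OF BA(1)]] in_closed(2)[OF BA]]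
        hm[OF gB_closed[OF BA(2)] gA_closed[OF BA(1)]] hA[OF BA(1)] hB[OF BA(2)]
        hinA[OF lft_closed[OF c]] eq
      using lft_closed[OF c] by (intro D_diff_self) (simp add: s)
  next
    case (BB b b')
    note c = bB_carrier[OF BB(1)] bB_carrier[OF BB(2)]
    note m = L.mult_closed[OF gB_closed[OF BB(1)] gB_closed[OF BB(2)]]
    have eq: "(\<zero>\<^bsub>\<AA>\<^esub>, b) \<otimes>\<^bsub>D\<^esub> (\<zero>\<^bsub>\<AA>\<^esub>, b') = (\<beta> b b', \<zero>\<^bsub>\<BB>\<^esub>) \<oplus>\<^bsub>D\<^esub> (\<zero>\<^bsub>\<AA>\<^esub>, b \<otimes>\<^bsub>\<BB>\<^esub> b')"
      using c by (simp add: s z \<beta>_closed B.mult_closed)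
    have Dc: "(\<beta> b b', \<zero>\<^bsub>\<BB>\<^esub>) \<in> carrier D" "(\<zero>\<^bsub>\<AA>\<^esub>, b \<otimes>\<^bsub>\<BB>\<^esub> b') \<in> carrier D"
      using c by (simp_all add: s \<beta>_closed B.mult_closed)
    show ?case
      unfolding hd[OF L.M.minus_closed[OF m in_closed(4)[OF BB]] in_closed(3)[OF BB]]
        hd[OF m in_closed(4)[OF BB]]
        hm[OF gB_closed[OF BB(1)] gB_closed[OF BB(2)]] hB[OF BB(1)] hB[OF BB(2)]
        hinA[OF \<beta>_closed[OF c]] hinB[OF B.mult_closed[OF c]] eq
      using Dc by (simp add: a_minus_def D.M.a_assoc D.M.r_neg del: ext_model_simps)
  qed
  then obtain k where k: "superalgebra_hom K P D k" "\<And>x. x \<in> carrier L \<Longrightarrow> k (\<pi> x) = h x"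
    using Lb_pres_lift[OF relators_closed D.graded_algebra_axioms h(1), folded P_eq] by blast
  note kl = superalgebra_homD(1)[OF k(1)]
  have kA: "k (iA a) = (a, \<zero>\<^bsub>\<BB>\<^esub>)" if "a \<in> carrier \<AA>" for a
    using k(2)[OF linear_mapD(1)[OF inA_linear that]] unfolding \<pi>_inA[OF that] hinA[OF that] .
  have kB: "k (iB b) = (\<zero>\<^bsub>\<AA>\<^esub>, b)" if "b \<in> carrier \<BB>" for b
    using k(2)[OF linear_mapD(1)[OF inB_linear that]] unfolding \<pi>_inB[OF that] hinB[OF that] .
  have "k (\<phi> x) = x" if xD: "x \<in> carrier D" for x
  proof -
    obtain a b where x: "x = (a, b)" "a \<in> carrier \<AA>" "b \<in> carrier \<BB>" using xD by (auto simp: s)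
    show ?thesis
      unfolding x(1) \<phi>_eq linear_mapD(2)[OF kl linear_mapD(1)[OF iA_linear x(2)]
          linear_mapD(1)[OF iB_linear x(3)]] kA[OF x(2)] kB[OF x(3)]
      using x by (simp add: s)
  qed
  with k(1) that show thesis by blast
qed

lemma \<phi>_bij: "bij_betw \<phi> (carrier D) (carrier P)"
proof -
  obtain \<psi> where \<psi>: "superalgebra_hom K P D \<psi>" "\<And>x. x \<in> carrier D \<Longrightarrow> \<psi> (\<phi> x) = x"
    using presentation_model by blast
  have "inj_on \<phi> (carrier D)" by (rule inj_on_inverseI) (rule \<psi>(2))
  moreover have "\<phi> ` carrier D = carrier P"
    using \<phi>_surj linear_mapD(1)[OF \<phi>_linear] by blast
  ultimately show ?thesis unfolding bij_betw_def by blast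
qed

text \<open>Surjectivity of \<open>\<phi>\<close> turns the left inverse into a two-sided one. The
  isomorphism is recorded from the presentation to the model because this direction preserves parity
  by construction.\<close>

lemma model_iso:
  obtains \<psi> where "superalgebra_hom K P D \<psi>" "bij_betw \<psi> (carrier P) (carrier D)"
proof -
  obtain \<psi> where \<psi>: "superalgebra_hom K P D \<psi>" "\<And>x. x \<in> carrier D \<Longrightarrow> \<psi> (\<phi> x) = x"
    using presentation_model by blast
  have "\<phi> (\<psi> y) = y" if "y \<in> carrier P" for y
    using \<phi>_surj that \<psi>(2) by force
  then have "bij_betw \<psi> (carrier P) (carrier D)"
    using \<psi>(2) linear_mapD(1)[OF \<phi>_linear] linear_mapD(1)[OF superalgebra_homD(1)[OF \<psi>(1)]]
    by (intro bij_betw_byWitness[where f' = \<phi>]) auto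
  with \<psi>(1) that show thesis by blast
qed

end

section \<open>Extensions and isomorphism with the presented superalgebra\<close>

context extension_datum
begin

text \<open>All three terms in the first component of the product contain a zero argument, so
  multiplicativity says exactly that the product of \<open>\<AA>\<close> vanishes.\<close>

lemma inl_hom: "superalgebra_hom K \<AA> D (\<lambda>a. (a, \<zero>\<^bsub>\<BB>\<^esub>))"
proof (rule superalgebra_homI[OF inl_linear])
  fix a a' assume a: "a \<in> carrier \<AA>" "a' \<in> carrier \<AA>"
  have "rgt a \<zero>\<^bsub>\<BB>\<^esub> = \<zero>\<^bsub>\<AA>\<^esub>" "lft \<zero>\<^bsub>\<BB>\<^esub> a' = \<zero>\<^bsub>\<AA>\<^esub>" "\<beta> \<zero>\<^bsub>\<BB>\<^esub> \<zero>\<^bsub>\<BB>\<^esub> = \<zero>\<^bsub>\<AA>\<^esub>"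
    using linear_map_zero[OF B.module_V A.module_V rgt_lin2[OF a(1)]]
      linear_map_zero[OF B.module_V A.module_V lft_lin1[OF a(2)]]
      linear_map_zero[OF B.module_V A.module_V \<beta>_lin1[OF B.M.zero_closed]] .
  then show "(a \<otimes>\<^bsub>\<AA>\<^esub> a', \<zero>\<^bsub>\<BB>\<^esub>) = (a, \<zero>\<^bsub>\<BB>\<^esub>) \<otimes>\<^bsub>D\<^esub> (a', \<zero>\<^bsub>\<BB>\<^esub>)"
    using a by (simp add: ext_model_simps trivial_mult B.mult_zero_left)
qed (simp add: ext_model_simps B.part_zero)

lemma snd_hom: "superalgebra_hom K D \<BB> snd"
  by (rule superalgebra_homI[OF snd_linear]) (auto simp: ext_model_simps)

text \<open>In the model, inclusion of the first summand followed by the second projection is short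
  exact. The sequence is transported to \<open>\<EE>\<close> by composing the projection with
  \<open>h\<close> and the inclusion with the inverse of \<open>h\<close>.\<close>

lemma extension_of_model_iso:
  assumes "leibniz_superalgebra K \<EE>" "superalgebra_hom K \<EE> D h"
    and "bij_betw h (carrier \<EE>) (carrier D)"
  shows "is_extension K \<EE> \<BB> \<AA>"
proof -
  interpret E: leibniz_superalgebra K \<EE> by fact
  note s = ext_model_simps
  define k where "k = inv_into (carrier \<EE>) h"
  have k: "superalgebra_hom K D \<EE> k"
    unfolding k_def
    by (rule superalgebra_hom_inverse[OF E.graded_algebra_axioms D_superalgebra assms(2,3)])
  have kc: "k d \<in> carrier \<EE>" "h (k d) = d" if "d \<in> carrier D" for d
    using assms(3) that unfolding k_def bij_betw_def
    by (auto intro: inv_into_into f_inv_into_f)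
  have hc: "h e \<in> carrier D" "k (h e) = e" if "e \<in> carrier \<EE>" for e
    using assms(3) that unfolding k_def by (auto simp: bij_betw_def)
  have a0: "(a, \<zero>\<^bsub>\<BB>\<^esub>) \<in> carrier D" if "a \<in> carrier \<AA>" for a using that by (simp add: s)
  have b0: "(\<zero>\<^bsub>\<AA>\<^esub>, b) \<in> carrier D" if "b \<in> carrier \<BB>" for b using that by (simp add: s)
  show ?thesis
    unfolding is_extension_def
  proof (intro conjI exI)
    show "superalgebra_hom K \<AA> \<EE> (\<lambda>a. k (a, \<zero>\<^bsub>\<BB>\<^esub>))"
      by (rule superalgebra_hom_comp[OF inl_hom k])
    show "superalgebra_hom K \<EE> \<BB> (\<lambda>e. snd (h e))"
      by (rule superalgebra_hom_comp[OF assms(2) snd_hom])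
    show "inj_on (\<lambda>a. k (a, \<zero>\<^bsub>\<BB>\<^esub>)) (carrier \<AA>)"
      by (rule inj_on_inverseI[where g = "\<lambda>e. fst (h e)"]) (simp add: kc(2)[OF a0])
    show "(\<lambda>a. k (a, \<zero>\<^bsub>\<BB>\<^esub>)) ` carrier \<AA> = {x \<in> carrier \<EE>. snd (h x) = \<zero>\<^bsub>\<BB>\<^esub>}"
    proof (intro equalityI subsetI)
      fix x assume "x \<in> (\<lambda>a. k (a, \<zero>\<^bsub>\<BB>\<^esub>)) ` carrier \<AA>"
      then show "x \<in> {x \<in> carrier \<EE>. snd (h x) = \<zero>\<^bsub>\<BB>\<^esub>}" using kc[OF a0] by auto
    next
      fix x assume x: "x \<in> {x \<in> carrier \<EE>. snd (h x) = \<zero>\<^bsub>\<BB>\<^esub>}"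
      then have "h x \<in> carrier D" "k (h x) = x" using hc by auto
      then have "fst (h x) \<in> carrier \<AA>" "x = k (fst (h x), \<zero>\<^bsub>\<BB>\<^esub>)"
        using x by (auto simp: s mem_Times_iff prod_eq_iff) (metis prod.collapse)
      then show "x \<in> (\<lambda>a. k (a, \<zero>\<^bsub>\<BB>\<^esub>)) ` carrier \<AA>" by blast
    qed
    show "(\<lambda>e. snd (h e)) ` carrier \<EE> = carrier \<BB>"
    proof (intro equalityI subsetI)
      fix b assume "b \<in> (\<lambda>e. snd (h e)) ` carrier \<EE>"
      then show "b \<in> carrier \<BB>" using hc(1) by (auto simp: s mem_Times_iff)
    next
      fix b assume "b \<in> carrier \<BB>"
      then show "b \<in> (\<lambda>e. snd (h e)) ` carrier \<EE>"
        using kc[OF b0] by (intro image_eqI[of _ _ "k (\<zero>\<^bsub>\<AA>\<^esub>, b)"]) auto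
    qed
  qed (rule assms(1) B.leibniz_superalgebra_axioms A.leibniz_superalgebra_axioms)+
qed

lemma extension_of_iso:
  assumes "leibniz_superalgebra K \<EE>" "superalgebra_isomorphic K \<EE> P"
  shows "is_extension K \<EE> \<BB> \<AA>"
proof -
  obtain h where h: "superalgebra_hom K \<EE> P h" "bij_betw h (carrier \<EE>) (carrier P)"
    using assms(2) unfolding superalgebra_isomorphic_def by blast
  obtain \<psi> where \<psi>: "superalgebra_hom K P D \<psi>" "bij_betw \<psi> (carrier P) (carrier D)"
    using model_iso by blast
  show ?thesis
    using extension_of_model_iso[OF assms(1) superalgebra_hom_comp[OF h(1) \<psi>(1)]]
      bij_betw_trans[OF h(2) \<psi>(2)] by (simp add: comp_def)
qed

text \<open>The composite is formed from the presentation to \<open>\<EE>\<close> and only then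
  inverted, because directness of the grading is at hand in \<open>\<EE>\<close> and that is the
  side required by \<open>superalgebra_hom_inverse\<close>.\<close>

lemma iso_of_model_iso:
  assumes "superalgebra K \<EE>" "superalgebra_hom K D \<EE> \<theta>" "bij_betw \<theta> (carrier D) (carrier \<EE>)"
  shows "superalgebra_isomorphic K \<EE> P"
proof -
  obtain \<psi> where \<psi>: "superalgebra_hom K P D \<psi>" "bij_betw \<psi> (carrier P) (carrier D)"
    using model_iso by blast
  have hom: "superalgebra_hom K P \<EE> (\<lambda>x. \<theta> (\<psi> x))"
    by (rule superalgebra_hom_comp[OF \<psi>(1) assms(2)])
  have bij: "bij_betw (\<lambda>x. \<theta> (\<psi> x)) (carrier P) (carrier \<EE>)"
    using bij_betw_trans[OF \<psi>(2) assms(3)] by (simp add: comp_def)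
  show ?thesis
    unfolding superalgebra_isomorphic_def
    using superalgebra_hom_inverse[OF P_graded assms(1) hom bij] bij_betw_inv_into[OF bij] by blast
qed

end

section \<open>Data extracted from an extension with a graded linear section\<close>

locale sectioned_extension = extension_bases K \<AA> \<BB> A B + E: leibniz_superalgebra K \<EE>
  for K :: "('k, 'r) ring_scheme"
    and \<AA> :: "('k, 'a) superalgebra" and \<BB> :: "('k, 'b) superalgebra" and A B
    and \<EE> :: "('k, 'e) superalgebra" +
  fixes f :: "'a \<Rightarrow> 'e" and g :: "'e \<Rightarrow> 'b" and s :: "'b \<Rightarrow> 'e"
  assumes f_hom: "superalgebra_hom K \<AA> \<EE> f" and g_hom: "superalgebra_hom K \<EE> \<BB> g"
    and f_inj: "inj_on f (carrier \<AA>)"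
    and exact: "f ` carrier \<AA> = {x \<in> carrier \<EE>. g x = \<zero>\<^bsub>\<BB>\<^esub>}"
    and s_linear: "linear_map K \<BB> \<EE> s"
    and s_graded: "b \<in> part \<BB> i \<Longrightarrow> s b \<in> part \<EE> i"
    and section_s: "b \<in> carrier \<BB> \<Longrightarrow> g (s b) = b"
begin

text \<open>Meaningful only on the image of \<open>f\<close>. Each use below therefore comes with a
  proof that its argument is killed by \<open>g\<close>, which by exactness places it in that
  image.\<close>

definition "fi = inv_into (carrier \<AA>) f"
definition "lft b a = fi (s b \<otimes>\<^bsub>\<EE>\<^esub> f a)"
definition "rgt a b = fi (f a \<otimes>\<^bsub>\<EE>\<^esub> s b)"
definition "\<beta> b b' = fi (s b \<otimes>\<^bsub>\<EE>\<^esub> s b' \<ominus>\<^bsub>\<EE>\<^esub> s (b \<otimes>\<^bsub>\<BB>\<^esub> b'))"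

lemmas f_linear = superalgebra_homD(1)[OF f_hom]
lemmas g_linear = superalgebra_homD(1)[OF g_hom]
lemmas f_closed = linear_mapD(1)[OF f_linear]
lemmas s_closed = linear_mapD(1)[OF s_linear]
lemmas f_add = linear_mapD(2)[OF f_linear]
lemmas f_smult = linear_mapD(3)[OF f_linear]
lemmas s_smult = linear_mapD(3)[OF s_linear]
lemmas f_minus = linear_map_minus[OF A.module_V E.module_V f_linear]
lemmas s_minus = linear_map_minus[OF B.module_V E.module_V s_linear]
lemmas g_mult = superalgebra_homD(2)[OF g_hom]
lemmas g_minus = linear_map_minus[OF E.module_V B.module_V g_linear]
lemmas g_add = linear_mapD(2)[OF g_linear]

lemma g_f: "a \<in> carrier \<AA> \<Longrightarrow> g (f a) = \<zero>\<^bsub>\<BB>\<^esub>"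
  using exact by blast

lemma f_f: "a \<in> carrier \<AA> \<Longrightarrow> a' \<in> carrier \<AA> \<Longrightarrow> f a \<otimes>\<^bsub>\<EE>\<^esub> f a' = \<zero>\<^bsub>\<EE>\<^esub>"
  using superalgebra_homD(2)[OF f_hom, of a a'] linear_map_zero[OF A.module_V E.module_V f_linear]
  by (simp add: trivial_mult)

lemma fi_closed: "x \<in> f ` carrier \<AA> \<Longrightarrow> fi x \<in> carrier \<AA>"
  and f_fi: "x \<in> f ` carrier \<AA> \<Longrightarrow> f (fi x) = x"
  unfolding fi_def by (auto intro: inv_into_into f_inv_into_f)

lemma fi_f: "a \<in> carrier \<AA> \<Longrightarrow> fi (f a) = a"
  unfolding fi_def using f_inj by simp

text \<open>That \<open>f\<close> preserves parity does not by itself say that its inverse does. The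
  preimage is split in \<open>\<AA>\<close>, the pieces are compared in \<open>\<EE>\<close> where
  the splitting is unique, and injectivity of \<open>f\<close> returns the result.\<close>

lemma fi_part:
  assumes "x \<in> f ` carrier \<AA>" "x \<in> part \<EE> i"
  shows "fi x \<in> part \<AA> i"
proof -
  obtain u v where uv: "fi x = u \<oplus>\<^bsub>\<AA>\<^esub> v" "u \<in> part \<AA> 0" "v \<in> part \<AA> 1"
    using A.part_span[OF fi_closed[OF assms(1)]] by blast
  note c = A.part_carrier[OF uv(2)] A.part_carrier[OF uv(3)]
  have "x = f u \<oplus>\<^bsub>\<EE>\<^esub> f v"
    using f_fi[OF assms(1)] unfolding uv(1) f_add[OF c] by simp
  then have "x = (if i = 0 then f u else f v)"
    using E.part_sum_unique[OF superalgebra_homD(3)[OF f_hom uv(2)] superalgebra_homD(3)[OF f_hom uv(3)]]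
      assms(2) by simp
  then have "fi x = (if i = 0 then u else v)" using fi_f c by auto
  with uv show ?thesis by (cases i) auto
qed

text \<open>A factor from the image of \<open>f\<close> is annihilated by \<open>g\<close>, hence so
  is the product: the kernel of \<open>g\<close> is an ideal. For the cocycle below, it is the two
  terms that cancel, as \<open>g\<close> undoes \<open>s\<close>.\<close>

lemma image_lft: "b \<in> carrier \<BB> \<Longrightarrow> a \<in> carrier \<AA> \<Longrightarrow> s b \<otimes>\<^bsub>\<EE>\<^esub> f a \<in> f ` carrier \<AA>"
  unfolding exact
  by (simp add: E.mult_closed s_closed f_closed g_mult section_s g_f B.mult_zero_right)

lemma image_rgt: "a \<in> carrier \<AA> \<Longrightarrow> b \<in> carrier \<BB> \<Longrightarrow> f a \<otimes>\<^bsub>\<EE>\<^esub> s b \<in> f ` carrier \<AA>"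
  unfolding exact
  by (simp add: E.mult_closed s_closed f_closed g_mult section_s g_f B.mult_zero_left)

lemma image_\<beta>:
  "b \<in> carrier \<BB> \<Longrightarrow> b' \<in> carrier \<BB> \<Longrightarrow>
    s b \<otimes>\<^bsub>\<EE>\<^esub> s b' \<ominus>\<^bsub>\<EE>\<^esub> s (b \<otimes>\<^bsub>\<BB>\<^esub> b') \<in> f ` carrier \<AA>"
  unfolding exact
  by (simp add: E.mult_closed B.mult_closed s_closed g_minus g_mult section_s B.M.minus_eq_zero_iff)

lemma lft_closed: "b \<in> carrier \<BB> \<Longrightarrow> a \<in> carrier \<AA> \<Longrightarrow> lft b a \<in> carrier \<AA>"
  and rgt_closed: "a \<in> carrier \<AA> \<Longrightarrow> b \<in> carrier \<BB> \<Longrightarrow> rgt a b \<in> carrier \<AA>"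
  and \<beta>_closed: "b \<in> carrier \<BB> \<Longrightarrow> b' \<in> carrier \<BB> \<Longrightarrow> \<beta> b b' \<in> carrier \<AA>"
  unfolding lft_def rgt_def \<beta>_def by (rule fi_closed, rule image_lft image_rgt image_\<beta>; assumption)+

lemma f_lft: "b \<in> carrier \<BB> \<Longrightarrow> a \<in> carrier \<AA> \<Longrightarrow> f (lft b a) = s b \<otimes>\<^bsub>\<EE>\<^esub> f a"
  and f_rgt: "a \<in> carrier \<AA> \<Longrightarrow> b \<in> carrier \<BB> \<Longrightarrow> f (rgt a b) = f a \<otimes>\<^bsub>\<EE>\<^esub> s b"
  and f_\<beta>: "b \<in> carrier \<BB> \<Longrightarrow> b' \<in> carrier \<BB> \<Longrightarrow>
    f (\<beta> b b') = s b \<otimes>\<^bsub>\<EE>\<^esub> s b' \<ominus>\<^bsub>\<EE>\<^esub> s (b \<otimes>\<^bsub>\<BB>\<^esub> b')"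
  unfolding lft_def rgt_def \<beta>_def by (rule f_fi, rule image_lft image_rgt image_\<beta>; assumption)+

lemma s_mult:
  assumes "b \<in> carrier \<BB>" "b' \<in> carrier \<BB>"
  shows "s b \<otimes>\<^bsub>\<EE>\<^esub> s b' = f (\<beta> b b') \<oplus>\<^bsub>\<EE>\<^esub> s (b \<otimes>\<^bsub>\<BB>\<^esub> b')"
  unfolding f_\<beta>[OF assms]
  using assms by (simp add: a_minus_def E.M.a_assoc E.M.l_neg E.mult_closed B.mult_closed s_closed)

text \<open>The section fails to be multiplicative only by an element of the image of
  \<open>f\<close>, and this image has zero product with itself. Against \<open>f a\<close> the
  defect therefore disappears, so the supermodule laws hold without a correction by
  \<open>\<beta>\<close>.\<close>

lemma s_mult_f:
  assumes "b \<in> carrier \<BB>" "b' \<in> carrier \<BB>" "a \<in> carrier \<AA>"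
  shows "(s b \<otimes>\<^bsub>\<EE>\<^esub> s b') \<otimes>\<^bsub>\<EE>\<^esub> f a = s (b \<otimes>\<^bsub>\<BB>\<^esub> b') \<otimes>\<^bsub>\<EE>\<^esub> f a"
    and "f a \<otimes>\<^bsub>\<EE>\<^esub> (s b \<otimes>\<^bsub>\<EE>\<^esub> s b') = f a \<otimes>\<^bsub>\<EE>\<^esub> s (b \<otimes>\<^bsub>\<BB>\<^esub> b')"
  unfolding s_mult[OF assms(1,2)]
  using assms by (simp_all add: E.mult_add_left E.mult_add_right f_closed s_closed \<beta>_closed
      B.mult_closed f_f E.mult_closed)

lemma f_injD: "f x = f y \<Longrightarrow> x \<in> carrier \<AA> \<Longrightarrow> y \<in> carrier \<AA> \<Longrightarrow> x = y"
  using f_inj by (auto dest: inj_onD)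

text \<open>The laws are the Leibniz identity of \<open>\<EE>\<close> with \<open>f a\<close> in the
  first, the third and the second place and lifted elements in the other two, simplified by
  \<open>s_mult_f\<close> and pulled back through the injective \<open>f\<close>.\<close>

lemma section_supermodule: "supermodule K \<BB> \<AA> lft rgt"
proof -
  note lift = bilinear_map_lift[OF A.module_V f_linear f_inj, folded fi_def]
  have "bilinear_map K \<BB> \<AA> \<AA> lft"
    using lift[OF bilinear_map_comp[OF E.bilinear s_linear f_linear] image_lft]
    unfolding lft_def .
  moreover have "bilinear_map K \<AA> \<BB> \<AA> rgt"
    using lift[OF bilinear_map_comp[OF E.bilinear f_linear s_linear] image_rgt]
    unfolding rgt_def .
  moreover have "rgt a x \<in> part \<AA> (i + j)" if "a \<in> part \<AA> i" "x \<in> part \<BB> j" for i j a x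
    unfolding rgt_def
    by (rule fi_part[OF image_rgt[OF A.part_carrier[OF that(1)] B.part_carrier[OF that(2)]]
          E.mult_graded[OF superalgebra_homD(3)[OF f_hom that(1)] s_graded[OF that(2)]]])
  moreover have "lft x a \<in> part \<AA> (i + j)" if "x \<in> part \<BB> i" "a \<in> part \<AA> j" for i j a x
    unfolding lft_def
    by (rule fi_part[OF image_lft[OF B.part_carrier[OF that(1)] A.part_carrier[OF that(2)]]
          E.mult_graded[OF s_graded[OF that(1)] superalgebra_homD(3)[OF f_hom that(2)]]])
  moreover have "rgt a (x \<otimes>\<^bsub>\<BB>\<^esub> y) = rgt (rgt a x) y \<ominus>\<^bsub>\<AA>\<^esub> sgn_pow K (j * l) \<odot>\<^bsub>\<AA>\<^esub> rgt (rgt a y) x \<and>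
      lft x (lft y a) = lft (x \<otimes>\<^bsub>\<BB>\<^esub> y) a \<ominus>\<^bsub>\<AA>\<^esub> sgn_pow K (i * l) \<odot>\<^bsub>\<AA>\<^esub> rgt (lft x a) y \<and>
      lft x (rgt a y) = rgt (lft x a) y \<ominus>\<^bsub>\<AA>\<^esub> sgn_pow K (i * l) \<odot>\<^bsub>\<AA>\<^esub> lft (x \<otimes>\<^bsub>\<BB>\<^esub> y) a"
    if a: "a \<in> part \<AA> i" and x: "x \<in> part \<BB> j" and y: "y \<in> part \<BB> l" for i j l a x y
  proof -
    note c = A.part_carrier[OF a] B.part_carrier[OF x] B.part_carrier[OF y]
    note p = superalgebra_homD(3)[OF f_hom a] s_graded[OF x] s_graded[OF y]
    define \<sigma> \<tau> where "\<sigma> = sgn_pow K (j * l)" and "\<tau> = sgn_pow K (i * l)"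
    have \<sigma>: "\<sigma> \<in> carrier K" "\<tau> \<in> carrier K"
      unfolding \<sigma>_def \<tau>_def by (rule A.sgn_pow_closed)+
    have 1: "f a \<otimes>\<^bsub>\<EE>\<^esub> s (x \<otimes>\<^bsub>\<BB>\<^esub> y) = f a \<otimes>\<^bsub>\<EE>\<^esub> s x \<otimes>\<^bsub>\<EE>\<^esub> s y \<ominus>\<^bsub>\<EE>\<^esub> \<sigma> \<odot>\<^bsub>\<EE>\<^esub> (f a \<otimes>\<^bsub>\<EE>\<^esub> s y \<otimes>\<^bsub>\<EE>\<^esub> s x)"
      using E.leibniz[OF p(1,2,3)] unfolding s_mult_f(2)[OF c(2,3,1)] \<sigma>_def
      by (simp only: mult.commute)
    have 2: "s x \<otimes>\<^bsub>\<EE>\<^esub> (s y \<otimes>\<^bsub>\<EE>\<^esub> f a) =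
        s (x \<otimes>\<^bsub>\<BB>\<^esub> y) \<otimes>\<^bsub>\<EE>\<^esub> f a \<ominus>\<^bsub>\<EE>\<^esub> \<tau> \<odot>\<^bsub>\<EE>\<^esub> (s x \<otimes>\<^bsub>\<EE>\<^esub> f a \<otimes>\<^bsub>\<EE>\<^esub> s y)"
      using E.leibniz[OF p(2,3,1)] unfolding s_mult_f(1)[OF c(2,3,1)] \<tau>_def .
    have 3: "s x \<otimes>\<^bsub>\<EE>\<^esub> (f a \<otimes>\<^bsub>\<EE>\<^esub> s y) =
        s x \<otimes>\<^bsub>\<EE>\<^esub> f a \<otimes>\<^bsub>\<EE>\<^esub> s y \<ominus>\<^bsub>\<EE>\<^esub> \<tau> \<odot>\<^bsub>\<EE>\<^esub> (s (x \<otimes>\<^bsub>\<BB>\<^esub> y) \<otimes>\<^bsub>\<EE>\<^esub> f a)"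
      using E.leibniz[OF p(2,1,3)] unfolding s_mult_f(1)[OF c(2,3,1)] \<tau>_def
      by (simp only: mult.commute)
    note simps = f_lft f_rgt f_minus f_smult lft_closed rgt_closed B.mult_closed c \<sigma>
    have "rgt a (x \<otimes>\<^bsub>\<BB>\<^esub> y) = rgt (rgt a x) y \<ominus>\<^bsub>\<AA>\<^esub> \<sigma> \<odot>\<^bsub>\<AA>\<^esub> rgt (rgt a y) x"
      by (rule f_injD) (simp_all add: simps 1)
    moreover have "lft x (lft y a) = lft (x \<otimes>\<^bsub>\<BB>\<^esub> y) a \<ominus>\<^bsub>\<AA>\<^esub> \<tau> \<odot>\<^bsub>\<AA>\<^esub> rgt (lft x a) y"
      by (rule f_injD) (simp_all add: simps 2)
    moreover have "lft x (rgt a y) = rgt (lft x a) y \<ominus>\<^bsub>\<AA>\<^esub> \<tau> \<odot>\<^bsub>\<AA>\<^esub> lft (x \<otimes>\<^bsub>\<BB>\<^esub> y) a"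
      by (rule f_injD) (simp_all add: simps 3)
    ultimately show ?thesis unfolding \<sigma>_def \<tau>_def by (intro conjI)
  qed
  ultimately show ?thesis
    unfolding supermodule_def by (intro conjI[of "bilinear_map _ _ _ _ _"] conjI[of "\<forall>i. _ i"] allI ballI)
qed

text \<open>Under \<open>f\<close>, an action term combined with its \<open>\<beta>\<close> term is
  a triple product of lifts minus the lift of the triple product in \<open>\<BB>\<close>. The
  identity is thus the Leibniz identity of \<open>\<EE>\<close> minus the image under
  \<open>s\<close> of the one of \<open>\<BB>\<close>.\<close>

lemma section_cocycle:
  assumes b: "b \<in> part \<BB> i" "b' \<in> part \<BB> j" "b'' \<in> part \<BB> l"
  shows "rgt (\<beta> b'' b) b'
        \<ominus>\<^bsub>\<AA>\<^esub> sgn_pow K (i * j) \<odot>\<^bsub>\<AA>\<^esub> rgt (\<beta> b'' b') b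
        \<ominus>\<^bsub>\<AA>\<^esub> lft b'' (\<beta> b b')
        \<oplus>\<^bsub>\<AA>\<^esub> \<beta> (b'' \<otimes>\<^bsub>\<BB>\<^esub> b) b'
        \<ominus>\<^bsub>\<AA>\<^esub> sgn_pow K (i * j) \<odot>\<^bsub>\<AA>\<^esub> \<beta> (b'' \<otimes>\<^bsub>\<BB>\<^esub> b') b
        \<ominus>\<^bsub>\<AA>\<^esub> \<beta> b'' (b \<otimes>\<^bsub>\<BB>\<^esub> b') = \<zero>\<^bsub>\<AA>\<^esub>"
proof -
  define \<sigma> where "\<sigma> = sgn_pow K (i * j)"
  have \<sigma>: "\<sigma> \<in> carrier K" unfolding \<sigma>_def by (rule A.sgn_pow_closed)
  have \<sigma>': "sgn_pow K (j * i) = \<sigma>" unfolding \<sigma>_def by (simp only: mult.commute)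
  note c = B.part_carrier[OF b(1)] B.part_carrier[OF b(2)] B.part_carrier[OF b(3)]
  note cl = c \<sigma> s_closed lft_closed rgt_closed \<beta>_closed B.mult_closed E.mult_closed
  note lE = E.leibniz[OF s_graded[OF b(3)] s_graded[OF b(1)] s_graded[OF b(2)], unfolded \<sigma>']
  note lB = B.leibniz[OF b(3) b(1) b(2), unfolded \<sigma>']
  \<comment> \<open>The mixed product of \<open>s b''\<close> with the lift of the product of
    \<open>b\<close> and \<open>b'\<close> comes from both summands with opposite signs and
    cancels.\<close>
  have L: "f (lft b'' (\<beta> b b') \<oplus>\<^bsub>\<AA>\<^esub> \<beta> b'' (b \<otimes>\<^bsub>\<BB>\<^esub> b')) =
      s b'' \<otimes>\<^bsub>\<EE>\<^esub> (s b \<otimes>\<^bsub>\<EE>\<^esub> s b') \<ominus>\<^bsub>\<EE>\<^esub> s (b'' \<otimes>\<^bsub>\<BB>\<^esub> (b \<otimes>\<^bsub>\<BB>\<^esub> b'))"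
    by (simp add: cl f_add f_lft f_\<beta> E.mult_minus_right)
      (simp add: cl a_minus_def E.M.a_assoc E.M.l_neg E.M.r_neg2 E.M.r_neg1)
  \<comment> \<open>Proved for general \<open>x\<close> and \<open>y\<close> because it is needed
    for \<open>b\<close>, \<open>b'\<close> and again with these two interchanged.\<close>
  have R: "f (rgt (\<beta> b'' x) y \<oplus>\<^bsub>\<AA>\<^esub> \<beta> (b'' \<otimes>\<^bsub>\<BB>\<^esub> x) y) =
      (s b'' \<otimes>\<^bsub>\<EE>\<^esub> s x) \<otimes>\<^bsub>\<EE>\<^esub> s y \<ominus>\<^bsub>\<EE>\<^esub> s ((b'' \<otimes>\<^bsub>\<BB>\<^esub> x) \<otimes>\<^bsub>\<BB>\<^esub> y)"
    if "x \<in> carrier \<BB>" "y \<in> carrier \<BB>" for x y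
    using that
    by (simp add: cl f_add f_rgt f_\<beta> E.mult_minus_left)
      (simp add: cl a_minus_def E.M.a_assoc E.M.l_neg E.M.r_neg2 E.M.r_neg1)
  have "lft b'' (\<beta> b b') \<oplus>\<^bsub>\<AA>\<^esub> \<beta> b'' (b \<otimes>\<^bsub>\<BB>\<^esub> b') =
      (rgt (\<beta> b'' b) b' \<oplus>\<^bsub>\<AA>\<^esub> \<beta> (b'' \<otimes>\<^bsub>\<BB>\<^esub> b) b') \<ominus>\<^bsub>\<AA>\<^esub>
      \<sigma> \<odot>\<^bsub>\<AA>\<^esub> (rgt (\<beta> b'' b') b \<oplus>\<^bsub>\<AA>\<^esub> \<beta> (b'' \<otimes>\<^bsub>\<BB>\<^esub> b') b)" (is "?l = ?p \<ominus>\<^bsub>\<AA>\<^esub> \<sigma> \<odot>\<^bsub>\<AA>\<^esub> ?q")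
  proof (rule f_injD)
    have pq: "?p \<in> carrier \<AA>" "?q \<in> carrier \<AA>" by (simp_all add: cl)
    have "f (?p \<ominus>\<^bsub>\<AA>\<^esub> \<sigma> \<odot>\<^bsub>\<AA>\<^esub> ?q) = f ?p \<ominus>\<^bsub>\<EE>\<^esub> \<sigma> \<odot>\<^bsub>\<EE>\<^esub> f ?q"
      using pq \<sigma> by (simp only: f_minus f_smult A.smult_closed)
    also have "\<dots> = s b'' \<otimes>\<^bsub>\<EE>\<^esub> (s b \<otimes>\<^bsub>\<EE>\<^esub> s b') \<ominus>\<^bsub>\<EE>\<^esub> s (b'' \<otimes>\<^bsub>\<BB>\<^esub> (b \<otimes>\<^bsub>\<BB>\<^esub> b'))"
      unfolding R[OF c(1,2)] R[OF c(2,1)] lE lB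
      by (simp add: cl s_minus s_smult)
        (simp add: cl a_minus_def E.smult_r_distr E.smult_r_minus E.M.minus_add E.M.a_ac)
    finally show "f ?l = f (?p \<ominus>\<^bsub>\<AA>\<^esub> \<sigma> \<odot>\<^bsub>\<AA>\<^esub> ?q)" unfolding L by simp
  qed (simp_all add: cl)
  then show ?thesis
    unfolding \<sigma>_def[symmetric]
    by (subst A.M.six_term_iff) (simp_all add: cl A.smult_r_distr)
qed

lemma section_data: "ext_data K \<AA> \<BB> B lft rgt \<beta>"
proof -
  have "bilinear_map K \<BB> \<BB> \<EE> (\<lambda>b b'. s b \<otimes>\<^bsub>\<EE>\<^esub> s b' \<ominus>\<^bsub>\<EE>\<^esub> s (b \<otimes>\<^bsub>\<BB>\<^esub> b'))"
    by (rule bilinear_map_diff[OF B.module_V B.module_V E.module_V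
          bilinear_map_comp[OF E.bilinear s_linear s_linear]
          bilinear_map_comp_left[OF B.bilinear s_linear]])
  from bilinear_map_lift[OF A.module_V f_linear f_inj this image_\<beta>, folded fi_def]
  have "bilinear_map K \<BB> \<BB> \<AA> \<beta>" unfolding \<beta>_def .
  moreover have "\<beta> b b' \<in> part \<AA> (i + j)" if "b \<in> B i" "b' \<in> B j" for b b' i j
  proof -
    note p = bB_part[OF that(1)] bB_part[OF that(2)]
    show ?thesis
      unfolding \<beta>_def
      by (rule fi_part[OF image_\<beta>[OF B.part_carrier[OF p(1)] B.part_carrier[OF p(2)]]
            E.part_diff[OF E.mult_graded[OF s_graded[OF p(1)] s_graded[OF p(2)]]
              s_graded[OF B.mult_graded[OF p]]]])
  qed
  moreover note section_supermodule section_cocycle[OF bB_part bB_part bB_part]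
  ultimately show ?thesis
    unfolding ext_data_def by (intro conjI allI ballI)
qed

text \<open>The map adds \<open>f a\<close> and \<open>s b\<close>; it is multiplicative by
  \<open>s_mult\<close> and because the image of \<open>f\<close> has zero product. Applying
  \<open>g\<close> recovers \<open>b\<close>, after which \<open>f\<close> being injective recovers
  \<open>a\<close>. It is onto because \<open>e\<close> minus the lift of \<open>g e\<close> lies in
  the kernel of \<open>g\<close>.\<close>

lemma section_iso: "superalgebra_isomorphic K \<EE> (ext_alg K \<AA> \<BB> A B lft rgt \<beta>)"
proof -
  interpret X: extension_datum K \<AA> \<BB> A B lft rgt \<beta>
    by unfold_locales (rule section_data)
  let ?D = "ext_model \<AA> \<BB> lft rgt \<beta>"
  define \<theta> where "\<theta> = (\<lambda>p. f (fst p) \<oplus>\<^bsub>\<EE>\<^esub> s (snd p))"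
  have lin: "linear_map K ?D \<EE> \<theta>"
    unfolding \<theta>_def
    by (rule linear_map_add[OF X.D_module E.module_V linear_map_comp[OF X.fst_linear f_linear]
          linear_map_comp[OF X.snd_linear s_linear]])
  have hom: "superalgebra_hom K ?D \<EE> \<theta>"
  proof (rule superalgebra_homI[OF lin])
    fix x y assume "x \<in> carrier ?D" "y \<in> carrier ?D"
    then obtain a b a' b' where x: "x = (a, b)" "a \<in> carrier \<AA>" "b \<in> carrier \<BB>"
      and y: "y = (a', b')" "a' \<in> carrier \<AA>" "b' \<in> carrier \<BB>"
      by (auto simp: ext_model_simps)
    note cl = f_closed s_closed lft_closed rgt_closed \<beta>_closed B.mult_closed E.mult_closed
    have "\<theta> x \<otimes>\<^bsub>\<EE>\<^esub> \<theta> y = f a \<otimes>\<^bsub>\<EE>\<^esub> s b' \<oplus>\<^bsub>\<EE>\<^esub> s b \<otimes>\<^bsub>\<EE>\<^esub> f a' \<oplus>\<^bsub>\<EE>\<^esub> s b \<otimes>\<^bsub>\<EE>\<^esub> s b'"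
      using x y by (simp add: \<theta>_def cl E.mult_add_left E.mult_add_right f_f E.M.a_ac)
    also have "\<dots> = f (rgt a b' \<oplus>\<^bsub>\<AA>\<^esub> lft b a' \<oplus>\<^bsub>\<AA>\<^esub> \<beta> b b') \<oplus>\<^bsub>\<EE>\<^esub> s (b \<otimes>\<^bsub>\<BB>\<^esub> b')"
      unfolding s_mult[OF x(3) y(3)] using x y by (simp add: cl f_add f_lft f_rgt E.M.a_ac)
    also have "\<dots> = \<theta> (x \<otimes>\<^bsub>?D\<^esub> y)"
      using x y by (simp add: \<theta>_def ext_model_simps)
    finally show "\<theta> (x \<otimes>\<^bsub>?D\<^esub> y) = \<theta> x \<otimes>\<^bsub>\<EE>\<^esub> \<theta> y" by simp
  next
    fix i x assume "x \<in> part ?D i"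
    then show "\<theta> x \<in> part \<EE> i"
      unfolding \<theta>_def
      by (intro E.part_add superalgebra_homD(3)[OF f_hom] s_graded) (auto simp: ext_model_simps)
  qed
  have g\<theta>: "g (\<theta> (a, b)) = b" if "a \<in> carrier \<AA>" "b \<in> carrier \<BB>" for a b
    using that by (simp add: \<theta>_def g_add f_closed s_closed g_f section_s)
  have "inj_on \<theta> (carrier ?D)"
  proof (rule inj_onI)
    fix x y assume "x \<in> carrier ?D" "y \<in> carrier ?D" and eq: "\<theta> x = \<theta> y"
    then obtain a b a' b' where x: "x = (a, b)" "a \<in> carrier \<AA>" "b \<in> carrier \<BB>"
      and y: "y = (a', b')" "a' \<in> carrier \<AA>" "b' \<in> carrier \<BB>"
      by (auto simp: ext_model_simps)
    have bb: "b = b'" using g\<theta>[OF x(2,3)] g\<theta>[OF y(2,3)] eq unfolding x(1) y(1) by simp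
    have "f a = f a'"
      using eq x y unfolding bb \<theta>_def
      by (simp add: f_closed s_closed E.M.add.right_cancel)
    then show "x = y" unfolding x(1) y(1) bb using f_injD x y by simp
  qed
  moreover have "\<theta> ` carrier ?D = carrier \<EE>"
  proof
    show "\<theta> ` carrier ?D \<subseteq> carrier \<EE>" using linear_mapD(1)[OF lin] by blast
    show "carrier \<EE> \<subseteq> \<theta> ` carrier ?D"
    proof
      fix e assume e: "e \<in> carrier \<EE>"
      define b where "b = g e"
      have b: "b \<in> carrier \<BB>" unfolding b_def by (rule linear_mapD(1)[OF g_linear e])
      have "e \<ominus>\<^bsub>\<EE>\<^esub> s b \<in> f ` carrier \<AA>"
        unfolding exact using e b
        by (simp add: s_closed g_minus section_s B.M.minus_eq_zero_iff b_def)
      then obtain a where a: "a \<in> carrier \<AA>" "e \<ominus>\<^bsub>\<EE>\<^esub> s b = f a" by blast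
      have "e = (e \<ominus>\<^bsub>\<EE>\<^esub> s b) \<oplus>\<^bsub>\<EE>\<^esub> s b"
        using e b by (simp add: a_minus_def s_closed E.M.a_assoc E.M.l_neg)
      then have "e = \<theta> (a, b)" unfolding a(2) \<theta>_def by simp
      moreover have "(a, b) \<in> carrier ?D" using a b by (simp add: ext_model_simps)
      ultimately show "e \<in> \<theta> ` carrier ?D" by blast
    qed
  qed
  ultimately show ?thesis
    using X.iso_of_model_iso[OF E.superalgebra_axioms hom] unfolding bij_betw_def by blast
qed

end

text \<open>What remains is a section that is linear and graded at once: homogeneous preimages are
  chosen on the basis of \<open>\<BB>\<close> and extended linearly, so both properties follow from
  the values on basis elements.\<close>

lemma (in extension_bases) data_of_extension:
  fixes \<EE> :: "('k, 'e) superalgebra"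
  assumes "is_extension K \<EE> \<BB> \<AA>"
  shows "\<exists>lft rgt \<beta>. ext_data K \<AA> \<BB> B lft rgt \<beta> \<and>
    superalgebra_isomorphic K \<EE> (ext_alg K \<AA> \<BB> A B lft rgt \<beta>)"
proof -
  obtain f g where E: "leibniz_superalgebra K \<EE>"
    and f: "superalgebra_hom K \<AA> \<EE> f" "inj_on f (carrier \<AA>)"
    and g: "superalgebra_hom K \<EE> \<BB> g"
    and ex: "f ` carrier \<AA> = {x \<in> carrier \<EE>. g x = \<zero>\<^bsub>\<BB>\<^esub>}" and sur: "g ` carrier \<EE> = carrier \<BB>"
    using assms unfolding is_extension_def by blast
  interpret E: leibniz_superalgebra K \<EE> by (rule E)
  note gl = superalgebra_homD(1)[OF g]
  \<comment> \<open>Any preimage may be replaced by its component of parity \<open>i\<close>: the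
    images of its components split \<open>b\<close>, and a homogeneous element is its own
    component.\<close>
  have lift: "\<exists>e\<in>part \<EE> i. g e = b" if b: "b \<in> part \<BB> i" for b i
  proof -
    have "b \<in> g ` carrier \<EE>" unfolding sur by (rule B.part_carrier[OF b])
    then obtain e where e: "e \<in> carrier \<EE>" "b = g e" by blast
    obtain u v where uv: "e = u \<oplus>\<^bsub>\<EE>\<^esub> v" "u \<in> part \<EE> 0" "v \<in> part \<EE> 1"
      using E.part_span[OF e(1)] by blast
    have "b = g u \<oplus>\<^bsub>\<BB>\<^esub> g v"
      unfolding e(2) uv(1)
      by (rule linear_mapD(2)[OF gl E.part_carrier[OF uv(2)] E.part_carrier[OF uv(3)]])
    then have "b = (if i = 0 then g u else g v)"
      using B.part_sum_unique[OF superalgebra_homD(3)[OF g uv(2)] superalgebra_homD(3)[OF g uv(3)]] b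
      by simp
    with uv show ?thesis by (cases i) auto
  qed
  \<comment> \<open>One choice has to serve every parity of \<open>b\<close>. A nonzero element has
    only one parity; zero has both, and for it the preimage zero works.\<close>
  have "\<exists>e. g e = b \<and> (\<forall>i. b \<in> part \<BB> i \<longrightarrow> e \<in> part \<EE> i)" if b: "b \<in> bB" for b
  proof (cases "b = \<zero>\<^bsub>\<BB>\<^esub>")
    case True
    then show ?thesis
      using linear_map_zero[OF E.module_V B.module_V gl] E.part_zero by blast
  next
    case False
    obtain i where i: "b \<in> part \<BB> i" using b bB_part by blast
    then obtain e where "e \<in> part \<EE> i" "g e = b" using lift by blast
    moreover have "j = i" if "b \<in> part \<BB> j" for j
      using B.part_disjoint[OF i that] False by blast
    ultimately show ?thesis by blast
  qed
  then obtain \<sigma> where \<sigma>: "\<And>b. b \<in> bB \<Longrightarrow> g (\<sigma> b) = b"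
    "\<And>b i. b \<in> bB \<Longrightarrow> b \<in> part \<BB> i \<Longrightarrow> \<sigma> b \<in> part \<EE> i"
    by metis
  have \<sigma>c: "\<sigma> b \<in> carrier \<EE>" if b: "b \<in> bB" for b
    using \<sigma>(2)[OF b] bB_part b E.part_carrier by blast
  define s where "s = read_in K \<BB> bB \<EE> \<sigma>"
  have s_lin: "linear_map K \<BB> \<EE> s"
    unfolding s_def by (rule linear_map_read_in[OF B.module_V E.module_V full_basis_B]) (auto intro: \<sigma>c)
  have s_basis: "s b = \<sigma> b" if "b \<in> bB" for b
    unfolding s_def by (rule read_in_basis[where g = \<sigma>, OF B.module_V E.module_V full_basis_B that \<sigma>c[OF that]])
  have id: "linear_map K \<BB> \<BB> (\<lambda>x. x)" by (rule linear_mapI) auto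
  interpret sectioned_extension K \<AA> \<BB> A B \<EE> f g s
  proof unfold_locales
    show "s b \<in> part \<EE> i" if "b \<in> part \<BB> i" for b i
    proof (rule linear_map_span_part[OF B.module_V E.superalgebra_axioms s_lin])
      show "B i \<subseteq> carrier \<BB>" "b \<in> lin_span K \<BB> (B i)"
        using basis_B[of i] that unfolding linear_basis_def by auto
      fix x assume x: "x \<in> B i"
      then have "x \<in> bB" by (metis UnCI bit_not_zero_iff)
      then show "s x \<in> part \<EE> i" using \<sigma>(2) bB_part[OF x] s_basis by simp
    qed
    show "g (s b) = b" if "b \<in> carrier \<BB>" for b
      by (rule linear_map_eq_on_basis[OF B.module_V B.module_V full_basis_B
            linear_map_comp[OF s_lin gl] id _ that]) (simp only: s_basis \<sigma>(1))
  qed (fact f g ex s_lin)+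
  show ?thesis using section_data section_iso by blast
qed

section \<open>The characterization of extensions and the product on the direct sum\<close>

theorem corollary6p12:
  fixes K :: "('k, 'r) ring_scheme"
    and \<AA> :: "('k, 'a) superalgebra"
    and \<BB> :: "('k, 'b) superalgebra"
    and \<EE> :: "('k, 'e) superalgebra"
    and A :: "bit \<Rightarrow> 'a set"
    and B :: "bit \<Rightarrow> 'b set"
  assumes "field K"
    and "leibniz_superalgebra K \<AA>"
    and "leibniz_superalgebra K \<BB>"
    and "\<And>i. linear_basis K \<AA> (part \<AA> i) (A i)"
    and "\<And>i. linear_basis K \<BB> (part \<BB> i) (B i)"
    and "\<And>a a'. a \<in> A 0 \<union> A 1 \<Longrightarrow> a' \<in> A 0 \<union> A 1 \<Longrightarrow> a \<otimes>\<^bsub>\<AA>\<^esub> a' = \<zero>\<^bsub>\<AA>\<^esub>"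
    and "leibniz_superalgebra K \<EE>"
  shows "(is_extension K \<EE> \<BB> \<AA> \<longleftrightarrow>
      (\<exists>lft rgt \<beta>. ext_data K \<AA> \<BB> B lft rgt \<beta> \<and>
        superalgebra_isomorphic K \<EE> (ext_alg K \<AA> \<BB> A B lft rgt \<beta>)))
    \<and> (\<forall>lft rgt \<beta>. ext_data K \<AA> \<BB> B lft rgt \<beta> \<and>
        superalgebra_isomorphic K \<EE> (ext_alg K \<AA> \<BB> A B lft rgt \<beta>) \<longrightarrow>
        (let P = ext_alg K \<AA> \<BB> A B lft rgt \<beta>;
             \<phi> = ext_map K \<AA> \<BB> A B lft rgt \<beta>
         in linear_map K (direct_sum \<AA> \<BB>) P \<phi> \<and>
            bij_betw \<phi> (carrier (direct_sum \<AA> \<BB>)) (carrier P) \<and>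
            (\<forall>a\<in>carrier \<AA>. \<forall>a'\<in>carrier \<AA>. \<forall>b\<in>carrier \<BB>. \<forall>b'\<in>carrier \<BB>.
              \<phi> (a, b) \<otimes>\<^bsub>P\<^esub> \<phi> (a', b') =
                \<phi> (rgt a b' \<oplus>\<^bsub>\<AA>\<^esub> lft b a' \<oplus>\<^bsub>\<AA>\<^esub> \<beta> b b', b \<otimes>\<^bsub>\<BB>\<^esub> b'))))"
proof -
  interpret extension_bases K \<AA> \<BB> A B
    by (intro extension_bases.intro extension_bases_axioms.intro assms)
  have datum: "extension_datum K \<AA> \<BB> A B lft rgt \<beta>" if "ext_data K \<AA> \<BB> B lft rgt \<beta>" for lft rgt \<beta>
    by (intro extension_datum.intro extension_datum_axioms.intro extension_bases_axioms that)
  show ?thesis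
  proof (intro conjI iffI allI impI)
    assume "is_extension K \<EE> \<BB> \<AA>"
    then show "\<exists>lft rgt \<beta>. ext_data K \<AA> \<BB> B lft rgt \<beta> \<and>
        superalgebra_isomorphic K \<EE> (ext_alg K \<AA> \<BB> A B lft rgt \<beta>)"
      by (rule data_of_extension)
  next
    assume "\<exists>lft rgt \<beta>. ext_data K \<AA> \<BB> B lft rgt \<beta> \<and>
        superalgebra_isomorphic K \<EE> (ext_alg K \<AA> \<BB> A B lft rgt \<beta>)"
    then show "is_extension K \<EE> \<BB> \<AA>"
      using extension_datum.extension_of_iso[OF datum assms(7)] by blast
  next
    fix lft rgt \<beta>
    assume "ext_data K \<AA> \<BB> B lft rgt \<beta> \<and>
        superalgebra_isomorphic K \<EE> (ext_alg K \<AA> \<BB> A B lft rgt \<beta>)"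
    then interpret extension_datum K \<AA> \<BB> A B lft rgt \<beta> using datum by blast
    \<comment> \<open>This identification and \<open>linear_map_direct_sum_iff\<close> carry the
      statements about \<open>\<phi>\<close> on the model over to the direct sum.\<close>
    have c: "carrier (direct_sum \<AA> \<BB>) = carrier D"
      by (simp add: direct_sum_def ext_model_simps)
    have "\<phi> (a, b) \<otimes>\<^bsub>P\<^esub> \<phi> (a', b') = \<phi> (rgt a b' \<oplus>\<^bsub>\<AA>\<^esub> lft b a' \<oplus>\<^bsub>\<AA>\<^esub> \<beta> b b', b \<otimes>\<^bsub>\<BB>\<^esub> b')"
      if "a \<in> carrier \<AA>" "a' \<in> carrier \<AA>" "b \<in> carrier \<BB>" "b' \<in> carrier \<BB>" for a a' b b'
      using \<phi>_mult[of "(a, b)" "(a', b')"] that by (simp add: ext_model_simps)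
    then show "let P = ext_alg K \<AA> \<BB> A B lft rgt \<beta>; \<phi> = ext_map K \<AA> \<BB> A B lft rgt \<beta>
         in linear_map K (direct_sum \<AA> \<BB>) P \<phi> \<and>
            bij_betw \<phi> (carrier (direct_sum \<AA> \<BB>)) (carrier P) \<and>
            (\<forall>a\<in>carrier \<AA>. \<forall>a'\<in>carrier \<AA>. \<forall>b\<in>carrier \<BB>. \<forall>b'\<in>carrier \<BB>.
              \<phi> (a, b) \<otimes>\<^bsub>P\<^esub> \<phi> (a', b') =
                \<phi> (rgt a b' \<oplus>\<^bsub>\<AA>\<^esub> lft b a' \<oplus>\<^bsub>\<AA>\<^esub> \<beta> b b', b \<otimes>\<^bsub>\<BB>\<^esub> b'))"
      unfolding Let_def c linear_map_direct_sum_iff[where lft = lft and rgt = rgt and \<beta> = \<beta>]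
      using \<phi>_linear \<phi>_bij by blast
  qed
qed

end
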